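(* Let $1<p<\infty$, $\alpha\in\mathbb R$, $\mathbb X=L^p(\log L)^\alpha(\mathbb T)$ with the Luxemburg norm $\|\cdot\|_{L^\Phi}$, and $\mathcal D=\{e^{inx}\}_{n\in\mathbb Z}$. Let $\tau\in(0,1]$. There is a constant $C>1$ such that every $\tau$-WCGA satisfies $$\|f-\mathcal G_{\varphi(N)}(f)\|\le2\,\sigma_N(f)\qquad\forall f\in\mathbb X,\ N\ge2,$$ where $\varphi(N)$ is the integer part of $C$ times: $N\log N$ if $p>2$; $N\log\log N$ if $p=2,\alpha>0$; $N$ if $p=2,\alpha=0$; $N(\log N)^{4\alpha_-}\log\log N$ if $p=2,\alpha<0$; $N^{p'-1}(\log N)^{p'\alpha_--p'\alpha}\log N$ if $1<p<2$.
   Context: $\mathbb T\equiv[-\pi,\pi)$ with Lebesgue measure. $p'=p/(p-1)$, $\alpha_\pm=\max\{\pm\alpha,0\}$. $L^p(\log L)^\alpha(\mathbb T)$ is the Orlicz space $L^\Phi$ with $\Phi(t)=\int_0^t s^{p-1}(\log(c+s))^{\alpha p}\,ds$ ($c>1$ fixed, large enough that $\Phi$ is a Young function), norm $\|f\|_{L^\Phi}=\inf\{\lambda>0:\int_{\mathbb T}\Phi(|f|/\lambda)\le1\}$. For $f\ne0$, $F_f$ is the norming functional ($\|F_f\|=1$, $F_f(f)=\|f\|$). $\Sigma_N$ = linear combinations of at most $N$ dictionary elements, $\sigma_N(f)=\mathrm{dist}(f,\Sigma_N)$. A $\tau$-WCGA: for $f\ne0$, $f_0=f$; at step $n+1$ choose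 any $\phi_{i_{n+1}}\in\mathcal D$ with $|F_{f_n}(\phi_{i_{n+1}})|\ge\tau\sup_{\phi\in\mathcal D}|F_{f_n}(\phi)|$, let $\mathcal G_{n+1}(f)$ be a best approximation of $f$ from $\mathrm{span}\{\phi_{i_1},\dots,\phi_{i_{n+1}}\}$, $f_{n+1}=f-\mathcal G_{n+1}(f)$; if $f_n=0$ then $\mathcal G_{n+k}(f)=f$ for all $k$.
   Formalization: Each log in φ(N) is read as max(1, ln), iterated for log log; literally, for p=2, α≠0, N=2 one has log log 2 ≤ 0, so φ(2) ≤ 0 and the claim fails (e.g. f=e^{ix}); elsewhere the change is only by bounded factors absorbed in C. *)

theory Defs
  imports "HOL-Analysis.Analysis"
begin

definition torus :: "real set" where
  "torus = {-pi..<pi}"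

definition young_function :: "(real \<Rightarrow> real) \<Rightarrow> bool" where
  "young_function \<Phi> \<longleftrightarrow> convex_on {0..} \<Phi> \<and> \<Phi> 0 = 0 \<and> (\<forall>t>0. 0 < \<Phi> t)
      \<and> filterlim \<Phi> at_top at_top"

definition PhiLL :: "real \<Rightarrow> real \<Rightarrow> real \<Rightarrow> real \<Rightarrow> real" where
  "PhiLL p \<alpha> c t = integral {0..t} (\<lambda>s. s powr (p - 1) * (ln (c + s)) powr (\<alpha> * p))"

definition orlicz :: "(real \<Rightarrow> real) \<Rightarrow> (real \<Rightarrow> complex) set" where
  "orlicz \<Phi> = {f. f \<in> borel_measurable (lebesgue_on torus) \<and>
      (\<exists>r>0. (\<integral>\<^sup>+x. ennreal (\<Phi> (cmod (f x) / r)) \<partial>(lebesgue_on torus)) < \<infinity>)}"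

definition lux :: "(real \<Rightarrow> real) \<Rightarrow> (real \<Rightarrow> complex) \<Rightarrow> real" where
  "lux \<Phi> f = Inf {r. 0 < r \<and>
      (\<integral>\<^sup>+x. ennreal (\<Phi> (cmod (f x) / r)) \<partial>(lebesgue_on torus)) \<le> 1}"

definition trig :: "int \<Rightarrow> real \<Rightarrow> complex" where
  "trig n = (\<lambda>x. cis (real_of_int n * x))"

definition norming :: "(real \<Rightarrow> real) \<Rightarrow> ((real \<Rightarrow> complex) \<Rightarrow> complex) \<Rightarrow> (real \<Rightarrow> complex) \<Rightarrow> bool" where
  "norming \<Phi> F g \<longleftrightarrow>
     (\<forall>u\<in>orlicz \<Phi>. \<forall>v\<in>orlicz \<Phi>. F (\<lambda>x. u x + v x) = F u + F v) \<and>
     (\<forall>a::complex. \<forall>u\<in>orlicz \<Phi>. F (\<lambda>x. a * u x) = a * F u) \<and>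
     (\<forall>u\<in>orlicz \<Phi>. cmod (F u) \<le> lux \<Phi> u) \<and>
     F g = complex_of_real (lux \<Phi> g)"

definition SigmaN :: "nat \<Rightarrow> (real \<Rightarrow> complex) set" where
  "SigmaN N = {(\<lambda>x. \<Sum>n\<in>S. a n * trig n x) | S a. finite S \<and> card S \<le> N}"

definition sigmaN :: "(real \<Rightarrow> real) \<Rightarrow> nat \<Rightarrow> (real \<Rightarrow> complex) \<Rightarrow> real" where
  "sigmaN \<Phi> N f = Inf {lux \<Phi> (\<lambda>x. f x - g x) | g. g \<in> SigmaN N}"

definition chosen_span :: "(nat \<Rightarrow> int) \<Rightarrow> nat \<Rightarrow> (real \<Rightarrow> complex) set" where
  "chosen_span idx n = {(\<lambda>x. \<Sum>k\<in>{1..n}. a k * trig (idx k) x) | a. True}"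

definition best_approx :: "(real \<Rightarrow> real) \<Rightarrow> (real \<Rightarrow> complex) \<Rightarrow> (real \<Rightarrow> complex) set
    \<Rightarrow> (real \<Rightarrow> complex) \<Rightarrow> bool" where
  "best_approx \<Phi> f V G \<longleftrightarrow> G \<in> V \<and> (\<forall>g\<in>V. lux \<Phi> (\<lambda>x. f x - G x) \<le> lux \<Phi> (\<lambda>x. f x - g x))"

definition wcga :: "(real \<Rightarrow> real) \<Rightarrow> real \<Rightarrow> (real \<Rightarrow> complex) \<Rightarrow> (nat \<Rightarrow> int)
    \<Rightarrow> (nat \<Rightarrow> (real \<Rightarrow> complex) \<Rightarrow> complex) \<Rightarrow> (nat \<Rightarrow> real \<Rightarrow> complex) \<Rightarrow> bool" where
  "wcga \<Phi> \<tau> f idx F G \<longleftrightarrow>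
     G 0 = (\<lambda>x. 0) \<and>
     (\<forall>n. (lux \<Phi> (\<lambda>x. f x - G n x) = 0 \<longrightarrow> G (Suc n) = f) \<and>
          (lux \<Phi> (\<lambda>x. f x - G n x) \<noteq> 0 \<longrightarrow>
              norming \<Phi> (F n) (\<lambda>x. f x - G n x) \<and>
              cmod (F n (trig (idx (Suc n)))) \<ge> \<tau> * (SUP m. cmod (F n (trig m))) \<and>
              best_approx \<Phi> f (chosen_span idx (Suc n)) (G (Suc n))))"

text \<open>Logarithm convention: lg x = max 1 (ln x), so that log N, log log N are >= 1 for N >= 2.\<close>
definition lg :: "real \<Rightarrow> real" where
  "lg x = max 1 (ln x)"

definition neg_part :: "real \<Rightarrow> real" where
  "neg_part a = max (- a) 0"

definition phiN :: "real \<Rightarrow> real \<Rightarrow> real \<Rightarrow> nat \<Rightarrow> nat" where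
  "phiN p \<alpha> C N = nat \<lfloor>C *
     (if p > 2 then real N * lg (real N)
      else if p = 2 then
        (if \<alpha> > 0 then real N * lg (lg (real N))
         else if \<alpha> = 0 then real N
         else real N * lg (real N) powr (4 * neg_part \<alpha>) * lg (lg (real N)))
      else real N powr (p / (p - 1) - 1)
             * lg (real N) powr (p / (p - 1) * neg_part \<alpha> - p / (p - 1) * \<alpha>) * lg (real N))\<rfloor>"

end

theory Submission
  imports Defs
begin

text \<open>
  Write \<open>\<Phi>\<close> for the Young function and \<open>\<phi>\<close> for its derivative.  A second-order
  expansion of \<open>\<Phi>\<close> shows that the Luxemburg norm has a modulus of smoothness of order
  \<open>\<omega>(\<lambda>) = \<lambda>\<^sup>q (1 + \<bar>ln \<lambda>\<bar> / ln c)\<^sup>\<beta>\<close> with \<open>q = min p 2\<close>, so a greedy step gains a factor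
  \<open>1 - \<lambda> \<bar>F(e\<^sub>i)\<bar> + K \<omega>(\<lambda>)\<close>, and norming functionals annihilate the exponentials chosen so far.
  Splitting at a suitable level shows that \<open>\<Sum>\<^sub>A \<bar>x\<^sub>i\<bar> \<le> w(n) \<parallel>h\<parallel>\<close> for the coefficients \<open>x\<^sub>i\<close>
  of a trigonometric polynomial \<open>h\<close> on any set \<open>A\<close> of at most \<open>n\<close> frequencies; this bounds
  \<open>\<bar>F(e\<^sub>i)\<bar>\<close> from below at the chosen frequency.  Let \<open>\<Gamma>\<close> be the set of frequencies of the
  \<open>N\<close>-term competitor that are still missing.  Comparing the norms that survive after the best
  deletion of \<open>0, 1, 2, 4, \<dots>\<close> elements of \<open>\<Gamma>\<close>, one finds an \<open>L\<close> such that a number of steps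
  proportional to \<open>2\<^sup>L\<close> either makes the error small or exhausts a comparable number of
  elements of \<open>\<Gamma>\<close>; the norm of the partial sum projections enters only logarithmically.
  Induction on the size of \<open>\<Gamma>\<close> then gives the claim.
\<close>

section \<open>The Young function\<close>

text \<open>The obstacle is that the exponentials need not be unconditional in \<open>X\<close>:
  restricting a polynomial to some of its frequencies may enlarge its norm by a factor
  \<open>U\<close> that depends on \<open>N\<close>. A phase of the algorithm is therefore run until
  the error has dropped by the factor \<open>7 * U\<close>. As each step contracts the error
  geometrically, this costs only a factor \<open>ln (7 * U)\<close>. A crude polynomial bound for
  \<open>U\<close> thus accounts for log N when p \<noteq> 2. For p = 2 comparison with the l2 norm
  makes \<open>U\<close> a power of log N, hence log log N, or a constant if \<alpha> = 0. The
  number 7 closes the induction: after the last phase the missing part of the competitor has norm at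
  most \<open>U * (3/2) * 4 / (7 * U)\<close>, that is 6/7, of the best deletion norm that it would
  have to reach if too few frequencies had been found. The other factor comes from one step: with
  \<open>n\<close> relevant frequencies the gain is of order \<open>\<lambda> / w(n)\<close>, with
  \<lambda> as large as the remainder \<omega>(\<lambda>) allows. Solving \<omega>(\<lambda>) ~
  \<open>\<lambda> / w(n)\<close> yields the powers of N and log N in \<phi>(N).\<close>

lemma powr_le_scaled:
  fixes x y l b :: real
  assumes "0 < x" "x \<le> y" "y \<le> l * x"
  shows "x powr b \<le> l powr neg_part b * y powr b"
    and "y powr b \<le> l powr neg_part (- b) * x powr b"
proof -
  have "1 * x \<le> l * x" using assms by linarith
  then have l: "1 \<le> l" using assms mult_right_le_imp_le[of 1 x l] by simp
  show "x powr b \<le> l powr neg_part b * y powr b"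
  proof (cases "0 \<le> b")
    case False
    then have "l powr (- b) * (l * x) powr b \<le> l powr (- b) * y powr b"
      using assms l by (intro mult_left_mono powr_mono2') auto
    moreover have "l powr (- b) * (l * x) powr b = x powr b"
      using assms l by (simp add: powr_mult mult.assoc[symmetric] flip: powr_add)
    ultimately show ?thesis using False by (simp add: neg_part_def)
  qed (use assms l in \<open>simp add: neg_part_def powr_mono2\<close>)
  show "y powr b \<le> l powr neg_part (- b) * x powr b"
  proof (cases "0 \<le> b")
    case True
    then show ?thesis
      using assms l powr_mono2[of b y "l * x"] by (simp add: neg_part_def powr_mult max_def)
  qed (use assms l in \<open>simp add: neg_part_def powr_mono2'\<close>)
qed

text \<open>Measures how much \<open>ln (c + s)\<close> can change when \<open>s\<close> is dilated
  by \<open>x\<close>. The change is at most |ln x| additively; since \<open>ln (c + s)\<close> is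
  at least \<open>ln c\<close>, division by \<open>ln c\<close> makes it a multiplicative
  factor.\<close>

definition logfac :: "real \<Rightarrow> real \<Rightarrow> real" where
  "logfac c x = 1 + \<bar>ln x\<bar> / ln c"

lemma logfac_ge1: "1 < c \<Longrightarrow> 1 \<le> logfac c x"
  by (simp add: logfac_def)

lemma logfac_mult:
  assumes "1 < c" "0 < x" "0 < y"
  shows "logfac c (x * y) \<le> logfac c x * logfac c y"
proof -
  have "logfac c (x*y) = 1 + \<bar>ln x + ln y\<bar> / ln c"
    using assms by (simp add: logfac_def ln_mult)
  also have "\<dots> \<le> 1 + (\<bar>ln x\<bar> + \<bar>ln y\<bar>) / ln c"
    using assms by (intro add_left_mono divide_right_mono abs_triangle_ineq) auto
  also have "\<dots> \<le> logfac c x * logfac c y"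
    using assms by (simp add: logfac_def algebra_simps add_divide_distrib)
  finally show ?thesis .
qed

lemma logfac_antimono:
  assumes "1 < c" "0 < x" "x \<le> y" "y \<le> 1"
  shows "logfac c y \<le> logfac c x"
  using assms by (simp add: logfac_def divide_right_mono)

lemma ln_add_scale:
  assumes "1 < c" "0 \<le> s" "0 < m" "m \<le> 1"
  shows "ln (c + s) \<le> logfac c m * ln (c + m * s)"
proof -
  have ms: "0 \<le> m * s" "m * s \<le> s" "m * c \<le> c"
    using assms by (auto simp: mult_left_le_one_le)
  have "c + s \<le> (c + m * s) / m"
    using assms ms by (simp add: field_simps)
  then have "ln (c + s) \<le> ln ((c + m * s) / m)"
    using assms ms by (subst ln_le_cancel_iff) (auto intro!: divide_pos_pos add_pos_nonneg)
  also have "\<dots> = ln (c + m * s) + \<bar>ln m\<bar>"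
    using assms ms by (subst ln_div) (auto intro: add_pos_nonneg)
  also have "\<bar>ln m\<bar> \<le> \<bar>ln m\<bar> / ln c * ln (c + m * s)"
  proof -
    have "ln c \<le> ln (c + m * s)" using assms ms by simp
    then have "\<bar>ln m\<bar> / ln c * ln c \<le> \<bar>ln m\<bar> / ln c * ln (c + m * s)"
      using assms by (intro mult_left_mono divide_nonneg_pos abs_ge_zero ln_gt_zero)
    moreover have "\<bar>ln m\<bar> / ln c * ln c = \<bar>ln m\<bar>" using assms by simp
    ultimately show ?thesis by linarith
  qed
  finally show ?thesis by (simp add: logfac_def algebra_simps)
qed

lemma logfac_powr_bounded:
  assumes "1 < c" "0 < e" "0 \<le> b"
  obtains K where "1 \<le> K" "\<And>m. 0 < m \<Longrightarrow> m \<le> 1 \<Longrightarrow> m powr e * logfac c m powr b \<le> K"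
proof (cases "b = 0")
  case True
  show ?thesis
  proof (rule that[of 1])
    fix m :: real assume "0 < m" "m \<le> 1"
    then show "m powr e * logfac c m powr b \<le> 1"
      using True assms logfac_ge1[OF assms(1), of m] by (auto intro: powr_le1)
  qed simp
next
  case False
  then have b: "0 < b" using assms by simp
  \<comment> \<open>Chosen so that 1 + |ln m| / ln c is at most K (1 + e |ln m| / b), hence at most
    K exp (e |ln m| / b), whose b-th power cancels against \<open>m powr e\<close>.\<close>
  define K where "K = max 1 (b / (e * ln c))"
  have K: "1 \<le> K" "b / (e * ln c) \<le> K" by (auto simp: K_def)
  show ?thesis
  proof (rule that[of "K powr b"])
    show "1 \<le> K powr b" using K b by (simp add: ge_one_powr_ge_zero)
    fix m :: real assume m: "0 < m" "m \<le> 1"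
    define x where "x = \<bar>ln m\<bar>"
    have x: "0 \<le> x" "ln m = - x" using m by (auto simp: x_def)
    have "logfac c m = 1 + b / (e * ln c) * (e * x / b)"
      using assms b by (simp add: logfac_def x_def)
    also have "\<dots> \<le> K + K * (e * x / b)"
      using K x assms b by (intro add_mono mult_right_mono) auto
    also have "\<dots> = K * (1 + e * x / b)" by (simp add: algebra_simps)
    also have "\<dots> \<le> K * exp (e * x / b)"
      using K by (intro mult_left_mono) (auto simp: exp_ge_add_one_self add.commute)
    finally have "logfac c m powr b \<le> (K * exp (e * x / b)) powr b"
      using b logfac_ge1[OF assms(1), of m] by (intro powr_mono2) auto
    also have "\<dots> = K powr b * exp (e * x)"
      using K b by (simp add: powr_mult exp_powr_real)
    finally have "m powr e * logfac c m powr b \<le> m powr e * (K powr b * exp (e * x))"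
      by (intro mult_left_mono) auto
    also have "\<dots> = K powr b"
      using m x by (simp add: powr_def exp_minus field_simps)
    finally show "m powr e * logfac c m powr b \<le> K powr b" .
  qed
qed

section \<open>Growth properties of \<Phi> and of its derivative\<close>

locale llogl =
  fixes p \<alpha> c :: real
  assumes p1: "1 < p" and c1: "1 < c" and young: "young_function (PhiLL p \<alpha> c)"
begin

abbreviation Phi :: "real \<Rightarrow> real" where "Phi \<equiv> PhiLL p \<alpha> c"

definition phi :: "real \<Rightarrow> real" where
  "phi s = s powr (p - 1) * ln (c + s) powr (\<alpha> * p)"

lemma lnc: "0 < ln c" "0 \<le> s \<Longrightarrow> ln c \<le> ln (c + s)" "0 \<le> s \<Longrightarrow> 0 < ln (c + s)"
  using c1 by auto

lemma ln_add_mono: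
  assumes "0 < m" "m \<le> 1" "0 \<le> s"
  shows "0 < ln (c + m * s)" "ln (c + m * s) \<le> ln (c + s)"
proof -
  have "0 \<le> m * s" "m * s \<le> s" using assms by (auto simp: mult_left_le_one_le)
  then show "0 < ln (c + m * s)" "ln (c + m * s) \<le> ln (c + s)" using c1 by auto
qed

lemma phi_0 [simp]: "phi 0 = 0"
  by (simp add: phi_def)

lemma phi_nonneg [simp]: "0 \<le> phi s"
  by (simp add: phi_def)

lemma phi_pos: "0 < s \<Longrightarrow> 0 < phi s"
  using lnc(3)[of s] by (simp add: phi_def)

lemma continuous_on_phi: "continuous_on {0..} phi"
  unfolding phi_def using p1 c1
  by (intro continuous_intros continuous_on_powr') (auto simp: lnc)

lemma Phi_eq: "Phi t = integral {0..t} phi"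
  by (simp add: PhiLL_def phi_def[abs_def])

lemma Phi_0 [simp]: "Phi 0 = 0" and Phi_convex: "convex_on {0..} Phi"
  and Phi_pos: "0 < t \<Longrightarrow> 0 < Phi t" and Phi_at_top: "filterlim Phi at_top at_top"
  using young by (auto simp: young_function_def)

text \<open>For negative arguments the interval of integration is empty, which gives the default
  value 0.\<close>

lemma Phi_nonneg [simp]: "0 \<le> Phi t"
  by (cases "0 < t"; cases "t = 0") (auto simp: Phi_eq dest: Phi_pos order.strict_implies_order)

lemma Phi_deriv_within:
  assumes "0 \<le> t"
  shows "(Phi has_real_derivative phi t) (at t within {0..})"
proof -
  have "(Phi has_real_derivative phi t) (at t within {0..t+1})"
    unfolding Phi_eq using assms
    by (intro integral_has_real_derivative continuous_on_subset[OF continuous_on_phi]) auto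
  moreover have "at t within {0..t+1} = at t within {0..}"
    by (rule at_within_nhd[of _ "{..<t+1}"]) auto
  ultimately show ?thesis by simp
qed

lemma continuous_on_Phi: "continuous_on {0..} Phi"
  using Phi_deriv_within by (meson DERIV_continuous atLeast_iff continuous_on_eq_continuous_within)

text \<open>Convexity. At the boundary point \<open>a = 0\<close> the tangent is horizontal and
  nonnegativity of \<Phi> takes its place.\<close>

lemma Phi_tangent:
  assumes "0 \<le> a" "0 \<le> b"
  shows "phi a * (b - a) \<le> Phi b - Phi a"
proof (cases "a = 0")
  case False
  have "Phi b - Phi a \<ge> phi a * (b - a)"
    using assms False Phi_deriv_within[of a]
    by (intro convex_on_imp_above_tangent[OF Phi_convex]) auto
  then show ?thesis by simp
qed simp

text \<open>Not visible from the formula, since for \<alpha> < 0 the logarithmic factor decreases.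
  It follows from the convexity of \<Phi> by adding the tangent inequalities at both points.\<close>

lemma phi_mono:
  assumes "0 \<le> a" "a \<le> b"
  shows "phi a \<le> phi b"
proof (cases "a = b")
  case False
  have "phi a * (b - a) \<le> Phi b - Phi a" "phi b * (a - b) \<le> Phi a - Phi b"
    using assms Phi_tangent[of a b] Phi_tangent[of b a] by auto
  then have "phi a * (b - a) \<le> phi b * (b - a)" by (simp add: algebra_simps)
  then show ?thesis using assms False by simp
qed simp

lemma Phi_mono:
  assumes "0 \<le> a" "a \<le> b"
  shows "Phi a \<le> Phi b"
  using Phi_tangent[of a b] assms mult_nonneg_nonneg[of "phi a" "b - a"] phi_nonneg[of a] by linarith

lemma Phi_upper: "0 \<le> t \<Longrightarrow> Phi t \<le> t * phi t"
  using Phi_tangent[of t 0] by (simp add: mult.commute)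

lemma Phi_scale_le:
  assumes "0 \<le> t" "0 \<le> m" "m \<le> 1"
  shows "Phi (m * t) \<le> m * Phi t"
  using convex_onD[OF Phi_convex, of m 0 t] assms by simp

text \<open>A logarithm is lost only for \<alpha> < 0, when the logarithmic factor grows as its
  argument shrinks. In the reverse estimate \<open>phi_scale_up\<close> it is lost only for \<alpha>
  > 0.\<close>

lemma phi_scale_down:
  assumes "0 < m" "m \<le> 1" "0 \<le> s"
  shows "phi (m * s) \<le> m powr (p - 1) * logfac c m powr (p * neg_part \<alpha>) * phi s"
proof -
  have "ln (c + m * s) powr (\<alpha> * p) \<le> logfac c m powr neg_part (\<alpha> * p) * ln (c + s) powr (\<alpha> * p)"
    using ln_add_mono[OF assms] ln_add_scale[OF c1 assms(3,1,2)] by (intro powr_le_scaled)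
  moreover have "neg_part (\<alpha> * p) = p * neg_part \<alpha>"
    using p1 by (auto simp: neg_part_def max_def mult_le_0_iff zero_le_mult_iff)
  ultimately show ?thesis
    using assms by (simp add: phi_def powr_mult mult.assoc mult_left_mono mult.left_commute)
qed

lemma phi_scale_up:
  assumes "0 < m" "m \<le> 1" "0 \<le> s"
  shows "m powr (p - 1) * phi s \<le> logfac c m powr neg_part (- (\<alpha> * p)) * phi (m * s)"
proof -
  have "ln (c + s) powr (\<alpha> * p) \<le> logfac c m powr neg_part (- (\<alpha> * p)) * ln (c + m * s) powr (\<alpha> * p)"
    using ln_add_mono[OF assms] ln_add_scale[OF c1 assms(3,1,2)] by (intro powr_le_scaled)
  then show ?thesis
    using assms by (simp add: phi_def powr_mult mult.assoc mult_left_mono mult.left_commute)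
qed

lemma phi_dilate:
  assumes "1 \<le> k"
  obtains K where "1 \<le> K" "\<And>s. 0 \<le> s \<Longrightarrow> phi (k * s) \<le> K * phi s"
proof -
  define A where "A = logfac c (1/k) powr neg_part (- (\<alpha> * p)) / (1/k) powr (p - 1)"
  have "phi (k * s) \<le> max 1 A * phi s" if "0 \<le> s" for s
  proof -
    have "(1/k) powr (p - 1) * phi (k * s) \<le> logfac c (1/k) powr neg_part (- (\<alpha> * p)) * phi s"
      using phi_scale_up[of "1/k" "k * s"] that assms by simp
    then have "phi (k * s) \<le> A * phi s"
      using assms by (simp add: A_def field_simps)
    also have "\<dots> \<le> max 1 A * phi s" by (intro mult_right_mono) auto
    finally show ?thesis .
  qed
  then show ?thesis using that[of "max 1 A"] by auto
qed

text \<open>On [t/2, t] the derivative is at least \<open>phi (t/2)\<close>, which doubling compares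
  with \<open>phi t\<close>. Together with \<open>Phi_upper\<close> this makes \<Phi> and
  \<open>t * phi t\<close> interchangeable up to constants.\<close>

lemma Phi_lower:
  obtains K where "1 \<le> K" "\<And>t. 0 \<le> t \<Longrightarrow> t * phi t \<le> K * Phi t"
proof -
  obtain K where K: "1 \<le> K" "\<And>s. 0 \<le> s \<Longrightarrow> phi (2 * s) \<le> K * phi s"
    using phi_dilate[of 2] by auto
  have "t * phi t \<le> 2 * K * Phi t" if t: "0 \<le> t" for t
  proof -
    have "phi (t/2) * (t/2) \<le> Phi t - Phi (t/2)"
      using Phi_tangent[of "t/2" t] t by (simp add: field_simps)
    then have "phi (t/2) * (t/2) \<le> Phi t" using Phi_nonneg[of "t/2"] by linarith
    have "t * phi t \<le> t * (K * phi (t/2))"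
      using K(2)[of "t/2"] t by (intro mult_left_mono) auto
    also have "\<dots> = 2 * K * (phi (t/2) * (t/2))" by simp
    also have "\<dots> \<le> 2 * K * Phi t" using K(1) \<open>phi (t/2) * (t/2) \<le> Phi t\<close> by (intro mult_left_mono) auto
    finally show ?thesis .
  qed
  then show ?thesis using that[of "2*K"] K by auto
qed

text \<open>The Delta_2 condition. It makes finiteness of the modular independent of the scaling and
  lets norm and modular be compared.\<close>

lemma Phi_dilate:
  assumes "1 \<le> k"
  obtains K where "1 \<le> K" "\<And>s. 0 \<le> s \<Longrightarrow> Phi (k * s) \<le> K * Phi s"
proof -
  obtain A where A: "1 \<le> A" "\<And>s. 0 \<le> s \<Longrightarrow> phi (k * s) \<le> A * phi s"
    using phi_dilate[OF assms] by blast
  obtain B where B: "1 \<le> B" "\<And>t. 0 \<le> t \<Longrightarrow> t * phi t \<le> B * Phi t"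
    using Phi_lower by blast
  have "Phi (k * s) \<le> k * A * B * Phi s" if s: "0 \<le> s" for s
  proof -
    have "Phi (k * s) \<le> k * s * phi (k * s)" using Phi_upper[of "k * s"] assms s by auto
    also have "\<dots> \<le> k * s * (A * phi s)" using A(2)[OF s] assms s by (intro mult_left_mono) auto
    also have "\<dots> = k * A * (s * phi s)" by simp
    also have "\<dots> \<le> k * A * (B * Phi s)" using B(2)[OF s] assms A by (intro mult_left_mono) auto
    finally show ?thesis by simp
  qed
  moreover have "1 \<le> k * A * B" using assms A B using mult_mono[of 1 k 1 A] mult_mono[of 1 "k * A" 1 B] by auto
  ultimately show ?thesis using that by blast
qed

abbreviation decay :: "real \<Rightarrow> real" where
  "decay m \<equiv> m powr p * logfac c m powr (p * neg_part \<alpha>)"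

lemma Phi_scale_down:
  obtains K where "1 \<le> K" "\<And>m s. 0 < m \<Longrightarrow> m \<le> 1 \<Longrightarrow> 0 \<le> s \<Longrightarrow>
      Phi (m * s) \<le> K * decay m * Phi s"
proof -
  obtain B where B: "1 \<le> B" "\<And>t. 0 \<le> t \<Longrightarrow> t * phi t \<le> B * Phi t"
    using Phi_lower by blast
  have "Phi (m * s) \<le> B * decay m * Phi s"
    if "0 < m" "m \<le> 1" "0 \<le> s" for m s
  proof -
    let ?E = "logfac c m powr (p * neg_part \<alpha>)"
    have "Phi (m * s) \<le> m * s * phi (m * s)" using Phi_upper[of "m * s"] that by auto
    also have "\<dots> \<le> m * s * (m powr (p - 1) * ?E * phi s)"
      using phi_scale_down[OF that] that by (intro mult_left_mono) auto
    also have "\<dots> = m powr p * ?E * (s * phi s)"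
      using that by (simp add: powr_mult_base[symmetric] powr_diff)
    also have "\<dots> \<le> m powr p * ?E * (B * Phi s)"
      using B(2) that by (intro mult_left_mono) auto
    finally show ?thesis by (simp add: mult_ac)
  qed
  then show ?thesis using that B by blast
qed

section \<open>Second-order expansion of the Young function\<close>

text \<open>The exponent is capped at 2 because the Taylor remainder is quadratic at best. For p > 2
  the logarithm disappears, being absorbed by the surplus power p - 2.\<close>

definition omega :: "real \<Rightarrow> real" where
  "omega x = x powr (min p 2) * logfac c x powr (if p \<le> 2 then p * neg_part \<alpha> else 0)"

lemma omega_nonneg [simp]: "0 \<le> omega x"
  by (simp add: omega_def)

lemma neg_part_mult_nonneg [simp]: "0 \<le> p * neg_part \<alpha>"
  using p1 by (simp add: neg_part_def)

lemma square_le_omega: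
  assumes "0 < l" "l \<le> 1"
  shows "l ^ 2 \<le> omega l"
proof -
  have "l ^ 2 = l powr 2" using assms by simp
  also have "\<dots> \<le> l powr (min p 2)" using assms by (intro powr_mono') auto
  also have "\<dots> \<le> omega l"
    using logfac_ge1[OF c1, of l] by (auto simp: omega_def mult_le_cancel_left1 ge_one_powr_ge_zero not_less)
  finally show ?thesis .
qed

text \<open>For p \<le> 2 the quantity \<open>m powr (p - 2)\<close> times the logarithmic factor
  decreases in \<open>m\<close>, so \<open>m = l\<close> is the worst case. For p > 2 it is bounded
  on (0, 1].\<close>

lemma omega_dominates:
  obtains K where "1 \<le> K" "\<And>l m. 0 < l \<Longrightarrow> l \<le> m \<Longrightarrow> m \<le> 1 \<Longrightarrow>
      decay m * (l / m)^2 \<le> K * omega l"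
proof -
  have eq: "m powr p * E * (l / m)^2 = m powr (p - 2) * E * l powr 2" if "0 < l" "0 < m" for m l E :: real
    using that by (simp add: powr_diff power_divide)
  show ?thesis
  proof (cases "p \<le> 2")
    case True
    show ?thesis
    proof (rule that[of 1])
      fix l m :: real assume lm: "0 < l" "l \<le> m" "m \<le> 1"
      have "m powr (p - 2) * logfac c m powr (p * neg_part \<alpha>) * l powr 2
          \<le> l powr (p - 2) * logfac c l powr (p * neg_part \<alpha>) * l powr 2"
        using lm True logfac_antimono[OF c1 lm] logfac_ge1[OF c1, of m]
        by (intro mult_right_mono mult_mono powr_mono2 powr_mono2') auto
      also have "\<dots> = omega l" using lm True by (simp add: omega_def powr_diff)
      finally show "decay m * (l / m)^2 \<le> 1 * omega l"
        using lm by (subst eq) auto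
    qed simp
  next
    case False
    then obtain K where K: "1 \<le> K"
        "\<And>m. 0 < m \<Longrightarrow> m \<le> 1 \<Longrightarrow> m powr (p - 2) * logfac c m powr (p * neg_part \<alpha>) \<le> K"
      using logfac_powr_bounded[OF c1, of "p - 2" "p * neg_part \<alpha>"] neg_part_mult_nonneg by auto
    show ?thesis
    proof (rule that[OF K(1)])
      fix l m :: real assume lm: "0 < l" "l \<le> m" "m \<le> 1"
      have "m powr (p - 2) * logfac c m powr (p * neg_part \<alpha>) * l powr 2 \<le> K * l powr 2"
        using K(2)[of m] lm by (intro mult_right_mono) auto
      also have "\<dots> = K * omega l" using False logfac_ge1[OF c1, of l] by (simp add: omega_def)
      finally show "decay m * (l / m)^2 \<le> K * omega l"
        using lm by (subst eq) auto
    qed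
  qed
qed

lemma Phi_scale_omega:
  obtains K where "1 \<le> K" "\<And>l m s. 0 < l \<Longrightarrow> l \<le> m \<Longrightarrow> m \<le> 1 \<Longrightarrow> 0 \<le> s \<Longrightarrow>
      Phi (m * s) * (l / m)^2 \<le> K * omega l * Phi s"
proof -
  obtain A where A: "1 \<le> A" "\<And>m s. 0 < m \<Longrightarrow> m \<le> 1 \<Longrightarrow> 0 \<le> s \<Longrightarrow>
      Phi (m * s) \<le> A * decay m * Phi s"
    using Phi_scale_down by blast
  obtain B where B: "1 \<le> B" "\<And>l m. 0 < l \<Longrightarrow> l \<le> m \<Longrightarrow> m \<le> 1 \<Longrightarrow>
      decay m * (l / m)^2 \<le> B * omega l"
    using omega_dominates by blast
  show ?thesis
  proof (rule that[of "A * B"])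
    show "1 \<le> A * B" using A B mult_mono[of 1 A 1 B] by auto
    fix l m s :: real assume l: "0 < l" "l \<le> m" "m \<le> 1" "0 \<le> s"
    have "Phi (m * s) * (l / m)^2 \<le> A * decay m * Phi s * (l / m)^2"
      using A(2)[of m s] l by (intro mult_right_mono) auto
    also have "\<dots> = A * Phi s * (decay m * (l / m)^2)" by (simp only: mult_ac)
    also have "\<dots> \<le> A * Phi s * (B * omega l)"
      using B(2)[of l m] l A by (intro mult_left_mono) auto
    finally show "Phi (m * s) * (l / m)^2 \<le> A * B * omega l * Phi s" by (simp only: mult_ac)
  qed
qed

text \<open>The left side is the second-order Taylor term, as \<open>phi t / t\<close> is the size
  of the second derivative. If \<open>s \<le> t\<close>, the bound \<open>l^2 \<le> omega l\<close>
  is enough; otherwise \<open>t = m * s\<close> with \<open>l \<le> m \<le> 1\<close>, and the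
  dilation estimate for \<Phi> applies.\<close>

lemma quadratic_part_le:
  obtains K where "1 \<le> K" "\<And>l t s. 0 < l \<Longrightarrow> l \<le> 1 \<Longrightarrow> 0 < t \<Longrightarrow> 0 \<le> s \<Longrightarrow> l * s \<le> t \<Longrightarrow>
      phi t / t * (l * s)^2 \<le> K * omega l * (Phi t + Phi s)"
proof -
  obtain A where A: "1 \<le> A" "\<And>l m s. 0 < l \<Longrightarrow> l \<le> m \<Longrightarrow> m \<le> 1 \<Longrightarrow> 0 \<le> s \<Longrightarrow>
      Phi (m * s) * (l / m)^2 \<le> A * omega l * Phi s"
    using Phi_scale_omega by blast
  obtain D where D: "1 \<le> D" "\<And>t. 0 \<le> t \<Longrightarrow> t * phi t \<le> D * Phi t"
    using Phi_lower by blast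
  show ?thesis
  proof (rule that[of "D * A"])
    show "1 \<le> D * A" using D A mult_mono[of 1 D 1 A] by auto
    fix l t s :: real assume l: "0 < l" "l \<le> 1" "0 < t" "0 \<le> s" "l * s \<le> t"
    show "phi t / t * (l * s)^2 \<le> D * A * omega l * (Phi t + Phi s)"
    proof (cases "s \<le> t")
      case True
      have "phi t / t * (l * s)^2 = phi t / t * l^2 * s^2" by (simp add: power_mult_distrib)
      also have "\<dots> \<le> phi t / t * l^2 * t^2"
        using True l by (intro mult_left_mono power_mono) auto
      also have "\<dots> = l^2 * (t * phi t)" using l by (simp add: power2_eq_square)
      also have "\<dots> \<le> omega l * (D * Phi t)"
        using square_le_omega[of l] D(2)[of t] l by (intro mult_mono[of "l^2"]) auto
      also have "\<dots> \<le> omega l * (D * A * (Phi t + Phi s))"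
        using A D by (intro mult_left_mono mult_mono) auto
      finally show ?thesis by (simp add: mult_ac)
    next
      case False
      define m where "m = t / s"
      have m: "0 < m" "l \<le> m" "m \<le> 1" "t = m * s" using False l by (auto simp: m_def field_simps)
      have "phi t / t * (l * s)^2 = (t * phi t) * (l / m)^2"
        using m l by (simp add: power2_eq_square field_simps)
      also have "\<dots> \<le> D * Phi t * (l / m)^2" using D(2)[of t] l by (intro mult_right_mono) auto
      also have "\<dots> \<le> D * (A * omega l * Phi s)"
        using A(2)[of l m s] m l D unfolding mult.assoc[of D] by (intro mult_left_mono) auto
      also have "\<dots> \<le> D * (A * omega l * (Phi t + Phi s))"
        using D A by (intro mult_left_mono) auto
      finally show ?thesis by (simp only: mult.assoc)
    qed
  qed
qed

lemma phi_lipschitz: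
  obtains K where "1 \<le> K" "\<And>t s. 0 < t \<Longrightarrow> t / 2 \<le> s \<Longrightarrow> s \<le> 2 * t \<Longrightarrow> \<bar>phi s - phi t\<bar> \<le> K * (phi t / t) * \<bar>s - t\<bar>"
proof -
  obtain A where A: "1 \<le> A" "\<And>s. 0 \<le> s \<Longrightarrow> phi (2 * s) \<le> A * phi s"
    using phi_dilate[of 2] by auto
  \<comment> \<open>Bounds |x phi'(x) / phi(x)|: the power contributes p - 1, and the logarithm at
    most |\<alpha>| p / ln c because x \<le> c + x.\<close>
  define E where "E = p - 1 + \<bar>\<alpha>\<bar> * p / ln c"
  have E: "0 < E" using p1 lnc by (auto simp: E_def intro!: add_pos_nonneg)
  show ?thesis
  proof (rule that[of "max 1 (2 * A * E)"])
    fix t s :: real assume t: "0 < t" "t / 2 \<le> s" "s \<le> 2 * t"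
    define f' where "f' x = phi x * ((p - 1) / x + \<alpha> * p / ((c + x) * ln (c + x)))" for x
    have "norm (phi s - phi t) \<le> (2 * A * E * (phi t / t)) * norm (s - t)"
    proof (rule field_differentiable_bound[where S = "{t/2..2 * t}" and f' = f'])
      fix x assume x: "x \<in> {t/2..2 * t}"
      have xp: "0 < x" "0 < c + x" "0 < ln (c + x)" "ln c \<le> ln (c + x)" using x t c1 lnc(2,3)[of x] by auto
      have "(phi has_field_derivative f' x) (at x)"
      proof -
        have "((\<lambda>x. ln (c + x)) has_field_derivative 1 / (c + x)) (at x)"
          using xp by (auto intro!: derivative_eq_intros DERIV_chain'[where g = ln and f = "\<lambda>x. c + x"])
        then have "((\<lambda>x. ln (c + x) powr (\<alpha> * p)) has_field_derivative
            \<alpha> * p * ln (c + x) powr (\<alpha> * p - 1) * (1 / (c + x))) (at x)"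
          using DERIV_fun_powr[of "\<lambda>x. ln (c + x)" "1 / (c + x)" x "\<alpha> * p"] xp by simp
        moreover have "((\<lambda>x. x powr (p - 1)) has_field_derivative (p - 1) * x powr (p - 1 - 1)) (at x)"
          using DERIV_fun_powr[of "\<lambda>x. x" 1 x "p - 1"] xp by simp
        ultimately have "(phi has_field_derivative x powr (p - 1) * (\<alpha> * p * ln (c + x) powr (\<alpha> * p - 1) * (1 / (c + x)))
            + (p - 1) * x powr (p - 1 - 1) * ln (c + x) powr (\<alpha> * p)) (at x)"
          unfolding phi_def[abs_def] by (intro DERIV_mult')
        moreover have eqs: "x powr (p - 1 - 1) = x powr (p - 1) / x" "ln (c + x) powr (\<alpha> * p - 1) = ln (c + x) powr (\<alpha> * p) / ln (c + x)"
          using xp by (subst powr_diff; simp)+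
        have "x powr (p - 1) * (\<alpha> * p * ln (c + x) powr (\<alpha> * p - 1) * (1 / (c + x)))
            + (p - 1) * x powr (p - 1 - 1) * ln (c + x) powr (\<alpha> * p) = f' x"
          unfolding eqs f'_def phi_def using xp by (simp add: distrib_left mult_ac)
        ultimately show ?thesis by simp
      qed
      then show "(phi has_field_derivative f' x) (at x within {t/2..2 * t})"
        by (rule has_field_derivative_at_within)
      have "\<bar>\<alpha> * p / ((c + x) * ln (c + x))\<bar> = \<bar>\<alpha>\<bar> * p / ((c + x) * ln (c + x))"
        using xp p1 by (simp add: abs_mult)
      also have "\<dots> \<le> \<bar>\<alpha>\<bar> * p / (x * ln c)"
        using xp p1 c1 by (intro divide_left_mono mult_mono mult_pos_pos) auto
      also have "\<dots> = \<bar>\<alpha>\<bar> * p / ln c / x" using xp c1 by simp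
      finally have "\<bar>(p - 1) / x + \<alpha> * p / ((c + x) * ln (c + x))\<bar> \<le> (p - 1) / x + \<bar>\<alpha>\<bar> * p / ln c / x"
        using xp p1 by (intro order.trans[OF abs_triangle_ineq] add_mono) auto
      also have "\<dots> = E / x" by (simp add: E_def add_divide_distrib)
      finally have "norm (f' x) \<le> phi x * (E / x)"
        unfolding f'_def real_norm_def abs_mult by (simp only: abs_of_nonneg[OF phi_nonneg] mult_left_mono phi_nonneg)
      also have "\<dots> \<le> (A * phi t) * (E / (t / 2))"
        using x t E A(1) phi_mono[of x "2 * t"] A(2)[of t]
        by (intro mult_mono divide_left_mono) auto
      finally show "norm (f' x) \<le> 2 * A * E * (phi t / t)" by (simp add: field_simps)
    qed (use t in auto)
    also have "\<dots> \<le> max 1 (2 * A * E) * (phi t / t) * norm (s - t)"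
      using t by (intro mult_right_mono) auto
    finally show "\<bar>phi s - phi t\<bar> \<le> max 1 (2 * A * E) * (phi t / t) * \<bar>s - t\<bar>" by simp
  qed simp
qed

text \<open>The real derivative of \<open>\<Phi> \<circ> cmod\<close>; at \<open>z = 0\<close> the division by zero gives the correct value \<open>0\<close>.\<close>

definition dPhi :: "complex \<Rightarrow> complex \<Rightarrow> real" where
  "dPhi z w = phi (cmod z) * Re (cnj z * w) / cmod z"

lemma dPhi_bound: "\<bar>dPhi z w\<bar> \<le> phi (cmod z) * cmod w"
proof (cases "z = 0")
  case False
  have "\<bar>Re (cnj z * w)\<bar> \<le> cmod z * cmod w"
    using abs_Re_le_cmod[of "cnj z * w"] by (simp add: norm_mult)
  then have "phi (cmod z) * \<bar>Re (cnj z * w)\<bar> / cmod z \<le> phi (cmod z) * (cmod z * cmod w) / cmod z"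
    by (intro divide_right_mono mult_left_mono) auto
  moreover have "\<bar>dPhi z w\<bar> = phi (cmod z) * \<bar>Re (cnj z * w)\<bar> / cmod z"
    unfolding dPhi_def abs_divide abs_mult by simp
  moreover have "phi (cmod z) * (cmod z * cmod w) / cmod z = phi (cmod z) * cmod w" using False by simp
  ultimately show ?thesis by linarith
qed (simp add: dPhi_def)

text \<open>Expanding |z + w|^2 and using (|z + w| - |z|)^2 \<ge> 0 gives the upper Taylor bound
  without differentiating the modulus.\<close>

lemma cmod_add_le_second_order:
  fixes z w :: complex
  assumes "z \<noteq> 0"
  shows "cmod (z + w) - cmod z \<le> Re (cnj z * w) / cmod z + (cmod w)^2 / (2 * cmod z)"
proof -
  have t: "0 < cmod z" using assms by simp
  have "(cmod (z + w))^2 = (cmod z)^2 + 2 * Re (cnj z * w) + (cmod w)^2"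
    unfolding cmod_power2 by (simp add: power2_eq_square algebra_simps)
  moreover have "0 \<le> (cmod (z + w) - cmod z)^2" by simp
  ultimately have "2 * (cmod (z + w) - cmod z) * cmod z \<le> 2 * Re (cnj z * w) + (cmod w)^2"
    by (simp add: power2_eq_square algebra_simps)
  then show ?thesis using t by (simp add: field_simps power2_eq_square)
qed

text \<open>If |w| exceeds |z| / 2, every term is a constant times \<Phi>(|w|), which is of order
  \<open>omega l * Phi s\<close>. Otherwise |z + w| stays in [|z| / 2, 2 |z|], where
  \<open>phi\<close> is Lipschitz with constant of order \<open>phi t / t\<close>, and a genuine
  Taylor expansion is available.\<close>

lemma Phi_second_order:
  obtains K where "1 \<le> K" "\<And>l z w s. 0 < l \<Longrightarrow> l \<le> 1 \<Longrightarrow> 0 \<le> s \<Longrightarrow> cmod w \<le> l * s \<Longrightarrow>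
      Phi (cmod (z + w)) \<le> Phi (cmod z) + dPhi z w + K * omega l * (Phi (cmod z) + Phi s)"
proof -
  obtain A where A: "1 \<le> A" "\<And>l m s. 0 < l \<Longrightarrow> l \<le> m \<Longrightarrow> m \<le> 1 \<Longrightarrow> 0 \<le> s \<Longrightarrow>
      Phi (m * s) * (l / m)^2 \<le> A * omega l * Phi s"
    using Phi_scale_omega by blast
  obtain B where B: "1 \<le> B" "\<And>l t s. 0 < l \<Longrightarrow> l \<le> 1 \<Longrightarrow> 0 < t \<Longrightarrow> 0 \<le> s \<Longrightarrow> l * s \<le> t \<Longrightarrow>
      phi t / t * (l * s)^2 \<le> B * omega l * (Phi t + Phi s)"
    using quadratic_part_le by blast
  obtain D where D: "1 \<le> D" "\<And>t. 0 \<le> t \<Longrightarrow> t * phi t \<le> D * Phi t"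
    using Phi_lower by blast
  obtain E where E: "1 \<le> E" "\<And>s. 0 \<le> s \<Longrightarrow> Phi (3 * s) \<le> E * Phi s"
    using Phi_dilate[of 3] by auto
  obtain H where H: "1 \<le> H" "\<And>t s. 0 < t \<Longrightarrow> t / 2 \<le> s \<Longrightarrow> s \<le> 2 * t \<Longrightarrow> \<bar>phi s - phi t\<bar> \<le> H * (phi t / t) * \<bar>s - t\<bar>"
    using phi_lipschitz by blast
  define K where "K = (1 + H) * B + (E + D * E) * A"
  have K: "(1 + H) * B \<le> K" "(E + D * E) * A \<le> K" "1 \<le> K" "A \<le> K"
  proof -
    have 1: "0 \<le> (E + D * E) * A" "0 \<le> (1 + H) * B" using A B D E H by auto
    then show "(1 + H) * B \<le> K" "(E + D * E) * A \<le> K" by (auto simp: K_def)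
    have "1 * 1 \<le> (1 + H) * B" using H B by (intro mult_mono) auto
    then show "1 \<le> K" using 1 by (simp add: K_def)
    have "1 * A \<le> (E + D * E) * A" using E D A by (intro mult_right_mono) (auto intro: add_increasing2)
    then show "A \<le> K" using 1 by (simp add: K_def)
  qed
  show ?thesis
  proof (rule that[OF K(3)])
    fix l s :: real and z w :: complex
    assume l: "0 < l" "l \<le> 1" "0 \<le> s" "cmod w \<le> l * s"
    \<comment> \<open>The smallest admissible value of \<open>s\<close>; with it
      \<open>cmod w = l * s'\<close> holds exactly, so the dilation estimates can be used with
      \<open>m = l\<close>.\<close>
    define s' where "s' = cmod w / l"
    have s': "0 \<le> s'" "s' \<le> s" "l * s' = cmod w" using l by (auto simp: s'_def field_simps)
    have Ps: "Phi s' \<le> Phi s" using s' by (intro Phi_mono)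
    have Pw: "Phi (cmod w) \<le> A * omega l * Phi s"
    proof -
      have "Phi (cmod w) \<le> A * omega l * Phi s'" using A(2)[of l l s'] l s' by simp
      also have "\<dots> \<le> A * omega l * Phi s" using A Ps by (intro mult_left_mono) auto
      finally show ?thesis .
    qed
    have wK: "M * omega l * R \<le> K * omega l * (Phi (cmod z) + Phi s)"
      if "M \<le> K" "0 \<le> R" "R \<le> Phi (cmod z) + Phi s" for M R
      using that K by (intro mult_mono) auto
    show "Phi (cmod (z + w)) \<le> Phi (cmod z) + dPhi z w + K * omega l * (Phi (cmod z) + Phi s)"
    proof (cases "cmod z / 2 < cmod w")
      case True
      have tri: "cmod (z + w) \<le> 3 * cmod w" using norm_triangle_ineq[of z w] True by linarith
      have "Phi (cmod (z + w)) \<le> Phi (3 * cmod w)" using tri by (intro Phi_mono) auto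
      also have "\<dots> \<le> E * Phi (cmod w)" using E(2)[of "cmod w"] by simp
      finally have 1: "Phi (cmod (z + w)) \<le> E * Phi (cmod w)" .
      have "- dPhi z w \<le> phi (cmod z) * cmod w" using dPhi_bound[of z w] by linarith
      also have "\<dots> \<le> phi (2 * cmod w) * (2 * cmod w)"
        using True by (intro mult_mono phi_mono) auto
      also have "\<dots> \<le> D * Phi (2 * cmod w)" using D(2)[of "2 * cmod w"] by (simp add: mult.commute)
      also have "\<dots> \<le> D * Phi (3 * cmod w)" using D by (intro mult_left_mono Phi_mono) auto
      also have "\<dots> \<le> D * (E * Phi (cmod w))" using D E(2)[of "cmod w"] by (intro mult_left_mono) auto
      finally have 2: "- dPhi z w \<le> D * (E * Phi (cmod w))" .
      have "Phi (cmod (z + w)) - dPhi z w \<le> (E + D * E) * Phi (cmod w)"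
        using 1 2 by (simp add: algebra_simps)
      also have "\<dots> \<le> (E + D * E) * (A * omega l * Phi s)" using Pw D E by (intro mult_left_mono) auto
      also have "\<dots> = (E + D * E) * A * omega l * Phi s" by simp
      also have "\<dots> \<le> K * omega l * (Phi (cmod z) + Phi s)" using K by (intro wK) auto
      finally show ?thesis using Phi_nonneg[of "cmod z"] by linarith
    next
      case False
      show ?thesis
      proof (cases "z = 0")
        case True
        with False show ?thesis using K by (simp add: dPhi_def)
      next
        case z: False
        define t t' where "t = cmod z" and "t' = cmod (z + w)"
        have w: "cmod w \<le> t / 2" using False by (simp add: t_def)
        have tt: "\<bar>t' - t\<bar> \<le> cmod w" unfolding t_def t'_def
          using norm_triangle_ineq3[of "z + w" z] by simp
        have t: "0 < t" "t / 2 \<le> t'" "t' \<le> 2 * t" using z tt w by (auto simp: t_def)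
        have "Phi t' - Phi t \<le> phi t' * (t' - t)"
          using Phi_tangent[of t' t] t by (simp add: algebra_simps)
        also have "\<dots> = phi t * (t' - t) + (phi t' - phi t) * (t' - t)" by (simp add: algebra_simps)
        also have "(phi t' - phi t) * (t' - t) \<le> H * (phi t / t) * (cmod w)^2"
        proof -
          have "(phi t' - phi t) * (t' - t) \<le> \<bar>phi t' - phi t\<bar> * \<bar>t' - t\<bar>"
            by (metis abs_ge_self abs_mult)
          also have "\<dots> \<le> (H * (phi t / t) * \<bar>t' - t\<bar>) * \<bar>t' - t\<bar>"
            using H(2)[OF t] by (intro mult_right_mono) auto
          also have "\<dots> = H * (phi t / t) * \<bar>t' - t\<bar>^2" by (simp add: power2_eq_square)
          also have "\<dots> \<le> H * (phi t / t) * (cmod w)^2"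
            using tt H t by (intro mult_left_mono power_mono) auto
          finally show ?thesis .
        qed
        also have "phi t * (t' - t) \<le> phi t * (Re (cnj z * w) / t + (cmod w)^2 / (2 * t))"
          using cmod_add_le_second_order[OF z, of w] by (intro mult_left_mono) (auto simp: t_def t'_def)
        also have "\<dots> \<le> dPhi z w + phi t / t * (cmod w)^2"
          using t by (simp add: dPhi_def t_def[symmetric] distrib_left field_simps)
        finally have "Phi t' - Phi t \<le> dPhi z w + (1 + H) * (phi t / t * (cmod w)^2)"
          by (simp add: algebra_simps add_divide_distrib)
        also have "phi t / t * (cmod w)^2 \<le> B * omega l * (Phi t + Phi s')"
          using B(2)[of l t s'] l s' t w by auto
        also have "(1 + H) * (B * omega l * (Phi t + Phi s')) = (1 + H) * B * omega l * (Phi t + Phi s')" by simp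
        also have "\<dots> \<le> K * omega l * (Phi (cmod z) + Phi s)"
          using K Ps by (intro wK) (auto simp: t_def)
        finally show ?thesis using H by (simp add: t_def t'_def)
      qed
    qed
  qed
qed

end

section \<open>The modular and the Luxemburg norm\<close>

abbreviation TM :: "real measure" where
  "TM \<equiv> lebesgue_on torus"

lemma space_torus_measure [simp]: "space TM = torus"
  by (simp add: space_restrict_space)

lemma emeasure_torus: "emeasure TM torus = ennreal (2 * pi)"
  using emeasure_lborel_Ico[of "-pi" pi]
  by (simp add: torus_def emeasure_restrict_space)

interpretation TM: finite_measure TM
  by (rule finite_measureI) (simp add: emeasure_torus)

lemma measure_torus: "measure TM torus = 2 * pi"
  by (simp add: measure_def emeasure_torus)

context llogl
begin

abbreviation X :: "(real \<Rightarrow> complex) set" where "X \<equiv> orlicz Phi"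
abbreviation nrm :: "(real \<Rightarrow> complex) \<Rightarrow> real" where "nrm \<equiv> lux Phi"

text \<open>A Bochner integral, in contrast to the nonnegative integral in \<open>lux\<close>.
  Doubling makes all dilates of members of \<open>X\<close> integrable, so that the two agree
  there.\<close>

definition modular :: "(real \<Rightarrow> real) \<Rightarrow> real" where
  "modular g = (\<integral>x. Phi (g x) \<partial>TM)"

lemma Phi_measurable [measurable]:
  assumes [measurable]: "f \<in> borel_measurable M"
  shows "(\<lambda>x. Phi (f x)) \<in> borel_measurable M"
proof -
  have "continuous_on UNIV (\<lambda>x. Phi (max 0 x))"
    by (intro continuous_on_compose2[OF continuous_on_Phi] continuous_intros) auto
  then have "(\<lambda>x. Phi (max 0 (f x))) \<in> borel_measurable M"
    by (rule borel_measurable_continuous_on) simp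
  moreover have "Phi (max 0 t) = Phi t" for t
    by (cases "0 \<le> t") (auto simp: max_def, simp add: Phi_eq)
  ultimately show ?thesis by simp
qed

lemma phi_measurable [measurable]: "phi \<in> borel_measurable borel"
  unfolding phi_def[abs_def] by measurable

lemma Phi_max_le: "0 \<le> a \<Longrightarrow> 0 \<le> b \<Longrightarrow> Phi (max a b) \<le> Phi a + Phi b"
  by (simp add: max_def)

lemma X_measurable: "f \<in> X \<Longrightarrow> f \<in> borel_measurable TM"
  by (simp add: orlicz_def)

text \<open>Membership in \<open>X\<close> provides one dilation with finite integral; doubling
  passes from it to all others.\<close>

lemma X_integrable:
  assumes "f \<in> X" "0 \<le> k"
  shows "integrable TM (\<lambda>x. Phi (k * cmod (f x)))"
proof -
  have [measurable]: "f \<in> borel_measurable TM" by (rule X_measurable[OF assms(1)])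
  obtain r where r: "0 < r" "(\<integral>\<^sup>+x. ennreal (Phi (cmod (f x) / r)) \<partial>TM) < \<infinity>"
    using assms by (auto simp: orlicz_def)
  obtain K where K: "1 \<le> K" "\<And>s. 0 \<le> s \<Longrightarrow> Phi (max 1 (k * r) * s) \<le> K * Phi s"
    using Phi_dilate[of "max 1 (k * r)"] by auto
  have "integrable TM (\<lambda>x. Phi (cmod (f x) / r))"
    using r by (intro integrableI_nonneg) auto
  then have "integrable TM (\<lambda>x. K * Phi (cmod (f x) / r))" by simp
  then show ?thesis
  proof (rule Bochner_Integration.integrable_bound)
    show "AE x in TM. norm (Phi (k * cmod (f x))) \<le> norm (K * Phi (cmod (f x) / r))"
    proof (rule AE_I2)
      fix x
      have "k * cmod (f x) = (k * r) * (cmod (f x) / r)" using r by simp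
      also have "\<dots> \<le> max 1 (k * r) * (cmod (f x) / r)" using r by (intro mult_right_mono) auto
      finally have "Phi (k * cmod (f x)) \<le> Phi (max 1 (k * r) * (cmod (f x) / r))"
        using assms by (intro Phi_mono) auto
      also have "\<dots> \<le> K * Phi (cmod (f x) / r)" using K(2)[of "cmod (f x) / r"] r by auto
      finally show "norm (Phi (k * cmod (f x))) \<le> norm (K * Phi (cmod (f x) / r))" using K by simp
    qed
  qed measurable
qed

lemma X_integrable1: "f \<in> X \<Longrightarrow> integrable TM (\<lambda>x. Phi (cmod (f x)))"
  using X_integrable[of f 1] by simp

lemma X_integrable_div: "f \<in> X \<Longrightarrow> 0 < r \<Longrightarrow> integrable TM (\<lambda>x. Phi (cmod (f x) / r))"
  using X_integrable[of f "1/r"] by simp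

lemma X_intro:
  assumes "f \<in> borel_measurable TM" "integrable TM g"
    and "\<And>x. x \<in> torus \<Longrightarrow> Phi (cmod (f x)) \<le> g x"
  shows "f \<in> X"
proof -
  note [measurable] = assms(1)
  have "integrable TM (\<lambda>x. Phi (cmod (f x)))"
  proof (rule Bochner_Integration.integrable_bound[OF assms(2)])
    show "AE x in TM. norm (Phi (cmod (f x))) \<le> norm (g x)"
      using assms(3) by (intro AE_I2) (auto intro: order.trans[OF _ abs_ge_self])
  qed measurable
  then have "(\<integral>\<^sup>+x. ennreal (Phi (cmod (f x) / 1)) \<partial>TM) < \<infinity>"
    by (simp add: nn_integral_eq_integral)
  then show ?thesis using assms(1) unfolding orlicz_def by (auto intro!: exI[of _ 1])
qed

lemma X_bounded:
  assumes "f \<in> borel_measurable TM" "\<And>x. x \<in> torus \<Longrightarrow> cmod (f x) \<le> B"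
  shows "f \<in> X"
  by (rule X_intro[where g = "\<lambda>_. Phi B"]) (use assms in \<open>auto intro!: Phi_mono\<close>)

lemma X_dominated:
  assumes "f \<in> borel_measurable TM" "g \<in> X" "h \<in> X"
    "\<And>x. x \<in> torus \<Longrightarrow> cmod (f x) \<le> k * (cmod (g x) + cmod (h x))" "0 \<le> k"
  shows "f \<in> X"
proof (rule X_intro[OF assms(1)])
  show "integrable TM (\<lambda>x. Phi (2 * k * cmod (g x)) + Phi (2 * k * cmod (h x)))"
    using assms by (intro Bochner_Integration.integrable_add X_integrable) auto
  fix x assume x: "x \<in> torus"
  have "cmod (f x) \<le> k * (cmod (g x) + cmod (h x))" using assms x by blast
  also have "\<dots> \<le> k * (2 * max (cmod (g x)) (cmod (h x)))" using assms by (intro mult_left_mono) auto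
  also have "\<dots> = max (2 * k * cmod (g x)) (2 * k * cmod (h x))"
    using assms by (simp add: max_mult_distrib_left mult_ac)
  finally have "Phi (cmod (f x)) \<le> Phi (max (2 * k * cmod (g x)) (2 * k * cmod (h x)))"
    by (intro Phi_mono) auto
  also have "\<dots> \<le> Phi (2 * k * cmod (g x)) + Phi (2 * k * cmod (h x))"
    using assms by (intro Phi_max_le) auto
  finally show "Phi (cmod (f x)) \<le> \<dots>" .
qed

lemma X_zero [simp]: "(\<lambda>_. 0) \<in> X"
  by (rule X_bounded[of _ 0]) auto

lemma X_add [simp]: "f \<in> X \<Longrightarrow> g \<in> X \<Longrightarrow> (\<lambda>x. f x + g x) \<in> X"
  by (rule X_dominated[of _ f g 1]) (auto intro: X_measurable norm_triangle_ineq borel_measurable_add)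

lemma X_cmult [simp]: "f \<in> X \<Longrightarrow> (\<lambda>x. a * f x) \<in> X"
  by (rule X_dominated[of _ f f "cmod a"])
     (auto intro: X_measurable borel_measurable_times simp: norm_mult mult_left_mono)

lemma X_uminus [simp]: "f \<in> X \<Longrightarrow> (\<lambda>x. - f x) \<in> X"
  using X_cmult[of f "-1"] by simp

lemma X_diff [simp]: "f \<in> X \<Longrightarrow> g \<in> X \<Longrightarrow> (\<lambda>x. f x - g x) \<in> X"
  using X_add[of f "\<lambda>x. - g x"] by simp

lemma X_sum [simp]: "finite A \<Longrightarrow> (\<And>i. i \<in> A \<Longrightarrow> g i \<in> X) \<Longrightarrow> (\<lambda>x. \<Sum>i\<in>A. g i x) \<in> X"
  by (induction A rule: finite_induct) auto

lemma modular_div_mono: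
  assumes "f \<in> X" "0 < r" "r \<le> s"
  shows "modular (\<lambda>x. cmod (f x) / s) \<le> modular (\<lambda>x. cmod (f x) / r)"
  unfolding modular_def using assms
  by (intro integral_mono X_integrable_div Phi_mono divide_left_mono) auto

lemma modular_nonneg: "0 \<le> modular g"
  by (simp add: modular_def)

text \<open>Since (1 + d) t = (1 - d) t + d (2 t), convexity between t and 2 t followed by doubling
  gives continuity of the modular in the dilation, with a rate.\<close>

lemma modular_dilate:
  obtains K where "1 \<le> K" "\<And>f r d. f \<in> X \<Longrightarrow> 0 < r \<Longrightarrow> 0 \<le> d \<Longrightarrow> d \<le> 1 \<Longrightarrow>
     modular (\<lambda>x. (1 + d) * (cmod (f x) / r)) \<le> (1 + d * K) * modular (\<lambda>x. cmod (f x) / r)"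
proof -
  obtain K where K: "1 \<le> K" "\<And>s. 0 \<le> s \<Longrightarrow> Phi (2 * s) \<le> K * Phi s"
    using Phi_dilate[of 2] by auto
  have *: "Phi ((1 + d) * t) \<le> (1 + d * K) * Phi t" if "0 \<le> t" "0 \<le> d" "d \<le> 1" for t d
  proof -
    have "Phi ((1 + d) * t) \<le> (1 - d) * Phi t + d * Phi (2 * t)"
      using convex_onD[OF Phi_convex, of d t "2 * t"] that by (simp add: algebra_simps)
    also have "\<dots> \<le> (1 - d) * Phi t + d * (K * Phi t)"
      using K(2)[of t] that by (intro add_left_mono mult_left_mono) auto
    also have "\<dots> \<le> (1 + d * K) * Phi t" using that by (simp add: algebra_simps)
    finally show ?thesis .
  qed
  show ?thesis
  proof (rule that[OF K(1)])
    fix f :: "real \<Rightarrow> complex" and r d :: real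
    assume f: "f \<in> X" "0 < r" "0 \<le> d" "d \<le> 1"
    have pw: "Phi ((1 + d) * (cmod (f x) / r)) \<le> (1 + d * K) * Phi (cmod (f x) / r)" for x
      using f by (intro *) auto
    have "integrable TM (\<lambda>x. Phi ((1 + d) * (cmod (f x) / r)))"
      using X_integrable[of f "(1 + d) / r"] f by simp
    then have "modular (\<lambda>x. (1 + d) * (cmod (f x) / r)) \<le> (\<integral>x. (1 + d * K) * Phi (cmod (f x) / r) \<partial>TM)"
      unfolding modular_def using f pw X_integrable_div[of f r]
      by (intro integral_mono integrable_mult_right)
    then show "modular (\<lambda>x. (1 + d) * (cmod (f x) / r)) \<le> (1 + d * K) * modular (\<lambda>x. cmod (f x) / r)"
      using X_integrable_div[of f r] f by (simp add: modular_def)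
  qed
qed

lemma nn_integral_modular:
  assumes "f \<in> X" "0 < r"
  shows "(\<integral>\<^sup>+x. ennreal (Phi (cmod (f x) / r)) \<partial>TM) \<le> 1 \<longleftrightarrow> modular (\<lambda>x. cmod (f x) / r) \<le> 1"
  using X_integrable_div[OF assms]
  by (simp add: nn_integral_eq_integral modular_def[symmetric] flip: ennreal_1)

lemma nrm_eq: "f \<in> X \<Longrightarrow> nrm f = Inf {r. 0 < r \<and> modular (\<lambda>x. cmod (f x) / r) \<le> 1}"
  unfolding lux_def using nn_integral_modular by (intro arg_cong[where f = Inf]) auto

lemma nrm_set_nonempty:
  assumes "f \<in> X"
  shows "\<exists>r>0. modular (\<lambda>x. cmod (f x) / r) \<le> 1"
proof -
  define r where "r = max 1 (modular (\<lambda>x. cmod (f x)))"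
  have r: "1 \<le> r" "modular (\<lambda>x. cmod (f x)) \<le> r" by (auto simp: r_def)
  have "Phi (cmod (f x) / r) \<le> (1/r) * Phi (cmod (f x))" for x
    using Phi_scale_le[of "cmod (f x)" "1/r"] r by auto
  then have "modular (\<lambda>x. cmod (f x) / r) \<le> (\<integral>x. (1/r) * Phi (cmod (f x)) \<partial>TM)"
    unfolding modular_def using assms r X_integrable1[OF assms] X_integrable_div[OF assms, of r]
    by (intro integral_mono) auto
  also have "\<dots> = modular (\<lambda>x. cmod (f x)) / r" by (simp add: modular_def)
  also have "\<dots> \<le> 1" using r by simp
  finally show ?thesis using r by (intro exI[of _ r]) auto
qed

lemma nrm_le:
  assumes "f \<in> X" "0 < r" "modular (\<lambda>x. cmod (f x) / r) \<le> 1"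
  shows "nrm f \<le> r"
  unfolding nrm_eq[OF assms(1)] using assms by (intro cInf_lower bdd_belowI[of _ 0]) auto

lemma nrm_nonneg: "f \<in> X \<Longrightarrow> 0 \<le> nrm f"
  unfolding nrm_eq using nrm_set_nonempty[of f] by (intro cInf_greatest) auto

lemma modular_le_1:
  assumes "f \<in> X" "nrm f < r"
  shows "modular (\<lambda>x. cmod (f x) / r) \<le> 1"
proof -
  obtain s where s: "0 < s" "modular (\<lambda>x. cmod (f x) / s) \<le> 1" "s < r"
    using assms nrm_set_nonempty[OF assms(1)]
      cInf_lessD[of "{r. 0 < r \<and> modular (\<lambda>x. cmod (f x) / r) \<le> 1}" r]
    unfolding nrm_eq[OF assms(1)] by auto
  then show ?thesis using modular_div_mono[OF assms(1), of s r] by linarith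
qed

text \<open>The infimum in the Luxemburg norm is attained with equality. Both halves rest on
  continuity under dilation: a limit from above gives \<le> 1, and a value below 1 would leave room
  for a smaller radius.\<close>

lemma modular_eq_1:
  assumes "f \<in> X" "0 < nrm f"
  shows "modular (\<lambda>x. cmod (f x) / nrm f) = 1"
proof -
  define r where "r = nrm f"
  have r: "0 < r" using assms by (simp add: r_def)
  obtain K where K: "1 \<le> K" "\<And>f r d. f \<in> X \<Longrightarrow> 0 < r \<Longrightarrow> 0 \<le> d \<Longrightarrow> d \<le> 1 \<Longrightarrow>
     modular (\<lambda>x. (1 + d) * (cmod (f x) / r)) \<le> (1 + d * K) * modular (\<lambda>x. cmod (f x) / r)"
    using modular_dilate by blast
  have "modular (\<lambda>x. cmod (f x) / r) \<le> 1 + e" if e: "0 < e" for e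
  proof -
    define d where "d = min 1 (e / K)"
    have d: "0 < d" "d \<le> 1" "d * K \<le> e"
    proof -
      show "0 < d" "d \<le> 1" using e K by (auto simp: d_def)
      have "d * K \<le> e / K * K" using K by (intro mult_right_mono) (auto simp: d_def)
      then show "d * K \<le> e" using K by simp
    qed
    have "modular (\<lambda>x. cmod (f x) / r) = modular (\<lambda>x. (1 + d) * (cmod (f x) / ((1 + d) * r)))"
      using d by simp
    also have "\<dots> \<le> (1 + d * K) * modular (\<lambda>x. cmod (f x) / ((1 + d) * r))"
      using K(2)[OF assms(1), of "(1 + d) * r" d] d r by auto
    also have "\<dots> \<le> (1 + d * K) * 1"
      using modular_le_1[OF assms(1), of "(1 + d) * r"] d r K
      by (intro mult_left_mono) (auto simp: r_def)
    also have "\<dots> \<le> 1 + e" using d by simp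
    finally show ?thesis .
  qed
  then have 1: "modular (\<lambda>x. cmod (f x) / r) \<le> 1" by (rule field_le_epsilon)
  moreover have "\<not> modular (\<lambda>x. cmod (f x) / r) < 1"
  proof
    assume less: "modular (\<lambda>x. cmod (f x) / r) < 1"
    define J where "J = modular (\<lambda>x. cmod (f x) / r)"
    have J: "0 \<le> J" "J < 1" using less by (auto simp: J_def modular_nonneg)
    \<comment> \<open>With this d the dilated modular is at most (1 + d K) J = (2 - J) J, which
      never exceeds 1.\<close>
    define d where "d = (1 - J) / K"
    have d: "0 < d" "d \<le> 1" "d * K = 1 - J" using J K by (auto simp: d_def field_simps)
    have "modular (\<lambda>x. cmod (f x) / (r / (1 + d))) = modular (\<lambda>x. (1 + d) * (cmod (f x) / r))"
      by (simp add: mult.commute)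
    also have "\<dots> \<le> (1 + d * K) * J" using K(2)[OF assms(1) r, of d] d by (auto simp: J_def)
    also have "\<dots> \<le> 1"
    proof -
      have "0 \<le> (1 - J)^2" by simp
      then show ?thesis unfolding d by (simp add: power2_eq_square algebra_simps)
    qed
    finally have "r \<le> r / (1 + d)" unfolding r_def
      using nrm_le[OF assms(1), of "r / (1 + d)"] d r by (auto simp: r_def)
    then have "r * (1 + d) \<le> r" using d by (simp add: pos_le_divide_eq)
    moreover have "0 < r * d" using d r by simp
    ultimately show False by (simp add: distrib_left)
  qed
  ultimately show ?thesis by (simp add: r_def)
qed

lemma nrm_mono:
  assumes "f \<in> X" "g \<in> X" "\<And>x. x \<in> torus \<Longrightarrow> cmod (f x) \<le> cmod (g x)"
  shows "nrm f \<le> nrm g"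
proof (rule field_le_epsilon)
  fix e :: real assume e: "0 < e"
  have r: "0 < nrm g + e" using nrm_nonneg[OF assms(2)] e by simp
  have "modular (\<lambda>x. cmod (f x) / (nrm g + e)) \<le> modular (\<lambda>x. cmod (g x) / (nrm g + e))"
    unfolding modular_def using assms r
    by (intro integral_mono X_integrable_div Phi_mono divide_right_mono) auto
  also have "\<dots> \<le> 1" using e by (intro modular_le_1 assms) auto
  finally show "nrm f \<le> nrm g + e" using r assms by (intro nrm_le)
qed

lemma nrm_zero [simp]: "nrm (\<lambda>_. 0) = 0"
proof (rule antisym)
  show "nrm (\<lambda>_. 0) \<le> 0"
    by (rule field_le_epsilon, rule nrm_le) (auto simp: modular_def)
qed (simp add: nrm_nonneg)

lemma nrm_cmult:
  assumes "f \<in> X"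
  shows "nrm (\<lambda>x. a * f x) = cmod a * nrm f"
proof -
  have le: "nrm (\<lambda>x. a * f x) \<le> cmod a * nrm f" if f: "f \<in> X" and a: "a \<noteq> 0" for f a
  proof (rule field_le_epsilon)
    fix e :: real assume e: "0 < e"
    define r where "r = nrm f + e / cmod a"
    have r: "0 < r" "nrm f < r" using nrm_nonneg[OF f] e a by (auto simp: r_def add_nonneg_pos)
    have "nrm (\<lambda>x. a * f x) \<le> cmod a * r"
      using f r a modular_le_1[OF f r(2)] by (intro nrm_le) (auto simp: norm_mult)
    also have "\<dots> = cmod a * nrm f + e" using a by (simp add: r_def distrib_left)
    finally show "nrm (\<lambda>x. a * f x) \<le> cmod a * nrm f + e" .
  qed
  show ?thesis
  proof (cases "a = 0")
    case False
    have "nrm (\<lambda>x. inverse a * (a * f x)) \<le> cmod (inverse a) * nrm (\<lambda>x. a * f x)"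
      using le[of "\<lambda>x. a * f x" "inverse a"] assms False by auto
    moreover have "(\<lambda>x. inverse a * (a * f x)) = f" using False by (auto simp: fun_eq_iff)
    ultimately have "nrm f \<le> nrm (\<lambda>x. a * f x) / cmod a"
      using False by (simp add: norm_inverse divide_inverse mult.commute)
    then show ?thesis using le[OF assms False] False by (intro antisym) (simp_all add: field_simps)
  qed simp
qed

lemma nrm_uminus: "f \<in> X \<Longrightarrow> nrm (\<lambda>x. - f x) = nrm f"
  using nrm_cmult[of f "-1"] by simp

lemma nrm_triangle:
  assumes "f \<in> X" "g \<in> X"
  shows "nrm (\<lambda>x. f x + g x) \<le> nrm f + nrm g"
proof (rule field_le_epsilon)
  fix e :: real assume e: "0 < e"
  define r s where "r = nrm f + e / 2" and "s = nrm g + e / 2"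
  have rs: "0 < r" "0 < s" "nrm f < r" "nrm g < s"
    using e nrm_nonneg[OF assms(1)] nrm_nonneg[OF assms(2)] by (auto simp: r_def s_def)
  define m where "m = s / (r + s)"
  have m: "0 \<le> m" "m \<le> 1" "1 - m = r / (r + s)" using rs by (auto simp: m_def field_simps)
  have pw: "Phi (cmod (f x + g x) / (r + s)) \<le> (1 - m) * Phi (cmod (f x) / r) + m * Phi (cmod (g x) / s)" for x
  proof -
    have "cmod (f x + g x) / (r + s) \<le> (cmod (f x) + cmod (g x)) / (r + s)"
      using rs by (intro divide_right_mono norm_triangle_ineq) auto
    also have "\<dots> = (1 - m) * (cmod (f x) / r) + m * (cmod (g x) / s)"
      unfolding m(3) using rs by (simp add: m_def add_divide_distrib)
    finally have "Phi (cmod (f x + g x) / (r + s)) \<le> Phi ((1 - m) * (cmod (f x) / r) + m * (cmod (g x) / s))"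
      using rs by (intro Phi_mono) auto
    also have "\<dots> \<le> (1 - m) * Phi (cmod (f x) / r) + m * Phi (cmod (g x) / s)"
      using convex_onD[OF Phi_convex, of m "cmod (f x) / r" "cmod (g x) / s"] m rs by simp
    finally show ?thesis .
  qed
  have "modular (\<lambda>x. cmod (f x + g x) / (r + s))
      \<le> (\<integral>x. (1 - m) * Phi (cmod (f x) / r) + m * Phi (cmod (g x) / s) \<partial>TM)"
    unfolding modular_def using assms rs pw
    by (intro integral_mono Bochner_Integration.integrable_add integrable_mult_right X_integrable_div X_add) auto
  also have "\<dots> = (1 - m) * modular (\<lambda>x. cmod (f x) / r) + m * modular (\<lambda>x. cmod (g x) / s)"
    unfolding modular_def using assms rs X_integrable_div[of f r] X_integrable_div[of g s]
    by (subst Bochner_Integration.integral_add) auto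
  also have "\<dots> \<le> (1 - m) * 1 + m * 1"
    using m rs assms by (intro add_mono mult_left_mono modular_le_1) auto
  finally have "nrm (\<lambda>x. f x + g x) \<le> r + s" using assms rs by (intro nrm_le) auto
  then show "nrm (\<lambda>x. f x + g x) \<le> nrm f + nrm g + e" by (simp add: r_def s_def)
qed

lemma nrm_triangle_diff:
  assumes "f \<in> X" "g \<in> X"
  shows "nrm (\<lambda>x. f x - g x) \<le> nrm f + nrm g"
  using nrm_triangle[of f "\<lambda>x. - g x"] nrm_uminus[of g] assms by simp

lemma nrm_sum:
  "finite A \<Longrightarrow> (\<And>i. i \<in> A \<Longrightarrow> g i \<in> X) \<Longrightarrow> nrm (\<lambda>x. \<Sum>i\<in>A. g i x) \<le> (\<Sum>i\<in>A. nrm (g i))"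
proof (induction A rule: finite_induct)
  case (insert a A)
  then have "nrm (\<lambda>x. g a x + (\<Sum>i\<in>A. g i x)) \<le> nrm (g a) + nrm (\<lambda>x. \<Sum>i\<in>A. g i x)"
    by (intro nrm_triangle) auto
  then show ?case using insert by simp
qed simp

section \<open>Smoothness of the norm and norming functionals\<close>

lemma dPhi_add: "dPhi z (v + w) = dPhi z v + dPhi z w"
  by (simp add: dPhi_def distrib_left add_divide_distrib distrib_right)

lemma dPhi_scaleR: "dPhi z (of_real a * w) = a * dPhi z w"
  by (simp add: dPhi_def algebra_simps)

lemma dPhi_uminus: "dPhi z (- w) = - dPhi z w"
  using dPhi_scaleR[of z "-1" w] by simp

lemma dPhi_self: "dPhi z z = cmod z * phi (cmod z)"
proof -
  have "Re (cnj z * z) = (cmod z)^2" unfolding cmod_power2 by (simp add: power2_eq_square)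
  then show ?thesis by (simp add: dPhi_def power2_eq_square)
qed

lemma phi_comp_measurable [measurable]:
  "f \<in> borel_measurable M \<Longrightarrow> (\<lambda>x. phi (f x)) \<in> borel_measurable M"
  by (rule measurable_compose[OF _ phi_measurable])

lemma cnj_measurable [measurable]:
  "f \<in> borel_measurable M \<Longrightarrow> (\<lambda>x. cnj (f x)) \<in> borel_measurable M"
  by (rule borel_measurable_continuous_on[where f = cnj]) (auto intro: continuous_intros)

lemma dPhi_measurable [measurable]:
  assumes [measurable]: "f \<in> borel_measurable M" "g \<in> borel_measurable M"
  shows "(\<lambda>x. dPhi (f x) (g x)) \<in> borel_measurable M"
  unfolding dPhi_def by measurable

text \<open>The tangent inequality at |u| plays the part of Young's inequality for the product, and
  \<open>Phi_lower\<close> controls the resulting \<open>|u| phi(|u|)\<close>.\<close>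

lemma phi_times_integrable:
  assumes "u \<in> X" "v \<in> X"
  shows "integrable TM (\<lambda>x. phi (cmod (u x)) * cmod (v x))"
proof -
  note [measurable] = X_measurable[OF assms(1)] X_measurable[OF assms(2)]
  obtain D where D: "1 \<le> D" "\<And>t. 0 \<le> t \<Longrightarrow> t * phi t \<le> D * Phi t"
    using Phi_lower by blast
  have "integrable TM (\<lambda>x. D * Phi (cmod (u x)) + Phi (cmod (v x)))"
    using assms by (intro Bochner_Integration.integrable_add integrable_mult_right X_integrable1)
  then show ?thesis
  proof (rule Bochner_Integration.integrable_bound)
    show "AE x in TM. norm (phi (cmod (u x)) * cmod (v x)) \<le> norm (D * Phi (cmod (u x)) + Phi (cmod (v x)))"
    proof (rule AE_I2)
      fix x
      have "phi (cmod (u x)) * cmod (v x) \<le> cmod (u x) * phi (cmod (u x)) + Phi (cmod (v x))"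
      proof -
        have "phi (cmod (u x)) * (cmod (v x) - cmod (u x)) = phi (cmod (u x)) * cmod (v x) - cmod (u x) * phi (cmod (u x))"
          by (simp add: algebra_simps)
        then show ?thesis
          using Phi_tangent[of "cmod (u x)" "cmod (v x)"] Phi_nonneg[of "cmod (u x)"] norm_ge_zero[of "u x"] norm_ge_zero[of "v x"]
          by linarith
      qed
      also have "\<dots> \<le> D * Phi (cmod (u x)) + Phi (cmod (v x))" using D(2)[of "cmod (u x)"] by simp
      finally show "norm (phi (cmod (u x)) * cmod (v x)) \<le> norm (D * Phi (cmod (u x)) + Phi (cmod (v x)))"
        using D by simp
    qed
  qed measurable
qed

lemma dPhi_integrable:
  assumes "u \<in> X" "v \<in> X"
  shows "integrable TM (\<lambda>x. dPhi (u x) (v x))"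
proof (rule Bochner_Integration.integrable_bound[OF phi_times_integrable[OF assms]])
  note [measurable] = X_measurable[OF assms(1)] X_measurable[OF assms(2)]
  show "(\<lambda>x. dPhi (u x) (v x)) \<in> borel_measurable TM" by measurable
  show "AE x in TM. norm (dPhi (u x) (v x)) \<le> norm (phi (cmod (u x)) * cmod (v x))"
    using dPhi_bound by (intro AE_I2) simp
qed

lemma modular_unit_ball:
  assumes "v \<in> X" "nrm v \<le> 1"
  shows "modular (\<lambda>x. cmod (v x)) \<le> 1"
proof (cases "nrm v = 1")
  case True
  then show ?thesis using modular_eq_1[OF assms(1)] by simp
next
  case False
  then show ?thesis using modular_le_1[OF assms(1), of 1] assms by simp
qed

definition weight :: "(real \<Rightarrow> complex) \<Rightarrow> real" where
  "weight u = (\<integral>x. phi (cmod (u x)) * cmod (u x) \<partial>TM)"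

text \<open>For \<open>nrm u = 1\<close> this is the derivative of the norm at \<open>u\<close> in
  direction \<open>v\<close>, found by implicit differentiation of the equation modular = 1. The
  division by \<open>weight u\<close> normalises it to 1 for \<open>v = u\<close>.\<close>

definition slope :: "(real \<Rightarrow> complex) \<Rightarrow> (real \<Rightarrow> complex) \<Rightarrow> real" where
  "slope u v = (\<integral>x. dPhi (u x) (v x) \<partial>TM) / weight u"

lemma slope_uminus: "slope u (\<lambda>x. - v x) = - slope u v"
  by (simp add: slope_def dPhi_uminus)

context
  fixes u :: "real \<Rightarrow> complex"
  assumes u: "u \<in> X" "nrm u = 1"
begin

lemma modular_u: "modular (\<lambda>x. cmod (u x)) = 1"
  using modular_eq_1[OF u(1)] u(2) by simp

lemma weight_ge_1: "1 \<le> weight u"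
proof -
  have "1 = modular (\<lambda>x. cmod (u x))" by (simp add: modular_u)
  also have "\<dots> \<le> weight u" unfolding modular_def weight_def
    using Phi_upper by (intro integral_mono X_integrable1 phi_times_integrable u) (simp add: mult.commute)
  finally show ?thesis .
qed

text \<open>Integrate the tangent inequality at |u|: the difference of the two modulars is at most
  0, because that of \<open>u\<close> is 1 and that of \<open>v\<close> at most 1.\<close>

lemma slope_le_1:
  assumes "v \<in> X" "nrm v \<le> 1"
  shows "\<bar>slope u v\<bar> \<le> 1"
proof -
  have "\<bar>\<integral>x. dPhi (u x) (v x) \<partial>TM\<bar> \<le> (\<integral>x. phi (cmod (u x)) * cmod (v x) \<partial>TM)"
    using dPhi_bound u assms
    by (intro order.trans[OF integral_abs_bound] integral_mono integrable_abs dPhi_integrable phi_times_integrable)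
  also have "\<dots> \<le> (\<integral>x. phi (cmod (u x)) * cmod (u x) + (Phi (cmod (v x)) - Phi (cmod (u x))) \<partial>TM)"
  proof (intro integral_mono phi_times_integrable u assms)
    show "integrable TM (\<lambda>x. phi (cmod (u x)) * cmod (u x) + (Phi (cmod (v x)) - Phi (cmod (u x))))"
      by (intro Bochner_Integration.integrable_add Bochner_Integration.integrable_diff
          phi_times_integrable X_integrable1 u assms)
    fix x show "phi (cmod (u x)) * cmod (v x) \<le> phi (cmod (u x)) * cmod (u x) + (Phi (cmod (v x)) - Phi (cmod (u x)))"
      using Phi_tangent[of "cmod (u x)" "cmod (v x)"] by (simp add: algebra_simps)
  qed
  also have "\<dots> = weight u + (modular (\<lambda>x. cmod (v x)) - modular (\<lambda>x. cmod (u x)))"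
    unfolding weight_def modular_def
    by (subst Bochner_Integration.integral_add Bochner_Integration.integral_diff;
        (intro Bochner_Integration.integrable_add Bochner_Integration.integrable_diff
          phi_times_integrable X_integrable1 u assms)?)+ simp
  also have "\<dots> \<le> weight u" using modular_unit_ball[OF assms] modular_u by simp
  finally show ?thesis using weight_ge_1 by (simp add: slope_def)
qed

end

text \<open>
  The modular of \<open>(u + \<lambda> v) / s\<close> is tested at \<open>s = 1 + \<lambda> slope u v + K \<omega>(\<lambda>)\<close>: the terms of
  first order in \<open>\<lambda>\<close> then cancel, and the last summand of \<open>s\<close> absorbs the remainder.
\<close>

lemma nrm_le_second_order:
  obtains K where "1 \<le> K" "\<And>u v l. u \<in> X \<Longrightarrow> v \<in> X \<Longrightarrow> nrm u = 1 \<Longrightarrow> nrm v \<le> 1 \<Longrightarrow> 0 < l \<Longrightarrow> l \<le> 1/4 \<Longrightarrow>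
     K * omega l \<le> l \<Longrightarrow> nrm (\<lambda>x. u x + of_real l * v x) \<le> 1 + l * slope u v + K * omega l"
proof -
  obtain K1 where K1: "1 \<le> K1" "\<And>l z w s. 0 < l \<Longrightarrow> l \<le> 1 \<Longrightarrow> 0 \<le> s \<Longrightarrow> cmod w \<le> l * s \<Longrightarrow>
      Phi (cmod (z + w)) \<le> Phi (cmod z) + dPhi z w + K1 * omega l * (Phi (cmod z) + Phi s)"
    using Phi_second_order by blast
  obtain K8 where K8: "1 \<le> K8" "\<And>s. 0 \<le> s \<Longrightarrow> Phi (8 * s) \<le> K8 * Phi s"
    using Phi_dilate[of 8] by auto
  \<comment> \<open>Twice the coefficient of the remainder, because the summand \<open>r\<close> of
    \<open>s\<close> lowers the modular by at least \<open>r / 2\<close> only.\<close>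
  define K where "K = 2 * (K1 * (1 + 2 * K8))"
  have "1 * 1 \<le> K1 * (1 + 2 * K8)" using K1 K8 by (intro mult_mono) auto
  then have K: "1 \<le> K" by (simp add: K_def)
  show ?thesis
  proof (rule that[OF K])
    fix u v :: "real \<Rightarrow> complex" and l :: real
    assume u: "u \<in> X" "nrm u = 1" and v: "v \<in> X" "nrm v \<le> 1" and l: "0 < l" "l \<le> 1/4"
      and small: "K * omega l \<le> l"
    define r where "r = K * omega l"
    define g where "g = l * slope u v + r"
    define s where "s = 1 + g"
    have r: "0 \<le> r" "r \<le> l" using small K by (auto simp: r_def)
    have sl: "\<bar>l * slope u v\<bar> \<le> l"
      using slope_le_1[OF u v] l by (simp add: abs_mult mult_left_le)
    have g: "\<bar>g\<bar> \<le> 2 * l" using sl r by (auto simp: g_def)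
    have s: "1/2 \<le> s" "s \<le> 3/2" using sl r l by (auto simp: s_def g_def)
    \<comment> \<open>The increment for which \<open>u + w = (u + l v) / s\<close>; the expansion
      can then be taken at \<open>u\<close> itself, whose modular is 1.\<close>
    define w where "w x = of_real (l / s) * v x + of_real (- (g / s)) * u x" for x
    have w: "w \<in> X" unfolding w_def[abs_def] using u v by (intro X_add X_cmult)
    have uw: "u x + w x = of_real (1 / s) * (u x + of_real l * v x)" for x
    proof -
      have "1 - g / s = 1 / s" using s by (simp add: s_def field_simps)
      then have "of_real (1 - g / s) * u x = of_real (1 / s) * u x" by simp
      then show ?thesis using s by (simp add: w_def algebra_simps)
    qed
    have wle: "cmod (w x) \<le> l * (4 * (cmod (u x) + cmod (v x)))" for x
    proof -
      have "cmod (w x) \<le> \<bar>l / s\<bar> * cmod (v x) + \<bar>g / s\<bar> * cmod (u x)"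
        unfolding w_def by (rule order.trans[OF norm_triangle_ineq]) (simp only: norm_mult norm_of_real abs_minus_cancel order_refl)
      also have "\<dots> \<le> (4 * l) * cmod (v x) + (4 * l) * cmod (u x)"
      proof (intro add_mono mult_right_mono)
        have "l * 1 \<le> l * (4 * s)" using s l by (intro mult_left_mono) auto
        then show "\<bar>l / s\<bar> \<le> 4 * l" using s l by (simp add: field_simps)
        have "\<bar>g\<bar> * 1 \<le> 2 * l * (2 * s)" using s l g by (intro mult_mono) auto
        then show "\<bar>g / s\<bar> \<le> 4 * l" using s l by (simp add: field_simps)
      qed auto
      finally show ?thesis by (simp add: algebra_simps)
    qed
    let ?P = "\<lambda>x. Phi (cmod (u x))" and ?Q = "\<lambda>x. Phi (cmod (v x))"
    have pw: "Phi (cmod (u x + w x)) \<le> ?P x + dPhi (u x) (w x) + K1 * omega l * (?P x + K8 * (?P x + ?Q x))" for x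
    proof -
      have "4 * (cmod (u x) + cmod (v x)) \<le> 8 * max (cmod (u x)) (cmod (v x))" by (simp add: max_def)
      then have "Phi (4 * (cmod (u x) + cmod (v x))) \<le> Phi (8 * max (cmod (u x)) (cmod (v x)))"
        by (intro Phi_mono) auto
      also have "\<dots> \<le> K8 * Phi (max (cmod (u x)) (cmod (v x)))" by (rule K8(2)) (simp add: le_max_iff_disj)
      also have "\<dots> \<le> K8 * (?P x + ?Q x)" using K8 by (intro mult_left_mono Phi_max_le) auto
      finally have *: "Phi (4 * (cmod (u x) + cmod (v x))) \<le> K8 * (?P x + ?Q x)" .
      have "Phi (cmod (u x + w x)) \<le> ?P x + dPhi (u x) (w x)
          + K1 * omega l * (?P x + Phi (4 * (cmod (u x) + cmod (v x))))"
        using wle l by (intro K1) auto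
      also have "\<dots> \<le> ?P x + dPhi (u x) (w x) + K1 * omega l * (?P x + K8 * (?P x + ?Q x))"
        using * K1 by (intro add_left_mono mult_left_mono) auto
      finally show ?thesis .
    qed
    have intP: "integrable TM ?P" "integrable TM ?Q"
      using u v by (auto intro: X_integrable1)
    have intw: "integrable TM (\<lambda>x. dPhi (u x) (w x))" using u w by (intro dPhi_integrable)
    have "modular (\<lambda>x. cmod (u x + w x)) \<le> (\<integral>x. ?P x + dPhi (u x) (w x) + K1 * omega l * (?P x + K8 * (?P x + ?Q x)) \<partial>TM)"
      unfolding modular_def using pw intP intw u v w
      by (intro integral_mono X_integrable1 X_add Bochner_Integration.integrable_add integrable_mult_right)
    also have "\<dots> = modular (\<lambda>x. cmod (u x)) + (\<integral>x. dPhi (u x) (w x) \<partial>TM)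
        + K1 * omega l * (modular (\<lambda>x. cmod (u x)) + K8 * (modular (\<lambda>x. cmod (u x)) + modular (\<lambda>x. cmod (v x))))"
      unfolding modular_def using intP intw by simp
    also have "\<dots> \<le> 1 + (\<integral>x. dPhi (u x) (w x) \<partial>TM) + K1 * omega l * (1 + K8 * (1 + 1))"
      using modular_u[OF u] modular_unit_ball[OF v] K1 K8
      by (intro add_mono mult_left_mono) auto
    also have "(\<integral>x. dPhi (u x) (w x) \<partial>TM) = - (r * weight u / s)"
    proof -
      have "(\<integral>x. dPhi (u x) (w x) \<partial>TM) = (\<integral>x. (l / s) * dPhi (u x) (v x) + (- (g / s)) * (phi (cmod (u x)) * cmod (u x)) \<partial>TM)"
        by (intro Bochner_Integration.integral_cong) (simp_all only: w_def dPhi_add dPhi_scaleR dPhi_self mult.commute[of "phi _"])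
      also have "\<dots> = (l / s) * (\<integral>x. dPhi (u x) (v x) \<partial>TM) + (- (g / s)) * weight u"
        unfolding weight_def using dPhi_integrable[OF u(1) v(1)] phi_times_integrable[OF u(1) u(1)]
        by (subst Bochner_Integration.integral_add) (auto simp only: integrable_mult_right integral_mult_right_zero)
      also have "(\<integral>x. dPhi (u x) (v x) \<partial>TM) = slope u v * weight u"
        using weight_ge_1[OF u] by (simp add: slope_def)
      also have "(l / s) * (slope u v * weight u) + (- (g / s)) * weight u = - (r * weight u / s)"
        unfolding g_def using s by (simp add: field_simps)
      finally show ?thesis .
    qed
    also have "- (r * weight u / s) \<le> - (r / 2)"
    proof -
      have "r * s \<le> r * (2 * weight u)" using r s weight_ge_1[OF u] by (intro mult_left_mono) auto
      then show ?thesis using s by (simp add: field_simps)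
    qed
    finally have "modular (\<lambda>x. cmod (u x + w x)) \<le> 1 + - (r / 2) + K1 * omega l * (1 + K8 * (1 + 1))"
      by simp
    also have "\<dots> = 1" by (simp add: r_def K_def algebra_simps)
    finally have le1: "modular (\<lambda>x. cmod (u x + w x)) \<le> 1" .
    have "cmod (u x + w x) = cmod (u x + of_real l * v x) / s" for x
    proof -
      have "0 < s" using s by simp
      then show ?thesis unfolding uw norm_mult norm_of_real by simp
    qed
    then have "modular (\<lambda>x. cmod (u x + of_real l * v x) / s) \<le> 1" using le1 by simp
    then have "nrm (\<lambda>x. u x + of_real l * v x) \<le> s"
      using u v s by (intro nrm_le) auto
    then show "nrm (\<lambda>x. u x + of_real l * v x) \<le> 1 + l * slope u v + K * omega l"
      by (simp add: s_def g_def r_def)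
  qed
qed

lemma nrm_smooth:
  obtains K where "1 \<le> K" "\<And>u v l. u \<in> X \<Longrightarrow> v \<in> X \<Longrightarrow> nrm u = 1 \<Longrightarrow> nrm v \<le> 1 \<Longrightarrow> 0 < l \<Longrightarrow> l \<le> 1/4 \<Longrightarrow>
     nrm (\<lambda>x. u x + of_real l * v x) + nrm (\<lambda>x. u x - of_real l * v x) \<le> 2 + K * omega l"
proof -
  obtain K where K: "1 \<le> K" "\<And>u v l. u \<in> X \<Longrightarrow> v \<in> X \<Longrightarrow> nrm u = 1 \<Longrightarrow> nrm v \<le> 1 \<Longrightarrow> 0 < l \<Longrightarrow> l \<le> 1/4 \<Longrightarrow>
     K * omega l \<le> l \<Longrightarrow> nrm (\<lambda>x. u x + of_real l * v x) \<le> 1 + l * slope u v + K * omega l"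
    using nrm_le_second_order by blast
  show ?thesis
  proof (rule that[of "2 * K"])
    show "1 \<le> 2 * K" using K by simp
    fix u v :: "real \<Rightarrow> complex" and l :: real
    assume u: "u \<in> X" "nrm u = 1" and v: "v \<in> X" "nrm v \<le> 1" and l: "0 < l" "l \<le> 1/4"
    show "nrm (\<lambda>x. u x + of_real l * v x) + nrm (\<lambda>x. u x - of_real l * v x) \<le> 2 + 2 * K * omega l"
    proof (cases "K * omega l \<le> l")
      case True
      have "nrm (\<lambda>x. u x + of_real l * v x) \<le> 1 + l * slope u v + K * omega l"
        using K(2)[of u v l] u v l True by blast
      moreover have "nrm (\<lambda>x. u x + of_real l * (- v x)) \<le> 1 + l * slope u (\<lambda>x. - v x) + K * omega l"
        using u v l True by (intro K(2)) (auto simp: nrm_uminus)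
      ultimately show ?thesis by (simp add: slope_uminus)
    next
      case False
      have "nrm (\<lambda>x. of_real l * v x) \<le> l"
        using v l by (simp add: nrm_cmult mult_left_le)
      moreover have "nrm (\<lambda>x. u x + of_real l * v x) \<le> nrm u + nrm (\<lambda>x. of_real l * v x)"
        "nrm (\<lambda>x. u x - of_real l * v x) \<le> nrm u + nrm (\<lambda>x. of_real l * v x)"
        using nrm_triangle[of u "\<lambda>x. of_real l * v x"] nrm_triangle_diff[of u "\<lambda>x. of_real l * v x"] u(1) v(1) by auto
      ultimately show ?thesis using u False by simp
    qed
  qed
qed

section \<open>Norming functionals\<close>

lemma
  assumes "norming Phi F g"
  shows norming_add: "u \<in> X \<Longrightarrow> v \<in> X \<Longrightarrow> F (\<lambda>x. u x + v x) = F u + F v"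
    and norming_cmult: "u \<in> X \<Longrightarrow> F (\<lambda>x. a * u x) = a * F u"
    and norming_le: "u \<in> X \<Longrightarrow> cmod (F u) \<le> nrm u"
    and norming_self: "F g = of_real (nrm g)"
  using assms by (auto simp: norming_def)

lemma norming_zero: "norming Phi F g \<Longrightarrow> F (\<lambda>_. 0) = 0"
  using norming_cmult[of F g "\<lambda>_. 0" 0] by simp

lemma norming_sum:
  assumes "norming Phi F g"
  shows "finite A \<Longrightarrow> (\<And>i. i \<in> A \<Longrightarrow> h i \<in> X) \<Longrightarrow> F (\<lambda>x. \<Sum>i\<in>A. a i * h i x) = (\<Sum>i\<in>A. a i * F (h i))"
proof (induction A rule: finite_induct)
  case (insert i A)
  then have "F (\<lambda>x. a i * h i x + (\<Sum>i\<in>A. a i * h i x)) = F (\<lambda>x. a i * h i x) + F (\<lambda>x. \<Sum>i\<in>A. a i * h i x)"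
    by (intro norming_add[OF assms]) auto
  then show ?case using insert by (simp add: norming_cmult[OF assms])
qed (simp add: norming_zero[OF assms])

definition smoothness_const :: "real \<Rightarrow> bool" where
  "smoothness_const K \<longleftrightarrow> (\<forall>F u v l. norming Phi F u \<longrightarrow> u \<in> X \<longrightarrow> 0 < nrm u \<longrightarrow> v \<in> X \<longrightarrow> nrm v \<le> 1 \<longrightarrow>
     0 < l \<longrightarrow> l \<le> 1/4 \<longrightarrow> (\<exists>t. nrm (\<lambda>x. u x - t * v x) \<le> nrm u * (1 - l * cmod (F v) + K * omega l)))"

text \<open>The norming functional bounds the norm of \<open>u + l v\<close> below by
  \<open>1 + l |F v|\<close> for normalised \<open>u\<close>. Smoothness bounds the sum over both
  signs, so \<open>u - l v\<close> must be small.\<close>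

lemma greedy_decrement:
  obtains K where "1 \<le> K" "smoothness_const K"
proof -
  obtain K where K: "1 \<le> K" "\<And>u v l. u \<in> X \<Longrightarrow> v \<in> X \<Longrightarrow> nrm u = 1 \<Longrightarrow> nrm v \<le> 1 \<Longrightarrow> 0 < l \<Longrightarrow> l \<le> 1/4 \<Longrightarrow>
     nrm (\<lambda>x. u x + of_real l * v x) + nrm (\<lambda>x. u x - of_real l * v x) \<le> 2 + K * omega l"
    using nrm_smooth by blast
  show ?thesis
  proof (rule that[OF K(1)], unfold smoothness_const_def, intro allI impI)
    fix F and u v :: "real \<Rightarrow> complex" and l :: real
    assume F: "norming Phi F u" and u: "u \<in> X" "0 < nrm u" and v: "v \<in> X" "nrm v \<le> 1"
      and l: "0 < l" "l \<le> 1/4"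
    \<comment> \<open>A unimodular factor that rotates \<open>F v\<close> to the nonnegative real
      axis.\<close>
    define th where "th = (if F v = 0 then 1 else cnj (F v) / cmod (F v))"
    have th: "cmod th = 1" "th * F v = of_real (cmod (F v))"
      by (auto simp: th_def norm_divide complex_norm_square[symmetric] mult.commute[of "cnj _"] power2_eq_square)
    define u' where "u' x = of_real (1 / nrm u) * u x" for x
    define v' where "v' x = th * v x" for x
    have u': "u' \<in> X" "nrm u' = 1" unfolding u'_def[abs_def] using u by (simp_all only: X_cmult nrm_cmult norm_of_real) simp
    have v': "v' \<in> X" "nrm v' \<le> 1" unfolding v'_def[abs_def] using v th by (auto simp: nrm_cmult)
    have Fu': "F u' = 1" unfolding u'_def[abs_def] norming_cmult[OF F u(1)] norming_self[OF F] using u by simp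
    have Fv': "F v' = of_real (cmod (F v))" unfolding v'_def[abs_def] norming_cmult[OF F v(1)] th ..
    have "F (\<lambda>x. u' x + of_real l * v' x) = of_real (1 + l * cmod (F v))"
      using u' v' by (simp add: norming_add[OF F] norming_cmult[OF F] Fu' Fv')
    then have "cmod (of_real (1 + l * cmod (F v))) \<le> nrm (\<lambda>x. u' x + of_real l * v' x)"
      using norming_le[OF F, of "\<lambda>x. u' x + of_real l * v' x"] u' v' by simp
    then have "1 + l * cmod (F v) \<le> nrm (\<lambda>x. u' x + of_real l * v' x)"
      using l by (simp only: norm_of_real)
    moreover have "nrm (\<lambda>x. u' x + of_real l * v' x) + nrm (\<lambda>x. u' x - of_real l * v' x) \<le> 2 + K * omega l"
      using K(2) u' v' l by blast
    ultimately have "nrm (\<lambda>x. u' x - of_real l * v' x) \<le> 1 - l * cmod (F v) + K * omega l" by linarith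
    then have "nrm u * nrm (\<lambda>x. u' x - of_real l * v' x) \<le> nrm u * (1 - l * cmod (F v) + K * omega l)"
      using u by (intro mult_left_mono) auto
    moreover have "nrm u * nrm (\<lambda>x. u' x - of_real l * v' x) = nrm (\<lambda>x. of_real (nrm u) * (u' x - of_real l * v' x))"
      using u u' v' by (subst nrm_cmult) auto
    moreover have "(\<lambda>x. of_real (nrm u) * (u' x - of_real l * v' x)) = (\<lambda>x. u x - (of_real (nrm u * l) * th) * v x)"
      using u by (auto simp: u'_def v'_def algebra_simps)
    ultimately show "\<exists>t. nrm (\<lambda>x. u x - t * v x) \<le> nrm u * (1 - l * cmod (F v) + K * omega l)"
      by (intro exI[of _ "of_real (nrm u * l) * th"]) simp
  qed
qed

text \<open>The exponent of \<open>omega\<close> exceeds 1; half of the excess is spent on absorbing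
  the logarithm, the other half remains.\<close>

lemma omega_superlinear:
  obtains K e where "1 \<le> K" "0 < e" "\<And>l. 0 < l \<Longrightarrow> l \<le> 1 \<Longrightarrow> omega l \<le> K * l * l powr e"
proof -
  define e where "e = (min p 2 - 1) / 2"
  have e: "0 < e" using p1 by (auto simp: e_def)
  define b where "b = (if p \<le> 2 then p * neg_part \<alpha> else 0)"
  have b: "0 \<le> b" by (simp add: b_def)
  obtain K where K: "1 \<le> K" "\<And>m. 0 < m \<Longrightarrow> m \<le> 1 \<Longrightarrow> m powr e * logfac c m powr b \<le> K"
    using logfac_powr_bounded[OF c1 e b] by blast
  show ?thesis
  proof (rule that[OF K(1) e])
    fix l :: real assume l: "0 < l" "l \<le> 1"
    have "omega l = l powr (1 + e + e) * logfac c l powr b" by (simp add: omega_def e_def b_def)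
    also have "\<dots> = l * l powr e * (l powr e * logfac c l powr b)" using l unfolding powr_add by simp
    also have "\<dots> \<le> l * l powr e * K" using K(2)[OF l] l by (intro mult_left_mono) auto
    finally show "omega l \<le> K * l * l powr e" by (simp add: mult_ac)
  qed
qed

text \<open>If \<open>F v\<close> were nonzero, a short step along \<open>v\<close> would lower the
  norm, the gain being linear in the step and the loss superlinear. This contradicts
  minimality.\<close>

lemma norming_annihilates:
  assumes F: "norming Phi F u" and u: "u \<in> X" "0 < nrm u" and v: "v \<in> X"
    and min: "\<And>t. nrm u \<le> nrm (\<lambda>x. u x - t * v x)"
  shows "F v = 0"
proof -
  obtain K where K: "1 \<le> K" "smoothness_const K"
    using greedy_decrement by blast
  obtain K' e where K': "1 \<le> K'" "0 < e" "\<And>l. 0 < l \<Longrightarrow> l \<le> 1 \<Longrightarrow> omega l \<le> K' * l * l powr e"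
    using omega_superlinear by blast
  define a where "a = 1 / (nrm v + 1)"
  have a: "0 < a" "a * nrm v \<le> 1" using nrm_nonneg[OF v] by (auto simp: a_def)
  define w where "w x = of_real a * v x" for x
  have w: "w \<in> X" "nrm w \<le> 1" unfolding w_def[abs_def] using v a by (auto simp: nrm_cmult)
  have Fw: "F w = of_real a * F v" unfolding w_def[abs_def] by (rule norming_cmult[OF F v])
  have "cmod (F w) = 0"
  proof (rule ccontr)
    assume "cmod (F w) \<noteq> 0"
    then have pos: "0 < cmod (F w)" by simp
    \<comment> \<open>The 2 makes the loss half of the gain, which is the contradiction obtained
      below.\<close>
    define d where "d = cmod (F w) / (2 * K * K')"
    have d: "0 < d" using pos K K' by (simp add: d_def)
    define l where "l = min (1/4) (d powr (1 / e))"
    have l: "0 < l" "l \<le> 1/4" using d by (auto simp: l_def)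
    have "l powr e \<le> (d powr (1 / e)) powr e" using l K' by (intro powr_mono2) (auto simp: l_def)
    also have "\<dots> = d" using K' d by (simp add: powr_powr)
    finally have le: "l powr e \<le> d" .
    obtain t where t: "nrm (\<lambda>x. u x - t * w x) \<le> nrm u * (1 - l * cmod (F w) + K * omega l)"
      using K(2)[unfolded smoothness_const_def, rule_format, OF F u w l] by blast
    have "(\<lambda>x. u x - t * w x) = (\<lambda>x. u x - (t * of_real a) * v x)" by (auto simp: w_def)
    then have "nrm u * 1 \<le> nrm (\<lambda>x. u x - t * w x)" using min by simp
    then have "nrm u * 1 \<le> nrm u * (1 - l * cmod (F w) + K * omega l)" using t by linarith
    then have "l * cmod (F w) \<le> K * omega l" using u by simp
    also have "\<dots> \<le> K * (K' * l * l powr e)" using K'(3)[of l] l K by (intro mult_left_mono) auto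
    also have "\<dots> \<le> K * (K' * l * d)" using le K K' l by (intro mult_left_mono) auto
    also have "\<dots> = l * (cmod (F w) / 2)" using K K' by (simp add: d_def)
    finally have "cmod (F w) \<le> cmod (F w) / 2" using l by simp
    then show False using pos by simp
  qed
  then show ?thesis using Fw a by simp
qed

end

section \<open>Trigonometric polynomials and a dual estimate\<close>

lemma cmod_trig [simp]: "cmod (trig n x) = 1"
  by (simp add: trig_def)

lemma continuous_on_trig: "continuous_on S (trig n)"
  unfolding trig_def by (intro continuous_intros)

lemma trig_measurable [measurable]: "trig n \<in> borel_measurable TM"
proof -
  have "trig n \<in> borel_measurable lborel"
    using borel_measurable_continuous_onI[OF continuous_on_trig] by simp
  then show ?thesis by (intro measurable_restrict_space1 measurable_completion)
qed

lemma trig_mult_cnj: "trig n x * cnj (trig m x) = trig (n - m) x"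
  by (simp add: trig_def cis_cnj cis_mult left_diff_distrib)

lemma torus_integrable_bounded:
  fixes f :: "real \<Rightarrow> 'a::{banach, second_countable_topology}"
  assumes "f \<in> borel_measurable TM" "\<And>x. x \<in> torus \<Longrightarrow> norm (f x) \<le> B"
  shows "integrable TM f"
  by (rule TM.integrable_const_bound[of _ B]) (use assms in \<open>auto intro: AE_I2\<close>)

lemma integral_trig: "(\<integral>x. trig n x \<partial>TM) = (if n = 0 then of_real (2 * pi) else 0)"
proof (cases "n = 0")
  case True
  then show ?thesis by (simp add: trig_def measure_torus scaleR_conv_of_real)
next
  case False
  define G where "G x = cis (real_of_int n * x) / (\<i> * of_int n)" for x
  have "(trig n has_integral (G pi - G (- pi))) {-pi..pi}"
  proof (rule fundamental_theorem_of_calculus)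
    fix x assume "x \<in> {-pi..pi}"
    have "((\<lambda>z. exp (\<i> * (of_int n * z)) / (\<i> * of_int n)) has_field_derivative exp (\<i> * (of_int n * of_real x))) (at (of_real x))"
      using False by (auto intro!: derivative_eq_intros simp: mult_ac)
    then have "((\<lambda>x. exp (\<i> * (of_int n * of_real x)) / (\<i> * of_int n)) has_vector_derivative exp (\<i> * (of_int n * of_real x))) (at x)"
      by (rule has_vector_derivative_real_field)
    then show "(G has_vector_derivative trig n x) (at x within {-pi..pi})"
      unfolding G_def[abs_def] trig_def cis_conv_exp by (simp add: has_vector_derivative_at_within)
  qed simp
  moreover have "G pi = G (- pi)"
  proof -
    have "sin (real_of_int n * pi) = 0" by (metis sin_npi_int mult.commute)
    then have "cis (real_of_int n * pi) = cis (- (real_of_int n * pi))"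
      by (simp add: complex_eq_iff)
    then show ?thesis by (simp add: G_def)
  qed
  ultimately have "integral {-pi..pi} (trig n) = 0" by (simp add: integral_unique)
  \<comment> \<open>The torus is half open, while the antiderivative was used on the closed
    interval; the difference is one point.\<close>
  moreover have "integral torus (trig n) = integral {-pi..pi} (trig n)"
  proof (rule integral_subset_negligible)
    have "{-pi..pi} - torus \<subseteq> {pi}" by (auto simp: torus_def)
    then show "negligible ({-pi..pi} - torus)" using negligible_subset by blast
  qed (auto simp: torus_def)
  moreover have "integrable TM (trig n)"
    by (rule torus_integrable_bounded[of _ 1]) auto
  then have "(\<integral>x. trig n x \<partial>TM) = integral torus (trig n)"
    by (rule lebesgue_integral_eq_integral) (simp add: torus_def)
  ultimately show ?thesis using False by simp
qed

lemma sum_cmod_le_l2: "(\<Sum>i\<in>A. cmod (a i)) \<le> sqrt (real (card A)) * sqrt (\<Sum>i\<in>A. (cmod (a i))^2)"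
  using L2_set_mult_ineq[of "\<lambda>_. 1" "\<lambda>i. cmod (a i)" A] by (simp add: L2_set_def)

definition tpoly :: "int set \<Rightarrow> (int \<Rightarrow> complex) \<Rightarrow> real \<Rightarrow> complex" where
  "tpoly S a x = (\<Sum>n\<in>S. a n * trig n x)"

lemma tpoly_measurable [measurable]: "tpoly S a \<in> borel_measurable TM"
  unfolding tpoly_def[abs_def] by measurable

lemma cmod_tpoly_le: "cmod (tpoly S a x) \<le> (\<Sum>n\<in>S. cmod (a n))"
  unfolding tpoly_def by (rule order.trans[OF norm_sum]) (simp add: norm_mult)

lemma integral_tpoly_cnj:
  assumes "finite S" "A \<subseteq> S"
  shows "(\<integral>x. tpoly S a x * cnj (tpoly A b x) \<partial>TM) = of_real (2 * pi) * (\<Sum>n\<in>A. a n * cnj (b n))"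
proof -
  have A: "finite A" using assms finite_subset by blast
  have int: "integrable TM (trig k)" for k
    by (rule torus_integrable_bounded[of _ 1]) auto
  have "tpoly S a x * cnj (tpoly A b x) = (\<Sum>n\<in>S. \<Sum>m\<in>A. (a n * cnj (b m)) * trig (n - m) x)" for x
    unfolding tpoly_def trig_mult_cnj[symmetric] cnj_sum sum_product complex_cnj_mult
    by (intro sum.cong refl) (simp add: mult_ac)
  then have "(\<integral>x. tpoly S a x * cnj (tpoly A b x) \<partial>TM)
      = (\<integral>x. (\<Sum>n\<in>S. \<Sum>m\<in>A. (a n * cnj (b m)) * trig (n - m) x) \<partial>TM)"
    by simp
  also have "\<dots> = (\<Sum>n\<in>S. \<Sum>m\<in>A. (a n * cnj (b m)) * (\<integral>x. trig (n - m) x \<partial>TM))"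
    using int by (subst Bochner_Integration.integral_sum; (simp add: Bochner_Integration.integral_sum)?)
  also have "\<dots> = (\<Sum>m\<in>A. \<Sum>n\<in>S. if n = m then of_real (2 * pi) * (a n * cnj (b m)) else 0)"
    by (subst sum.swap) (auto simp: integral_trig intro!: sum.cong)
  also have "\<dots> = (\<Sum>m\<in>A. of_real (2 * pi) * (a m * cnj (b m)))"
    using assms by (intro sum.cong refl) (auto simp: sum.delta)
  finally show ?thesis by (simp add: sum_distrib_left)
qed

lemma integral_tpoly_square:
  assumes "finite A"
  shows "(\<integral>x. (cmod (tpoly A b x))^2 \<partial>TM) = 2 * pi * (\<Sum>n\<in>A. (cmod (b n))^2)"
proof -
  have "complex_of_real (\<integral>x. (cmod (tpoly A b x))^2 \<partial>TM) = (\<integral>x. of_real ((cmod (tpoly A b x))^2) \<partial>TM)"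
    by (rule integral_complex_of_real[symmetric])
  also have "\<dots> = (\<integral>x. tpoly A b x * cnj (tpoly A b x) \<partial>TM)"
    by (simp only: complex_norm_square)
  also have "\<dots> = of_real (2 * pi * (\<Sum>n\<in>A. (cmod (b n))^2))"
    by (subst integral_tpoly_cnj[OF assms order.refl]) (simp add: complex_norm_square[symmetric])
  finally show ?thesis by (simp only: of_real_eq_iff)
qed

context llogl
begin

lemma trig_in_X [simp]: "trig n \<in> X"
  by (rule X_bounded[of _ 1]) auto

lemma tpoly_in_X [simp]: "finite S \<Longrightarrow> tpoly S a \<in> X"
  unfolding tpoly_def[abs_def] by (intro X_sum X_cmult trig_in_X)

lemma nrm_trig: "nrm (trig n) = nrm (trig 0)"
  by (rule antisym; rule nrm_mono) auto

text \<open>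
  \<open>D\<close> stands for an exponential sum with \<open>n\<close> unimodular coefficients; only the two bounds on
  its size are used.
\<close>

definition dual_bound :: "real \<Rightarrow> nat \<Rightarrow> bool" where
  "dual_bound w n \<longleftrightarrow> (\<forall>h D. h \<in> X \<longrightarrow> nrm h \<le> 1 \<longrightarrow> D \<in> borel_measurable TM \<longrightarrow>
     (\<forall>x\<in>torus. cmod (D x) \<le> real n) \<longrightarrow> (\<integral>x. (cmod (D x))^2 \<partial>TM) \<le> 2 * pi * real n \<longrightarrow>
     (\<integral>x. cmod (h x) * cmod (D x) \<partial>TM) \<le> w)"

lemma dual_bound_mono: "dual_bound v n \<Longrightarrow> v \<le> w \<Longrightarrow> dual_bound w n"
  unfolding dual_bound_def by (meson order.trans)

lemma dual_bound_nonneg: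
  assumes "dual_bound w n"
  shows "0 \<le> w"
proof -
  have "(\<integral>x. cmod ((\<lambda>_. 0) x) * cmod ((\<lambda>_. 0) x) \<partial>TM) \<le> w"
    by (rule assms[unfolded dual_bound_def, rule_format]) auto
  then show ?thesis by simp
qed

lemma dual_bound_scaled:
  assumes w: "dual_bound w n" and h: "h \<in> X" and D: "D \<in> borel_measurable TM"
    "\<And>x. x \<in> torus \<Longrightarrow> cmod (D x) \<le> real n" "(\<integral>x. (cmod (D x))^2 \<partial>TM) \<le> 2 * pi * real n"
  shows "(\<integral>x. cmod (h x) * cmod (D x) \<partial>TM) \<le> w * nrm h"
proof (rule field_le_epsilon)
  fix e :: real assume e: "0 < e"
  have w0: "0 \<le> w" by (rule dual_bound_nonneg[OF w])
  \<comment> \<open>A positive radius even if \<open>nrm h = 0\<close>; the 1 in the denominator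
    covers \<open>w = 0\<close>.\<close>
  define r where "r = nrm h + e / (w + 1)"
  have r: "0 < r" "nrm h \<le> r" "w * r \<le> w * nrm h + e"
  proof -
    show "0 < r" "nrm h \<le> r" using nrm_nonneg[OF h] e w0 by (auto simp: r_def add_nonneg_pos)
    have "w * e \<le> (w + 1) * e" using e by simp
    then have "w * (e / (w + 1)) \<le> e" using w0 by (simp add: field_simps)
    then show "w * r \<le> w * nrm h + e" by (simp add: r_def distrib_left)
  qed
  have "nrm (\<lambda>x. of_real (1 / r) * h x) \<le> 1"
    using h r by (subst nrm_cmult) (auto simp: norm_divide)
  then have "(\<integral>x. cmod (of_real (1 / r) * h x) * cmod (D x) \<partial>TM) \<le> w"
    using h D by (intro w[unfolded dual_bound_def, rule_format] X_cmult)
  moreover have "cmod (of_real (1 / r) * h x) * cmod (D x) = (1 / r) * (cmod (h x) * cmod (D x))" for x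
    using r by (simp add: norm_mult norm_divide)
  ultimately have "(1 / r) * (\<integral>x. cmod (h x) * cmod (D x) \<partial>TM) \<le> w" by simp
  then have "(\<integral>x. cmod (h x) * cmod (D x) \<partial>TM) \<le> w * r" using r by (simp add: field_simps)
  then show "(\<integral>x. cmod (h x) * cmod (D x) \<partial>TM) \<le> w * nrm h + e" using r by linarith
qed

text \<open>By orthogonality the coefficient pairing is an integral against the polynomial with
  coefficients \<open>b\<close>. Its supremum is controlled by the l1 norm of \<open>b\<close>, its
  L2 norm by Parseval.\<close>

lemma tpoly_pairing_le:
  assumes "dual_bound w n" "finite S" "A \<subseteq> S" "(\<Sum>i\<in>A. cmod (b i)) \<le> real n" "(\<Sum>i\<in>A. (cmod (b i))^2) \<le> real n"
  shows "cmod (\<Sum>i\<in>A. a i * cnj (b i)) \<le> w * nrm (tpoly S a)"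
proof -
  have A: "finite A" using assms finite_subset by blast
  have w0: "0 \<le> w * nrm (tpoly S a)"
    using dual_bound_nonneg[OF assms(1)] nrm_nonneg[OF tpoly_in_X[OF assms(2)]] by simp
  have "2 * pi * cmod (\<Sum>i\<in>A. a i * cnj (b i)) = cmod (\<integral>x. tpoly S a x * cnj (tpoly A b x) \<partial>TM)"
    unfolding integral_tpoly_cnj[OF assms(2,3)] norm_mult by simp
  also have "\<dots> \<le> (\<integral>x. cmod (tpoly S a x * cnj (tpoly A b x)) \<partial>TM)"
    by (rule integral_norm_bound)
  also have "\<dots> = (\<integral>x. cmod (tpoly S a x) * cmod (tpoly A b x) \<partial>TM)"
    by (simp add: norm_mult)
  also have "\<dots> \<le> w * nrm (tpoly S a)"
  proof (rule dual_bound_scaled[OF assms(1)])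
    show "cmod (tpoly A b x) \<le> real n" for x
      using cmod_tpoly_le[of A b x] assms(4) by linarith
    show "(\<integral>x. (cmod (tpoly A b x))^2 \<partial>TM) \<le> 2 * pi * real n"
      unfolding integral_tpoly_square[OF A] using assms(5) by (intro mult_left_mono) auto
  qed (use assms in auto)
  finally have "2 * pi * cmod (\<Sum>i\<in>A. a i * cnj (b i)) \<le> w * nrm (tpoly S a)" .
  moreover have "1 * cmod (\<Sum>i\<in>A. a i * cnj (b i)) \<le> 2 * pi * cmod (\<Sum>i\<in>A. a i * cnj (b i))"
    using pi_gt3 by (intro mult_right_mono) auto
  ultimately show ?thesis by linarith
qed

lemma coefficient_sum_le:
  assumes "dual_bound w n" "finite S" "A \<subseteq> S" "card A \<le> n"
  shows "(\<Sum>i\<in>A. cmod (a i)) \<le> w * nrm (tpoly S a)"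
proof -
  define b where "b i = (if a i = 0 then 0 else a i / cmod (a i))" for i
  have b: "a i * cnj (b i) = of_real (cmod (a i))" "cmod (b i) \<le> 1" for i
    by (auto simp: b_def norm_divide complex_norm_square[symmetric] power2_eq_square)
  have "(\<Sum>i\<in>A. cmod (b i)) \<le> real (card A)" using sum_mono[of A "\<lambda>i. cmod (b i)" "\<lambda>_. 1"] b by simp
  moreover have "(\<Sum>i\<in>A. (cmod (b i))^2) \<le> real (card A)"
    using sum_mono[of A "\<lambda>i. (cmod (b i))^2" "\<lambda>_. 1"] b by (simp add: power_le_one)
  ultimately have "cmod (\<Sum>i\<in>A. a i * cnj (b i)) \<le> w * nrm (tpoly S a)"
    using assms by (intro tpoly_pairing_le[where n = n]) auto
  moreover have "(\<Sum>i\<in>A. a i * cnj (b i)) = of_real (\<Sum>i\<in>A. cmod (a i))" by (simp add: b)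
  ultimately show ?thesis by (simp only: norm_of_real)
qed

text \<open>Test with the multiple of \<open>a\<close> whose l2 norm is the square root of
  \<open>n\<close>; Cauchy-Schwarz then gives the required l1 bound. The estimate serves the
  projection bound for p = 2.\<close>

lemma coefficient_l2_le:
  assumes "dual_bound w n" "finite S" "A \<subseteq> S" "card A \<le> n" "1 \<le> n"
  shows "sqrt (\<Sum>i\<in>A. (cmod (a i))^2) \<le> w / sqrt (real n) * nrm (tpoly S a)"
proof -
  define s where "s = sqrt (\<Sum>i\<in>A. (cmod (a i))^2)"
  have s2: "s^2 = (\<Sum>i\<in>A. (cmod (a i))^2)" by (simp add: s_def sum_nonneg)
  have s0: "0 \<le> s" by (simp add: s_def sum_nonneg)
  show ?thesis
  proof (cases "s = 0")
    case True
    then show ?thesis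
      using dual_bound_nonneg[OF assms(1)] nrm_nonneg[OF tpoly_in_X[OF assms(2), of a]] s_def by simp
  next
    case False
    then have s: "0 < s" using s0 by simp
    define t where "t = sqrt (real n) / s"
    have t: "0 < t" using s assms by (simp add: t_def)
    define b where "b i = of_real t * a i" for i
    have "(\<Sum>i\<in>A. cmod (a i)) \<le> sqrt (real (card A)) * s" unfolding s_def by (rule sum_cmod_le_l2)
    also have "\<dots> \<le> sqrt (real n) * s" using assms s by (intro mult_right_mono) auto
    finally have "t * (\<Sum>i\<in>A. cmod (a i)) \<le> t * (sqrt (real n) * s)" using t by (intro mult_left_mono) auto
    also have "\<dots> = real n" using s by (simp add: t_def)
    finally have 1: "(\<Sum>i\<in>A. cmod (b i)) \<le> real n"
      using t by (simp add: b_def norm_mult sum_distrib_left)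
    have 2: "(\<Sum>i\<in>A. (cmod (b i))^2) \<le> real n"
    proof -
      have "(\<Sum>i\<in>A. (cmod (b i))^2) = t^2 * s^2"
        using t unfolding s2 by (simp add: b_def norm_mult sum_distrib_left power_mult_distrib)
      also have "\<dots> = real n" using s by (simp add: t_def power_divide)
      finally show ?thesis by simp
    qed
    have "(\<Sum>i\<in>A. a i * cnj (b i)) = of_real (t * s^2)"
      unfolding s2 by (simp add: b_def sum_distrib_left complex_norm_square[symmetric] mult_ac)
    then have "\<bar>t * s^2\<bar> \<le> w * nrm (tpoly S a)"
      using tpoly_pairing_le[OF assms(1-3) 1 2, of a] by (simp only: norm_of_real)
    moreover have "t * s^2 = sqrt (real n) * s" using s by (simp add: t_def power2_eq_square)
    ultimately have "sqrt (real n) * s \<le> w * nrm (tpoly S a)" by linarith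
    then show ?thesis unfolding s_def[symmetric] using assms by (simp add: field_simps)
  qed
qed

text \<open>Where |h| is dominated by \<open>a * Phi |h|\<close>, the bound |D| \<le> n is used.
  Elsewhere |h| |D| is split into squares with the free parameter \<open>th\<close>, and the L2
  bound for D enters.\<close>

lemma dual_bound_split:
  assumes k: "0 \<le> a" "0 \<le> k" "0 < th" "1 \<le> n"
    and split: "\<And>s. 0 \<le> s \<Longrightarrow> s \<le> a * Phi s \<or> s^2 \<le> k * (1 + Phi s)"
  shows "dual_bound (8 * (real n * a + th * k + real n / th)) n"
  unfolding dual_bound_def
proof (intro allI impI)
  fix h D :: "real \<Rightarrow> complex"
  assume h: "h \<in> X" "nrm h \<le> 1" and D [measurable]: "D \<in> borel_measurable TM"
    and Dn: "\<forall>x\<in>torus. cmod (D x) \<le> real n" and D2: "(\<integral>x. (cmod (D x))^2 \<partial>TM) \<le> 2 * pi * real n"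
  note [measurable] = X_measurable[OF h(1)]
  let ?R = "\<lambda>x. real n * a * Phi (cmod (h x)) + (th * k / 2) * (1 + Phi (cmod (h x))) + (1 / (2 * th)) * (cmod (D x))^2"
  have pw: "cmod (h x) * cmod (D x) \<le> ?R x" if x: "x \<in> torus" for x
  proof -
    have pos: "0 \<le> real n * a * Phi (cmod (h x))" "0 \<le> (th * k / 2) * (1 + Phi (cmod (h x)))"
      "0 \<le> (1 / (2 * th)) * (cmod (D x))^2" using k by auto
    consider "cmod (h x) \<le> a * Phi (cmod (h x))" | "(cmod (h x))^2 \<le> k * (1 + Phi (cmod (h x)))"
      using split[of "cmod (h x)"] by auto
    then show ?thesis
    proof cases
      case 1
      have "cmod (h x) * cmod (D x) \<le> (a * Phi (cmod (h x))) * real n"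
        using 1 Dn x k by (intro mult_mono) auto
      then show ?thesis using pos by (simp add: mult_ac)
    next
      case 2
      have "0 \<le> (th * cmod (h x) - cmod (D x))^2" by simp
      then have "2 * th * (cmod (h x) * cmod (D x)) \<le> th^2 * (cmod (h x))^2 + (cmod (D x))^2"
        by (simp add: power2_eq_square algebra_simps)
      then have "cmod (h x) * cmod (D x) \<le> (th^2 * (cmod (h x))^2 + (cmod (D x))^2) / (2 * th)"
        using k by (simp add: pos_le_divide_eq mult_ac)
      also have "\<dots> = (th / 2) * (cmod (h x))^2 + (1 / (2 * th)) * (cmod (D x))^2"
        using k by (simp add: add_divide_distrib power2_eq_square)
      also have "\<dots> \<le> (th / 2) * (k * (1 + Phi (cmod (h x)))) + (1 / (2 * th)) * (cmod (D x))^2"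
        using 2 k by (intro add_right_mono mult_left_mono) auto
      finally show ?thesis using pos by (simp add: mult_ac)
    qed
  qed
  have int: "integrable TM (\<lambda>x. (cmod (D x))^2)"
    using Dn by (intro torus_integrable_bounded[of _ "(real n)^2"]) (auto intro!: power_mono)
  have intP: "integrable TM (\<lambda>x. Phi (cmod (h x)))" by (rule X_integrable1[OF h(1)])
  have intR: "integrable TM ?R"
    using int intP by (intro Bochner_Integration.integrable_add integrable_mult_right) auto
  have "(\<integral>x. cmod (h x) * cmod (D x) \<partial>TM) \<le> (\<integral>x. ?R x \<partial>TM)"
  proof (rule integral_mono[OF _ intR])
    show "integrable TM (\<lambda>x. cmod (h x) * cmod (D x))"
    proof (rule Bochner_Integration.integrable_bound[OF intR])
      show "AE x in TM. norm (cmod (h x) * cmod (D x)) \<le> norm (?R x)"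
        using pw by (intro AE_I2) (auto intro: order.trans[OF _ abs_ge_self])
    qed measurable
  qed (use pw in auto)
  also have "\<dots> = real n * a * modular (\<lambda>x. cmod (h x)) + (th * k / 2) * (2 * pi + modular (\<lambda>x. cmod (h x)))
      + (1 / (2 * th)) * (\<integral>x. (cmod (D x))^2 \<partial>TM)"
    using int intP by (simp add: modular_def measure_torus)
  also have "\<dots> \<le> real n * a * 1 + (th * k / 2) * (2 * pi + 1) + (1 / (2 * th)) * (2 * pi * real n)"
    using k D2 modular_unit_ball[OF h] by (intro add_mono mult_left_mono) auto
  \<comment> \<open>The constants 2 pi + 1 and 2 pi are both rounded up to 16, which gives a common
    factor 8.\<close>
  also have "\<dots> \<le> real n * a * 8 + (th * k / 2) * 16 + (1 / (2 * th)) * (16 * real n)"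
    using k pi_less_4 by (intro add_mono mult_left_mono mult_right_mono) auto
  also have "\<dots> = 8 * (real n * a + th * k + real n / th)" by (simp add: field_simps)
  finally show "(\<integral>x. cmod (h x) * cmod (D x) \<partial>TM) \<le> \<dots>" .
qed

end

section \<open>The greedy iteration\<close>

lemma tpoly_subset:
  assumes "finite S" "A \<subseteq> S"
  shows "tpoly A a = tpoly S (\<lambda>i. if i \<in> A then a i else 0)"
proof
  fix x
  have "(\<Sum>n\<in>S. (if n \<in> A then a n else 0) * trig n x) = (\<Sum>n\<in>S. if n \<in> A then a n * trig n x else 0)"
    by (intro sum.cong) auto
  also have "\<dots> = (\<Sum>n\<in>S \<inter> A. a n * trig n x)" using assms by (simp add: sum.inter_restrict)
  also have "S \<inter> A = A" using assms by auto
  finally show "tpoly A a x = tpoly S (\<lambda>i. if i \<in> A then a i else 0) x" by (simp add: tpoly_def)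
qed

lemma tpoly_cong: "(\<And>i. i \<in> A \<Longrightarrow> a i = b i) \<Longrightarrow> tpoly A a = tpoly A b"
  by (simp add: tpoly_def fun_eq_iff)

lemma tpoly_empty [simp]: "tpoly {} a = (\<lambda>_. 0)"
  by (simp add: tpoly_def fun_eq_iff)

lemma tpoly_add: "tpoly A a x + tpoly A b x = tpoly A (\<lambda>i. a i + b i) x"
  by (simp add: tpoly_def sum.distrib distrib_right)

lemma tpoly_diff: "tpoly A a x - tpoly A b x = tpoly A (\<lambda>i. a i - b i) x"
  by (simp add: tpoly_def sum_subtractf left_diff_distrib)

lemma tpoly_Un: "finite A \<Longrightarrow> finite B \<Longrightarrow> A \<inter> B = {} \<Longrightarrow> tpoly (A \<union> B) a x = tpoly A a x + tpoly B a x"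
  by (simp add: tpoly_def sum.union_disjoint)

text \<open>Passing from positions to sets of frequencies removes the ambiguity caused by repeated
  selections.\<close>

lemma chosen_span_eq: "chosen_span idx n = range (tpoly (idx ` {1..n}))"
proof (intro set_eqI iffI)
  fix h assume "h \<in> chosen_span idx n"
  then obtain a where h: "h = (\<lambda>x. \<Sum>k\<in>{1..n}. a k * trig (idx k) x)" by (auto simp: chosen_span_def)
  have "h = tpoly (idx ` {1..n}) (\<lambda>i. \<Sum>k\<in>{k \<in> {1..n}. idx k = i}. a k)"
  proof
    fix x
    have "h x = (\<Sum>i\<in>idx ` {1..n}. \<Sum>k\<in>{k \<in> {1..n}. idx k = i}. a k * trig (idx k) x)"
      unfolding h by (rule sum.image_gen) simp
    also have "\<dots> = (\<Sum>i\<in>idx ` {1..n}. (\<Sum>k\<in>{k \<in> {1..n}. idx k = i}. a k) * trig i x)"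
      by (intro sum.cong refl) (simp add: sum_distrib_right)
    finally show "h x = tpoly (idx ` {1..n}) (\<lambda>i. \<Sum>k\<in>{k \<in> {1..n}. idx k = i}. a k) x"
      by (simp add: tpoly_def)
  qed
  then show "h \<in> range (tpoly (idx ` {1..n}))" by blast
next
  fix h assume "h \<in> range (tpoly (idx ` {1..n}))"
  then obtain a where h: "h = tpoly (idx ` {1..n}) a" by blast
  \<comment> \<open>A frequency may be selected several times, so its coefficient is shared out evenly.\<close>
  define m where "m i = card {k \<in> {1..n}. idx k = i}" for i
  have "h = (\<lambda>x. \<Sum>k\<in>{1..n}. (a (idx k) / of_nat (m (idx k))) * trig (idx k) x)"
  proof
    fix x
    have "(\<Sum>k\<in>{1..n}. (a (idx k) / of_nat (m (idx k))) * trig (idx k) x)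
        = (\<Sum>i\<in>idx ` {1..n}. \<Sum>k\<in>{k \<in> {1..n}. idx k = i}. (a (idx k) / of_nat (m (idx k))) * trig (idx k) x)"
      by (rule sum.image_gen) simp
    also have "\<dots> = (\<Sum>i\<in>idx ` {1..n}. a i * trig i x)"
    proof (intro sum.cong refl)
      fix i assume "i \<in> idx ` {1..n}"
      then have "m i \<noteq> 0" by (auto simp: m_def)
      have "(\<Sum>k\<in>{k \<in> {1..n}. idx k = i}. (a (idx k) / of_nat (m (idx k))) * trig (idx k) x)
          = (\<Sum>k\<in>{k \<in> {1..n}. idx k = i}. (a i / of_nat (m i)) * trig i x)" by (intro sum.cong) auto
      also have "\<dots> = a i * trig i x"
        unfolding sum_constant m_def[symmetric] using \<open>m i \<noteq> 0\<close> by simp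
      finally show "(\<Sum>k\<in>{k \<in> {1..n}. idx k = i}. (a (idx k) / of_nat (m (idx k))) * trig (idx k) x) = a i * trig i x" .
    qed
    finally show "h x = (\<Sum>k\<in>{1..n}. (a (idx k) / of_nat (m (idx k))) * trig (idx k) x)"
      unfolding h by (simp add: tpoly_def)
  qed
  then show "h \<in> chosen_span idx n" unfolding chosen_span_def by (auto intro!: exI[of _ "\<lambda>k. a (idx k) / of_nat (m (idx k))"])
qed

context llogl
begin

text \<open>All exponentials have the same norm, but not norm 1; dividing by this constant brings
  them into the unit ball.\<close>

definition trig_bound :: real where
  "trig_bound = max 1 (nrm (trig 0))"

lemma norming_tpoly:
  assumes "norming Phi F u" "finite A"
  shows "F (tpoly A a) = (\<Sum>i\<in>A. a i * F (trig i))"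
  unfolding tpoly_def[abs_def] using norming_sum[OF assms, of trig a] by simp

end

section \<open>Elementary properties of a greedy run\<close>

locale greedy_run = llogl +
  fixes \<tau> :: real and f :: "real \<Rightarrow> complex" and idx :: "nat \<Rightarrow> int"
    and F :: "nat \<Rightarrow> (real \<Rightarrow> complex) \<Rightarrow> complex" and G :: "nat \<Rightarrow> real \<Rightarrow> complex"
  assumes tau: "0 < \<tau>" "\<tau> \<le> 1" and f: "f \<in> X" and run: "wcga Phi \<tau> f idx F G"
begin

definition res :: "nat \<Rightarrow> real" where "res m = nrm (\<lambda>x. f x - G m x)"

definition chosen :: "nat \<Rightarrow> int set" where "chosen m = idx ` {1..m}"

lemma finite_chosen [simp]: "finite (chosen m)"
  by (simp add: chosen_def)

lemma chosen_mono: "m \<le> n \<Longrightarrow> chosen m \<subseteq> chosen n"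
  by (auto simp: chosen_def)

lemma G0: "G 0 = (\<lambda>x. 0)"
  and G_stop: "res m = 0 \<Longrightarrow> G (Suc m) = f"
  and norming_F: "res m \<noteq> 0 \<Longrightarrow> norming Phi (F m) (\<lambda>x. f x - G m x)"
  and weak_greedy: "res m \<noteq> 0 \<Longrightarrow> \<tau> * (SUP i. cmod (F m (trig i))) \<le> cmod (F m (trig (idx (Suc m))))"
  and best: "res m \<noteq> 0 \<Longrightarrow> best_approx Phi f (chosen_span idx (Suc m)) (G (Suc m))"
  using run by (auto simp: wcga_def res_def)

lemma res_stop: "res m = 0 \<Longrightarrow> res (Suc m) = 0"
  using G_stop[of m] by (simp add: res_def)

text \<open>Restricted to nonzero residuals because after termination \<open>G m\<close> is
  \<open>f\<close> itself as a function and need not be a finite sum of exponentials.\<close>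

lemma G_tpoly:
  assumes "res m \<noteq> 0"
  shows "\<exists>c. G m = tpoly (chosen m) c"
proof (cases m)
  case 0
  then show ?thesis using G0 by (simp add: chosen_def)
next
  case (Suc k)
  then have "res k \<noteq> 0" using res_stop assms by metis
  from best[OF this] show ?thesis
    unfolding best_approx_def chosen_span_eq Suc chosen_def by blast
qed

lemma G_in_X: "G m \<in> X"
proof (cases "res m = 0")
  case False
  then show ?thesis using G_tpoly by force
next
  case True
  then show ?thesis
  proof (induction m)
    case (Suc m)
    show ?case
    proof (cases "res m = 0")
      case True
      then show ?thesis using G_stop f by simp
    next
      case False
      from best[OF this] show ?thesis
        unfolding best_approx_def chosen_span_eq by auto
    qed
  qed (simp add: G0)
qed

lemma f_minus_in_X [simp]: "(\<lambda>x. f x - G m x) \<in> X"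
  using f G_in_X by simp

lemma res_nonneg: "0 \<le> res m"
  unfolding res_def by (rule nrm_nonneg) simp

text \<open>Holds at every step: before termination it is the best approximation property,
  afterwards the residual is 0 whatever the indices are.\<close>

lemma res_minimal: "res m \<le> nrm (\<lambda>x. f x - tpoly (chosen m) d x)"
proof (cases m)
  case 0
  then show ?thesis using G0 by (simp add: chosen_def res_def)
next
  case (Suc k)
  show ?thesis
  proof (cases "res k = 0")
    case True
    then have "res m = 0" using res_stop Suc by simp
    then show ?thesis using f by (simp add: nrm_nonneg)
  next
    case False
    from best[OF this] show ?thesis
      unfolding best_approx_def chosen_span_eq Suc chosen_def res_def by blast
  qed
qed

lemma res_Suc_le: "res (Suc m) \<le> res m"
proof (cases "res m = 0")
  case True
  then show ?thesis by (simp add: res_stop)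
next
  case False
  then obtain c where c: "G m = tpoly (chosen m) c" using G_tpoly by blast
  have "chosen m \<subseteq> chosen (Suc m)" by (rule chosen_mono) simp
  then show ?thesis
    using res_minimal[of "Suc m"] unfolding res_def[of m] c
    by (subst tpoly_subset[of "chosen (Suc m)" "chosen m"]) auto
qed

lemma res_mono: "m \<le> n \<Longrightarrow> res n \<le> res m"
  by (rule lift_Suc_antimono_le[of res]) (rule res_Suc_le)

text \<open>The competitor is \<open>G m + t e_i\<close>. With a new frequency it yields the
  decrease of the error, with an old one the minimality that makes the norming functional vanish
  there.\<close>

lemma res_step_le:
  assumes "res m \<noteq> 0"
  shows "res (Suc m) \<le> nrm (\<lambda>x. (f x - G m x) - t * trig (idx (Suc m)) x)"
    and "i \<in> chosen m \<Longrightarrow> res m \<le> nrm (\<lambda>x. (f x - G m x) - t * trig i x)"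
proof -
  obtain c where c: "G m = tpoly (chosen m) c" using G_tpoly[OF assms] by blast
  have *: "\<exists>d. \<forall>x. G m x + t * trig i x = tpoly (chosen n) d x"
    if i: "i \<in> chosen n" and n: "m \<le> n" for i n
  proof -
    have "t * trig i x = tpoly (chosen n) (\<lambda>j. if j = i then t else 0) x" for x
    proof -
      have "tpoly (chosen n) (\<lambda>j. if j = i then t else 0) x = (\<Sum>j\<in>chosen n. if j = i then t * trig j x else 0)"
        unfolding tpoly_def by (intro sum.cong) auto
      then show ?thesis using i by (simp add: sum.delta)
    qed
    moreover have "G m x = tpoly (chosen n) (\<lambda>j. if j \<in> chosen m then c j else 0) x" for x
      by (rule fun_cong[OF trans[OF c tpoly_subset[OF finite_chosen chosen_mono[OF n]]]])
    ultimately have "G m x + t * trig i x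
        = tpoly (chosen n) (\<lambda>j. (if j \<in> chosen m then c j else 0) + (if j = i then t else 0)) x" for x
      by (simp only: tpoly_add)
    then show ?thesis by blast
  qed
  have **: "res n \<le> nrm (\<lambda>x. (f x - G m x) - t * trig i x)" if i: "i \<in> chosen n" "m \<le> n" for i n
  proof -
    obtain d where d: "\<And>x. G m x + t * trig i x = tpoly (chosen n) d x" using *[OF i] by blast
    have "(\<lambda>x. (f x - G m x) - t * trig i x) = (\<lambda>x. f x - tpoly (chosen n) d x)"
      by (simp add: d[symmetric] diff_diff_eq)
    then show ?thesis using res_minimal[of n d] by simp
  qed
  show "res (Suc m) \<le> nrm (\<lambda>x. (f x - G m x) - t * trig (idx (Suc m)) x)"
    by (rule **) (auto simp: chosen_def)
  show "res m \<le> nrm (\<lambda>x. (f x - G m x) - t * trig i x)" if "i \<in> chosen m"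
    by (rule **) (use that in auto)
qed

lemma F_chosen:
  assumes "res m \<noteq> 0" "i \<in> chosen m"
  shows "F m (trig i) = 0"
proof (rule norming_annihilates[OF norming_F[OF assms(1)]])
  show "0 < nrm (\<lambda>x. f x - G m x)" using assms res_nonneg[of m] by (simp add: res_def)
  show "nrm (\<lambda>x. f x - G m x) \<le> nrm (\<lambda>x. (f x - G m x) - t * trig i x)" for t
    using res_step_le(2)[OF assms] by (simp add: res_def)
qed simp_all

definition peak :: "nat \<Rightarrow> real" where "peak m = (SUP i. cmod (F m (trig i)))"

text \<open>Norming functionals are contractions and all exponentials have the same norm, so the
  supremum is taken over a bounded set and is a true upper bound.\<close>

lemma F_le_peak:
  assumes "res m \<noteq> 0"
  shows "cmod (F m (trig i)) \<le> peak m"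
  unfolding peak_def
proof (rule cSUP_upper)
  show "bdd_above (range (\<lambda>i. cmod (F m (trig i))))"
  proof (rule bdd_aboveI[of _ "nrm (trig 0)"])
    fix y assume "y \<in> range (\<lambda>i. cmod (F m (trig i)))"
    then obtain i where "y = cmod (F m (trig i))" by blast
    then show "y \<le> nrm (trig 0)"
      using norming_le[OF norming_F[OF assms] trig_in_X[of i]] nrm_trig[of i] by simp
  qed
qed simp

lemma res_decrement:
  assumes K: "smoothness_const K" and m: "res m \<noteq> 0" and l: "0 < l" "l \<le> 1/4"
    and v: "0 < v" "v \<le> peak m"
  shows "res (Suc m) \<le> res m * (1 - (l * (\<tau> * v / trig_bound) - K * omega l))"
proof -
  let ?B = "trig_bound" and ?i = "idx (Suc m)"
  have B: "1 \<le> ?B" "nrm (trig ?i) \<le> ?B" using nrm_trig[of ?i] by (auto simp: trig_bound_def)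
  define h where "h x = of_real (1 / ?B) * trig ?i x" for x
  have h: "h \<in> X" unfolding h_def[abs_def] by (rule X_cmult[OF trig_in_X])
  have h1: "nrm h \<le> 1"
    unfolding h_def[abs_def] nrm_cmult[OF trig_in_X] norm_of_real using B by simp
  have Fh: "F m h = of_real (1 / ?B) * F m (trig ?i)"
    unfolding h_def[abs_def] by (rule norming_cmult[OF norming_F[OF m] trig_in_X])
  have "\<tau> * v \<le> \<tau> * peak m" using tau v by simp
  also have "\<dots> \<le> cmod (F m (trig ?i))" using weak_greedy[OF m] by (simp add: peak_def)
  finally have "\<tau> * v / ?B \<le> cmod (F m h)"
    unfolding Fh norm_mult norm_of_real using B by (simp add: divide_right_mono)
  then have low: "l * (\<tau> * v / ?B) \<le> l * cmod (F m h)" using l by (intro mult_left_mono) auto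
  obtain t where t: "nrm (\<lambda>x. (f x - G m x) - t * h x) \<le> res m * (1 - l * cmod (F m h) + K * omega l)"
  proof -
    have "0 < nrm (\<lambda>x. f x - G m x)" using m res_nonneg[of m] by (simp add: res_def)
    from K[unfolded smoothness_const_def, rule_format, OF norming_F[OF m] f_minus_in_X this h h1 l]
    show ?thesis using that unfolding res_def by blast
  qed
  have "res (Suc m) \<le> nrm (\<lambda>x. (f x - G m x) - t * h x)"
    using res_step_le(1)[OF m, of "t * of_real (1 / ?B)"] by (simp add: h_def)
  also have "\<dots> \<le> res m * (1 - l * cmod (F m h) + K * omega l)" by (rule t)
  also have "\<dots> \<le> res m * (1 - (l * (\<tau> * v / ?B) - K * omega l))"
    using low res_nonneg[of m] by (intro mult_left_mono) auto
  finally show ?thesis .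
qed

end

text \<open>A fixed competitor \<open>tpoly T a\<close> with at most \<open>N\<close> terms.
  \<open>M\<close> is the unit of time: while \<open>n\<close> frequencies matter, a step contracts
  the error by \<open>1 - 1 / (n * M)\<close>, so \<open>n * Q\<close> steps contract it by
  \<open>7 * U\<close>. The 6 in \<open>gain\<close> is the constant that the lower bound for the
  peak in \<open>phase_step\<close> produces.\<close>

locale greedy_target = greedy_run +
  fixes K :: real and N :: nat and w :: "nat \<Rightarrow> real" and U M :: real and Q :: nat
    and T :: "int set" and a :: "int \<Rightarrow> complex"
  assumes K: "smoothness_const K" and N: "1 \<le> N"
    and w: "\<And>n. 1 \<le> n \<Longrightarrow> n \<le> N \<Longrightarrow> 0 < w n" "\<And>n. 1 \<le> n \<Longrightarrow> n \<le> N \<Longrightarrow> dual_bound (w n) n"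
    and gain: "\<And>n. 1 \<le> n \<Longrightarrow> n \<le> N \<Longrightarrow> \<exists>l. 0 < l \<and> l \<le> 1/4 \<and>
        1 / (real n * M) \<le> l * (\<tau> / (6 * w n * trig_bound)) - K * omega l"
    and U: "1 \<le> U" "\<And>S A b. finite S \<Longrightarrow> A \<subseteq> S \<Longrightarrow> card A \<le> N \<Longrightarrow> nrm (tpoly A b) \<le> U * nrm (tpoly S b)"
    and M: "0 < M" and Q: "M * ln (7 * U) \<le> real Q"
    and T: "finite T" "card T \<le> N"
begin

definition eps :: real where "eps = nrm (\<lambda>x. f x - tpoly T a x)"

definition rest :: "nat \<Rightarrow> int set" where "rest m = T - chosen m"

lemma eps_nonneg: "0 \<le> eps"
  unfolding eps_def using f T by (intro nrm_nonneg) simp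

lemma finite_Gam [simp]: "finite (rest m)"
  using T by (simp add: rest_def)

lemma card_Gam: "card (rest m) \<le> N"
  using T card_mono[of T "rest m"] by (simp add: rest_def)

lemma rest_mono: "m \<le> n \<Longrightarrow> rest n \<subseteq> rest m"
  using chosen_mono by (auto simp: rest_def)

text \<open>The polynomial is the competitor minus \<open>G m\<close>, estimated by passing through
  \<open>f\<close>. Subtracting \<open>G m\<close> changes no coefficient at a frequency still
  missing.\<close>

lemma target_minus_G:
  assumes "res m \<noteq> 0"
  obtains e where "nrm (tpoly (T \<union> chosen m) e) \<le> eps + res m" "\<And>i. i \<in> rest m \<Longrightarrow> e i = a i"
proof -
  obtain c where c: "G m = tpoly (chosen m) c" using G_tpoly[OF assms] by blast
  define e where "e i = (if i \<in> T then a i else 0) - (if i \<in> chosen m then c i else 0)" for i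
  have fin: "finite (T \<union> chosen m)" using T by simp
  have "tpoly (T \<union> chosen m) e x = (f x - G m x) - (f x - tpoly T a x)" for x
    unfolding c e_def[abs_def] tpoly_diff[symmetric]
    using tpoly_subset[OF fin, of T a] tpoly_subset[OF fin, of "chosen m" c] by simp
  then have "nrm (tpoly (T \<union> chosen m) e) = nrm (\<lambda>x. (f x - G m x) - (f x - tpoly T a x))" by presburger
  also have "\<dots> \<le> res m + eps"
    unfolding res_def eps_def using f T by (intro nrm_triangle_diff) auto
  finally show ?thesis using that[of e] by (simp add: e_def rest_def add.commute)
qed

lemma remaining_coefficients_le:
  assumes m: "res m \<noteq> 0" and A: "A \<subseteq> rest m" "card A \<le> n" and n: "1 \<le> n" "n \<le> N"
  shows "(\<Sum>i\<in>A. cmod (a i)) \<le> w n * (eps + res m)"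
proof -
  obtain e where e: "nrm (tpoly (T \<union> chosen m) e) \<le> eps + res m" "\<And>i. i \<in> rest m \<Longrightarrow> e i = a i"
    using target_minus_G[OF m] by blast
  have "(\<Sum>i\<in>A. cmod (a i)) = (\<Sum>i\<in>A. cmod (e i))"
    using A e(2) by (intro sum.cong) auto
  also have "\<dots> \<le> w n * nrm (tpoly (T \<union> chosen m) e)"
    using A T n by (intro coefficient_sum_le[OF w(2)]) (auto simp: rest_def)
  also have "\<dots> \<le> w n * (eps + res m)"
    using e(1) w(1)[OF n] by (intro mult_left_mono) auto
  finally show ?thesis .
qed

lemma nrm_remaining_le:
  assumes m: "res m \<noteq> 0"
  shows "nrm (tpoly (rest m) a) \<le> U * (eps + res m)"
proof -
  obtain e where e: "nrm (tpoly (T \<union> chosen m) e) \<le> eps + res m" "\<And>i. i \<in> rest m \<Longrightarrow> e i = a i"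
    using target_minus_G[OF m] by blast
  have "nrm (tpoly (rest m) a) = nrm (tpoly (rest m) e)"
    using e(2) by (metis tpoly_cong)
  also have "\<dots> \<le> U * nrm (tpoly (T \<union> chosen m) e)"
    using T card_Gam by (intro U) (auto simp: rest_def)
  also have "\<dots> \<le> U * (eps + res m)" using e(1) U(1) by (intro mult_left_mono) auto
  finally show ?thesis .
qed

text \<open>The part of the competitor on frequencies already chosen is an admissible
  approximant.\<close>

lemma res_le_remaining: "res m \<le> eps + nrm (tpoly (rest m) a)"
proof -
  have TT: "T = (T \<inter> chosen m) \<union> rest m" "(T \<inter> chosen m) \<inter> rest m = {}" by (auto simp: rest_def)
  have split: "tpoly T a x = tpoly (T \<inter> chosen m) a x + tpoly (rest m) a x" for x
    using T TT tpoly_Un[of "T \<inter> chosen m" "rest m" a x] by simp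
  have "res m \<le> nrm (\<lambda>x. f x - tpoly (T \<inter> chosen m) a x)"
    using res_minimal[of m] by (subst tpoly_subset[of "chosen m"]) auto
  also have "(\<lambda>x. f x - tpoly (T \<inter> chosen m) a x) = (\<lambda>x. (f x - tpoly T a x) + tpoly (rest m) a x)"
    by (simp add: split)
  also have "nrm (\<lambda>x. (f x - tpoly T a x) + tpoly (rest m) a x) \<le> eps + nrm (tpoly (rest m) a)"
    unfolding eps_def using f T by (intro nrm_triangle) auto
  finally show ?thesis .
qed

text \<open>
  \<open>F m\<close> kills every frequency chosen up to step \<open>m\<close>, so \<open>A\<close> may be fixed at an earlier step \<open>m0\<close>
  while its remaining part alone has to be estimated by coefficients.
\<close>

lemma res_le_peak:
  assumes m: "res m \<noteq> 0" "m0 \<le> m" and A: "A \<subseteq> rest m0" "card A \<le> n" and n: "1 \<le> n" "n \<le> N"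
  shows "res m \<le> eps + peak m * (w n * (eps + res m)) + nrm (tpoly (rest m0 - A) a)"
proof -
  note F = norming_F[OF m(1)]
  obtain c where c: "G m = tpoly (chosen m) c" using G_tpoly[OF m(1)] by blast
  have finA: "finite A" by (rule finite_subset[OF A(1) finite_Gam])
  have FG: "F m (G m) = 0"
    unfolding c norming_tpoly[OF F finite_chosen] by (simp add: F_chosen[OF m(1)])
  have "F m (\<lambda>x. (f x - G m x) + G m x) = of_real (res m) + F m (G m)"
    unfolding norming_add[OF F f_minus_in_X[of m] G_in_X[of m]] norming_self[OF F] res_def ..
  \<comment> \<open>Since \<open>F m\<close> kills \<open>G m\<close>, the residual can be read off
    from \<open>f\<close>, and then from the competitor up to an error \<open>eps\<close>.\<close>
  then have Ff: "F m f = of_real (res m)" using FG by simp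
  have "F m (\<lambda>x. (f x - tpoly T a x) + tpoly T a x) = F m (\<lambda>x. f x - tpoly T a x) + F m (tpoly T a)"
    using f T by (intro norming_add[OF F]) auto
  then have 1: "of_real (res m) = F m (\<lambda>x. f x - tpoly T a x) + F m (tpoly T a)" using Ff by simp
  have TT: "T = (T \<inter> chosen m0) \<union> (A \<union> (rest m0 - A))" using A by (auto simp: rest_def)
  have "F m (tpoly T a) = (\<Sum>i\<in>T. a i * F m (trig i))" using norming_tpoly[OF F T(1)] by simp
  also have "\<dots> = (\<Sum>i\<in>T \<inter> chosen m0. a i * F m (trig i)) + (\<Sum>i\<in>A \<union> (rest m0 - A). a i * F m (trig i))"
    by (subst TT, rule sum.union_disjoint) (use T finA A in \<open>auto simp: rest_def\<close>)
  also have "(\<Sum>i\<in>T \<inter> chosen m0. a i * F m (trig i)) = 0"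
    using F_chosen[OF m(1)] chosen_mono[OF m(2)] by (intro sum.neutral) auto
  also have "(\<Sum>i\<in>A \<union> (rest m0 - A). a i * F m (trig i)) = (\<Sum>i\<in>A. a i * F m (trig i)) + (\<Sum>i\<in>rest m0 - A. a i * F m (trig i))"
    using finA by (intro sum.union_disjoint) auto
  also have "(\<Sum>i\<in>rest m0 - A. a i * F m (trig i)) = F m (tpoly (rest m0 - A) a)"
    using norming_tpoly[OF F] by simp
  also have "(\<Sum>i\<in>A. a i * F m (trig i)) = (\<Sum>i\<in>A \<inter> rest m. a i * F m (trig i))"
    using finA F_chosen[OF m(1)] A by (intro sum.mono_neutral_right) (auto simp: rest_def)
  finally have 2: "F m (tpoly T a) = (\<Sum>i\<in>A \<inter> rest m. a i * F m (trig i)) + F m (tpoly (rest m0 - A) a)"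
    by simp
  have "cmod (\<Sum>i\<in>A \<inter> rest m. a i * F m (trig i)) \<le> (\<Sum>i\<in>A \<inter> rest m. cmod (a i) * peak m)"
    using F_le_peak[OF m(1)] by (intro sum_norm_le) (simp add: norm_mult mult_left_mono)
  also have "\<dots> = peak m * (\<Sum>i\<in>A \<inter> rest m. cmod (a i))" by (simp add: sum_distrib_left mult.commute)
  also have "\<dots> \<le> peak m * (w n * (eps + res m))"
  proof (rule mult_left_mono)
    have "card (A \<inter> rest m) \<le> n" using A finA card_mono[of A "A \<inter> rest m"] by auto
    then show "(\<Sum>i\<in>A \<inter> rest m. cmod (a i)) \<le> w n * (eps + res m)"
      using m n by (intro remaining_coefficients_le) auto
    show "0 \<le> peak m" using F_le_peak[OF m(1), of 0] norm_ge_zero order.trans by blast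
  qed
  finally have 3: "cmod (\<Sum>i\<in>A \<inter> rest m. a i * F m (trig i)) \<le> peak m * (w n * (eps + res m))" .
  have 4: "cmod (F m (\<lambda>x. f x - tpoly T a x)) \<le> eps"
    unfolding eps_def using f T by (intro norming_le[OF F]) auto
  have 5: "cmod (F m (tpoly (rest m0 - A) a)) \<le> nrm (tpoly (rest m0 - A) a)"
    by (intro norming_le[OF F]) auto
  have "res m = cmod (of_real (res m))" using res_nonneg[of m] by simp
  also have "\<dots> \<le> cmod (F m (\<lambda>x. f x - tpoly T a x)) + (cmod (\<Sum>i\<in>A \<inter> rest m. a i * F m (trig i))
      + cmod (F m (tpoly (rest m0 - A) a)))"
    unfolding 1 2 by (intro order.trans[OF norm_triangle_ineq] add_left_mono norm_triangle_ineq)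
  also have "\<dots> \<le> eps + peak m * (w n * (eps + res m)) + nrm (tpoly (rest m0 - A) a)"
    using 3 4 5 by linarith
  finally show ?thesis .
qed

text \<open>Of the residual, \<open>eps\<close> accounts for less than a half and the deleted tail
  for at most a quarter. The last quarter must come from the coefficients on \<open>A\<close>,
  bounded by \<open>peak m * w n * (3/2) * res m\<close>, so the peak is at least 1 / (6
  w(n)).\<close>

lemma phase_step:
  assumes m: "2 * eps < res m" "m0 \<le> m" "4 * nrm (tpoly (rest m0 - A) a) \<le> res m"
    and A: "A \<subseteq> rest m0" "card A \<le> n" and n: "1 \<le> n" "n \<le> N"
  shows "res (Suc m) \<le> res m * (1 - 1 / (real n * M))"
proof -
  have pos: "0 < res m" using m eps_nonneg by linarith
  then have ne: "res m \<noteq> 0" by simp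
  have wn: "0 < w n" using w n by blast
  have top0: "0 \<le> peak m" using F_le_peak[OF ne, of 0] norm_ge_zero order.trans by blast
  have "peak m * (w n * (eps + res m)) \<le> peak m * (w n * (3/2 * res m))"
    using m wn top0 by (intro mult_left_mono) auto
  then have "res m \<le> res m / 2 + peak m * (w n * (3/2 * res m)) + res m / 4"
    using res_le_peak[OF ne m(2) A n] m by linarith
  then have "res m * (1/4) \<le> res m * (peak m * w n * (3/2))" by (simp add: algebra_simps)
  then have "1/4 \<le> peak m * w n * (3/2)" using pos by simp
  then have v: "1 / (6 * w n) \<le> peak m" using wn by (simp add: field_simps)
  obtain l where l: "0 < l" "l \<le> 1/4" "1 / (real n * M) \<le> l * (\<tau> / (6 * w n * trig_bound)) - K * omega l"
    using gain[OF n] by blast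
  have "res (Suc m) \<le> res m * (1 - (l * (\<tau> * (1 / (6 * w n)) / trig_bound) - K * omega l))"
    using wn by (intro res_decrement K ne l v) auto
  also have "\<dots> \<le> res m * (1 - 1 / (real n * M))"
    using l(3) pos by (intro mult_left_mono) auto
  finally show ?thesis .
qed

text \<open>As long as the residual exceeds both thresholds, each step contracts it;
  \<open>n * Q\<close> contractions would multiply it by at most 1 / (7 U), below the second
  threshold.\<close>

lemma phase:
  assumes m: "m0 \<le> m" and A: "A \<subseteq> rest m0" "card A \<le> n" "1 \<le> n"
    and th: "nrm (tpoly (rest m0 - A) a) \<le> th" "res m \<le> 4 * (7 * U) * th"
  shows "res (m + n * Q) \<le> 2 * eps \<or> res (m + n * Q) \<le> 4 * th"
proof (rule ccontr)
  assume "\<not> ?thesis"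
  then have big: "2 * eps < res (m + n * Q)" "4 * th < res (m + n * Q)" by auto
  \<comment> \<open>Dual bounds are available only up to \<open>N\<close>, whereas \<open>n\<close>
    will be a power of 2 that may exceed it.\<close>
  define n1 where "n1 = max 1 (card A)"
  have cA: "card A \<le> N" using card_mono[OF finite_Gam A(1)] card_Gam[of m0] by simp
  have n1: "1 \<le> n1" "n1 \<le> N" "card A \<le> n1" "n1 \<le> n" using A N cA by (auto simp: n1_def)
  have "res (m + k) \<le> exp (- (real k / (real n1 * M))) * res m" if "k \<le> n * Q" for k
    using that
  proof (induction k)
    case (Suc k)
    have le: "res (m + n * Q) \<le> res (m + k)" using Suc.prems by (intro res_mono) auto
    have "4 * nrm (tpoly (rest m0 - A) a) \<le> res (m + k)" using big le th by linarith
    then have "res (Suc (m + k)) \<le> res (m + k) * (1 - 1 / (real n1 * M))"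
      using big le n1 A by (intro phase_step[where A = A and ?m0.0 = m0]) (auto intro: le_trans[OF m])
    also have "\<dots> \<le> res (m + k) * exp (- (1 / (real n1 * M)))"
      using exp_ge_add_one_self[of "- (1 / (real n1 * M))"] by (intro mult_left_mono res_nonneg) simp
    also have "\<dots> \<le> (exp (- (real k / (real n1 * M))) * res m) * exp (- (1 / (real n1 * M)))"
      using Suc by (intro mult_right_mono) auto
    also have "\<dots> = exp (- (real (Suc k) / (real n1 * M))) * res m"
      by (simp add: exp_add[symmetric] add_divide_distrib mult.assoc[symmetric] mult.commute[of _ "res m"])
    finally show ?case by simp
  qed simp
  then have "res (m + n * Q) \<le> exp (- (real (n * Q) / (real n1 * M))) * res m" by blast
  also have "\<dots> \<le> exp (- ln (7 * U)) * res m"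
  proof (intro mult_right_mono res_nonneg)
    have "ln (7 * U) * (real n1 * M) \<le> real Q * real n"
    proof -
      have "ln (7 * U) * (real n1 * M) = (M * ln (7 * U)) * real n1" by simp
      also have "\<dots> \<le> real Q * real n" using Q n1 U M by (intro mult_mono) auto
      finally show ?thesis .
    qed
    then show "exp (- (real (n * Q) / (real n1 * M))) \<le> exp (- ln (7 * U))"
      using n1 M by (simp add: field_simps)
  qed
  also have "\<dots> = res m / (7 * U)" using U by (simp add: exp_minus field_simps)
  also have "\<dots> \<le> 4 * th" using th(2) U by (simp add: field_simps)
  finally show False using big by simp
qed

section \<open>Best deletions and induction on the number of missing frequencies\<close>

definition best_rest :: "int set \<Rightarrow> nat \<Rightarrow> real" where
  "best_rest S k = Min ((\<lambda>A. nrm (tpoly (S - A) a)) ` {A. A \<subseteq> S \<and> card A \<le> k})"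

lemma best_rest:
  assumes "finite S"
  shows "\<exists>A. A \<subseteq> S \<and> card A \<le> k \<and> nrm (tpoly (S - A) a) = best_rest S k"
    and "A \<subseteq> S \<Longrightarrow> card A \<le> k \<Longrightarrow> best_rest S k \<le> nrm (tpoly (S - A) a)"
proof -
  let ?I = "(\<lambda>A. nrm (tpoly (S - A) a)) ` {A. A \<subseteq> S \<and> card A \<le> k}"
  have fin: "finite ?I" using finite_subset[of "{A. A \<subseteq> S \<and> card A \<le> k}" "Pow S"] assms by auto
  have "{} \<in> {A. A \<subseteq> S \<and> card A \<le> k}" by simp
  then have "best_rest S k \<in> ?I" unfolding best_rest_def using fin by (intro Min_in) auto
  then show "\<exists>A. A \<subseteq> S \<and> card A \<le> k \<and> nrm (tpoly (S - A) a) = best_rest S k" by auto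
  show "best_rest S k \<le> nrm (tpoly (S - A) a)" if "A \<subseteq> S" "card A \<le> k"
    unfolding best_rest_def using fin that by (intro Min_le) auto
qed

lemma best_rest_nonneg: "finite S \<Longrightarrow> 0 \<le> best_rest S k"
  using best_rest(1)[of S k] nrm_nonneg tpoly_in_X by (metis finite_Diff)

lemma best_rest_eq_0: "finite S \<Longrightarrow> card S \<le> k \<Longrightarrow> best_rest S k = 0"
  using best_rest(2)[of S S k] best_rest_nonneg[of S k] by simp

text \<open>The extra initial value 0 lets the sequence of deletions start from the whole missing
  part; the \<open>j\<close>-th phase deletes \<open>dyad (Suc j) = 2 ^ j\<close> elements.\<close>

definition dyad :: "nat \<Rightarrow> nat" where "dyad j = (if j = 0 then 0 else 2 ^ (j - 1))"

text \<open>\<open>L\<close> is the first index where the deletion norm \<open>E\<close> drops by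
  \<open>7 * U\<close>. Before it consecutive values are comparable, so each phase preserves the
  invariant that the residual is at most \<open>4 * E j\<close>; the large drop at \<open>L\<close>
  makes the residual small relative to \<open>E L\<close>. The projection bound then shows that the
  missing part has norm below \<open>E L\<close>, so more than \<open>dyad L\<close> frequencies
  must have been found, which pays for the steps.\<close>

lemma exhaust:
  assumes "card (rest m) = k"
  shows "res (m + 4 * Q * k) \<le> 2 * eps"
  using assms
proof (induction k arbitrary: m rule: less_induct)
  case (less k)
  show ?case
  proof (cases "k = 0 \<or> res m \<le> 2 * eps")
    case True
    then show ?thesis
    proof
      assume "k = 0"
      then show ?thesis using res_le_remaining[of m] less.prems eps_nonneg by simp
    next
      assume "res m \<le> 2 * eps"
      then show ?thesis using res_mono[of m "m + 4 * Q * k"] by simp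
    qed
  next
    case False
    then have k: "0 < k" and rm: "2 * eps < res m" by auto
    define E where "E j = best_rest (rest m) (dyad j)" for j
    have E0: "0 \<le> E j" for j by (simp add: E_def best_rest_nonneg)
    have E_zero: "E j = 0" if "k \<le> dyad j" for j
      using that less.prems by (simp add: E_def best_rest_eq_0)
    have "E 0 = nrm (tpoly (rest m) a)"
      using best_rest(1)[of "rest m" 0] by (auto simp: E_def dyad_def finite_subset)
    then have start: "res m \<le> 4 * E 0" using res_le_remaining[of m] rm E0[of 0] by linarith
    let ?P = "\<lambda>i. 7 * U * E (Suc i) \<le> E i"
    \<comment> \<open>Such an index exists: once \<open>k\<close> elements may be deleted, nothing
      is left and \<open>E\<close> vanishes.\<close>
    define L where "L = (LEAST i. ?P i)"
    have "k \<le> dyad (Suc k)" by (simp add: dyad_def order_less_imp_le)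
    then have "?P k" using E_zero[of "Suc k"] E0[of k] by simp
    then have PL: "?P L" unfolding L_def by (rule LeastI)
    have notP: "\<And>i. i < L \<Longrightarrow> \<not> ?P i"
      unfolding L_def by (rule not_less_Least)
    \<comment> \<open>Phase \<open>j\<close> takes \<open>2 ^ j * Q\<close> steps; the lengths of
      the phases before it add up to \<open>(2 ^ j - 1) * Q\<close>.\<close>
    have ph: "res (m + (2 ^ Suc j - 1) * Q) \<le> 2 * eps \<or> res (m + (2 ^ Suc j - 1) * Q) \<le> 4 * th"
      if j: "res (m + (2 ^ j - 1) * Q) \<le> 2 * eps \<or> res (m + (2 ^ j - 1) * Q) \<le> 4 * (7 * U) * th"
        and th: "E (Suc j) \<le> th" for j th
    proof -
      obtain A where A: "A \<subseteq> rest m" "card A \<le> 2 ^ j" "nrm (tpoly (rest m - A) a) = E (Suc j)"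
        using best_rest(1)[of "rest m" "dyad (Suc j)"] by (auto simp: E_def dyad_def)
      let ?m = "m + (2 ^ j - 1) * Q"
      have step: "?m + 2 ^ j * Q = m + (2 ^ Suc j - 1) * Q"
      proof -
        have "(2 ^ j - 1) + 2 ^ j = 2 ^ Suc j - (1::nat)" by simp
        then show ?thesis by (metis add.assoc add_mult_distrib)
      qed
      show ?thesis
      proof (cases "res ?m \<le> 2 * eps")
        case True
        moreover have "res (m + (2 ^ Suc j - 1) * Q) \<le> res ?m" unfolding step[symmetric] by (rule res_mono) simp
        ultimately show ?thesis by linarith
      next
        case False
        then show ?thesis
          using phase[of m ?m A "2 ^ j" th] A th j unfolding step by auto
      qed
    qed
    have upto: "j \<le> L \<Longrightarrow> res (m + (2 ^ j - 1) * Q) \<le> 2 * eps \<or> res (m + (2 ^ j - 1) * Q) \<le> 4 * E j" for j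
    proof (induction j)
      case 0
      then show ?case using start by simp
    next
      case (Suc j)
      have "E j \<le> 7 * U * E (Suc j)" using notP[of j] Suc.prems by simp
      then show ?case using Suc by (intro ph) auto
    qed
    define m' where "m' = m + (2 ^ Suc L - 1) * Q"
    \<comment> \<open>With this threshold the hypothesis of the phase is just the invariant at
      \<open>L\<close>, and the whole factor \<open>7 * U\<close> is gained.\<close>
    have end_phase: "res m' \<le> 2 * eps \<or> res m' \<le> 4 * (E L / (7 * U))"
      unfolding m'_def using upto[of L] PL U by (intro ph) (auto simp: field_simps)
    \<comment> \<open>By minimality of \<open>L\<close>, fewer than \<open>k\<close> elements were
      deleted at stage \<open>L\<close>, since otherwise \<open>E L\<close> would be 0 and the drop
      would have occurred earlier.\<close>
    have small: "2 ^ Suc L \<le> 4 * k"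
    proof (cases L)
      case (Suc i)
      have "\<not> k \<le> 2 ^ i"
      proof
        assume "k \<le> 2 ^ i"
        then have "E (Suc i) = 0" using E_zero[of "Suc i"] by (simp add: dyad_def)
        then show False using notP[of i] Suc E0[of i] by simp
      qed
      then show ?thesis using Suc by simp
    qed (use k in simp)
    show ?thesis
    proof (cases "res m' \<le> 2 * eps")
      case True
      have "(2 ^ Suc L - 1) * Q \<le> (4 * k) * Q" using small by (intro mult_right_mono) auto
      then have "m' \<le> m + 4 * Q * k" by (simp add: m'_def mult_ac)
      then show ?thesis using res_mono True by (meson order.trans)
    next
      case False
      then have r': "2 * eps < res m'" "res m' \<le> 4 * (E L / (7 * U))" using end_phase by auto
      have pos: "0 < res m'" using r' eps_nonneg by linarith
      \<comment> \<open>Here the 7 is used: (3/2) * 4 / 7 = 6/7 is less than 1.\<close>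
      have "nrm (tpoly (rest m') a) \<le> U * (eps + res m')" using pos by (intro nrm_remaining_le) auto
      also have "\<dots> \<le> U * (3/2 * res m')" using r' U by (intro mult_left_mono) auto
      also have "\<dots> \<le> U * (3/2 * (4 * (E L / (7 * U))))" using r' U by (intro mult_left_mono) auto
      also have "\<dots> = 6/7 * E L" using U by simp
      also have "\<dots> < E L"
      proof -
        have "0 < E L / (7 * U)" using pos r' by linarith
        then have "0 < E L" using U(1) by (simp add: zero_less_divide_iff)
        then show ?thesis by simp
      qed
      finally have less_E: "nrm (tpoly (rest m') a) < E L" .
      define R where "R = rest m - rest m'"
      have mm: "m \<le> m'" by (simp add: m'_def)
      have R: "R \<subseteq> rest m" "rest m - R = rest m'" using rest_mono[OF mm] by (auto simp: R_def)
      \<comment> \<open>If at most \<open>dyad L\<close> frequencies had been removed, they would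
        form a deletion better than the optimal one.\<close>
      have cR: "dyad L < card R"
      proof (rule ccontr)
        assume "\<not> ?thesis"
        then have "E L \<le> nrm (tpoly (rest m - R) a)" unfolding E_def using R by (intro best_rest) auto
        then show False using less_E R by simp
      qed
      have c1: "card (rest m') = k - card R" "card R \<le> k"
        using R less.prems card_Diff_subset[of R "rest m"] finite_subset[OF R(1)] card_mono[OF finite_Gam R(1)] by auto
      have "res (m' + 4 * Q * card (rest m')) \<le> 2 * eps"
        using less.IH[of "card (rest m')" m'] c1 cR by simp
      moreover have "m' + 4 * Q * card (rest m') \<le> m + 4 * Q * k"
      proof -
        \<comment> \<open>For \<open>L = 0\<close> one removed element pays for the single unit;
          otherwise \<open>card R\<close> exceeds a quarter of \<open>2 ^ Suc L\<close>.\<close>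
        have "2 ^ Suc L - 1 \<le> 4 * card R" using cR by (cases L) (auto simp: dyad_def)
        then have "(2 ^ Suc L - 1) * Q \<le> (4 * card R) * Q" by (intro mult_right_mono) auto
        moreover have "4 * Q * k = 4 * Q * card (rest m') + (4 * card R) * Q"
        proof -
          have kk: "k = card (rest m') + card R" using c1 by simp
          show ?thesis by (subst kk) (simp add: algebra_simps)
        qed
        ultimately show ?thesis by (simp add: m'_def)
      qed
      ultimately show ?thesis using res_mono by (meson order.trans)
    qed
  qed
qed

lemma res_final: "res (4 * Q * N) \<le> 2 * eps"
proof -
  have "res (0 + 4 * Q * card (rest 0)) \<le> 2 * eps" by (rule exhaust) simp
  moreover have "4 * Q * card (rest 0) \<le> 4 * Q * N" using card_Gam by simp
  ultimately show ?thesis using res_mono by (metis add_0 order.trans)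
qed

end

section \<open>Quantitative dual estimates\<close>

lemma powr_comparable:
  fixes x y k b :: real
  assumes "0 < x" "0 < y" "1 \<le> k" "x \<le> k * y" "y \<le> k * x"
  shows "x powr b \<le> k powr \<bar>b\<bar> * y powr b"
proof -
  have "k powr neg_part d \<le> k powr \<bar>b\<bar>" if "d = b \<or> d = - b" for d
    using assms that by (intro powr_mono) (auto simp: neg_part_def)
  then have "k powr neg_part b * y powr b \<le> k powr \<bar>b\<bar> * y powr b"
    "k powr neg_part (- b) * y powr b \<le> k powr \<bar>b\<bar> * y powr b"
    by (auto intro!: mult_right_mono)
  then show ?thesis
    using powr_le_scaled(1)[of x y k b] powr_le_scaled(2)[of y x k b] assms by linarith
qed

section \<open>The logarithm truncated below at 1\<close>

lemma lg_ge_1 [simp]: "1 \<le> lg x"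
  by (simp add: lg_def)

lemma lg_pos [simp]: "0 < lg x"
  using lg_ge_1[of x] by linarith

lemma lg_nonneg [simp]: "0 \<le> lg x" and lg_nonzero [simp]: "lg x \<noteq> 0"
  using lg_pos[of x] by linarith+

lemma ln_le_lg: "ln x \<le> lg x"
  by (simp add: lg_def)

lemma lg_mono: "0 < x \<Longrightarrow> x \<le> y \<Longrightarrow> lg x \<le> lg y"
  by (simp add: lg_def max.coboundedI2)

lemma ln_lg_le: "ln (lg x) \<le> lg x"
  by (rule order.trans[OF ln_le_minus_one]) auto

lemma lg_ratio_le:
  assumes "0 < n" "n \<le> N"
  shows "lg N \<le> logfac (exp 1) (n / N) * lg n"
proof -
  have "0 \<le> ln N - ln n" using assms by simp
  then have "ln N - ln n \<le> (ln N - ln n) * lg n" by (simp add: mult_le_cancel_left1)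
  moreover have "\<bar>ln (n / N)\<bar> = ln N - ln n" using assms by (simp add: ln_div)
  moreover have "logfac (exp 1) (n / N) * lg n = lg n + \<bar>ln (n / N)\<bar> * lg n"
    by (simp add: logfac_def distrib_right)
  ultimately have "logfac (exp 1) (n / N) * lg n \<ge> lg n + (ln N - ln n)" by simp
  moreover have "lg N \<le> lg n + (ln N - ln n)"
    using \<open>0 \<le> ln N - ln n\<close> by (auto simp: lg_def)
  ultimately show ?thesis by linarith
qed

lemma lg_powr_le:
  assumes "0 < e"
  obtains K where "1 \<le> K" "\<And>x. 1 \<le> x \<Longrightarrow> lg x powr b \<le> K * x powr e"
proof -
  obtain K where K: "1 \<le> K" "\<And>m. 0 < m \<Longrightarrow> m \<le> 1 \<Longrightarrow> m powr e * logfac (exp 1) m powr \<bar>b\<bar> \<le> K"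
    using logfac_powr_bounded[of "exp 1" e "\<bar>b\<bar>"] assms by auto
  show ?thesis
  proof (rule that[OF K(1)])
    fix x :: real assume x: "1 \<le> x"
    have "lg x \<le> logfac (exp 1) (1 / x) * lg 1" using lg_ratio_le[of 1 x] x by simp
    then have le: "lg x \<le> logfac (exp 1) (1 / x)" by (simp add: lg_def)
    have "lg x powr b \<le> lg x powr \<bar>b\<bar>" by (intro powr_mono) auto
    also have "\<dots> \<le> logfac (exp 1) (1 / x) powr \<bar>b\<bar>" using le by (intro powr_mono2) auto
    finally have "(1 / x) powr e * lg x powr b \<le> (1 / x) powr e * logfac (exp 1) (1 / x) powr \<bar>b\<bar>"
      by (intro mult_left_mono) auto
    also have "\<dots> \<le> K" using K(2)[of "1 / x"] x by simp
    finally show "lg x powr b \<le> K * x powr e" using x by (simp add: powr_divide field_simps)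
  qed
qed

text \<open>For negative \<open>b\<close> the function is monotone only up to a constant: a positive
  power of \<open>n / N\<close> beats the quotient of the logarithms.\<close>

lemma powr_lg_almost_mono:
  assumes "0 < e \<or> e = 0 \<and> 0 \<le> b"
  obtains K where "1 \<le> K" "\<And>n N. 1 \<le> n \<Longrightarrow> n \<le> N \<Longrightarrow> n powr e * lg n powr b \<le> K * (N powr e * lg N powr b)"
proof (cases "0 \<le> b")
  case True
  show ?thesis
  proof (rule that[of 1])
    fix n N :: real assume "1 \<le> n" "n \<le> N"
    then show "n powr e * lg n powr b \<le> 1 * (N powr e * lg N powr b)"
      using True assms by (auto intro!: mult_mono powr_mono2 lg_mono)
  qed simp
next
  case False
  then obtain K where K: "1 \<le> K" "\<And>m. 0 < m \<Longrightarrow> m \<le> 1 \<Longrightarrow> m powr e * logfac (exp 1) m powr (- b) \<le> K"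
    using logfac_powr_bounded[of "exp 1" e "- b"] assms by auto
  show ?thesis
  proof (rule that[OF K(1)])
    fix n N :: real assume n: "1 \<le> n" "n \<le> N"
    have "lg n powr b \<le> logfac (exp 1) (n / N) powr neg_part b * lg N powr b"
      using n by (intro powr_le_scaled lg_mono lg_ratio_le) auto
    then have "n powr e * lg n powr b \<le> n powr e * (logfac (exp 1) (n / N) powr (- b) * lg N powr b)"
      using False by (intro mult_left_mono) (auto simp: neg_part_def)
    also have "\<dots> = ((n / N) powr e * logfac (exp 1) (n / N) powr (- b)) * (N powr e * lg N powr b)"
      using n by (simp add: powr_divide)
    also have "\<dots> \<le> K * (N powr e * lg N powr b)"
      using K(2)[of "n / N"] n by (intro mult_right_mono) auto
    finally show "n powr e * lg n powr b \<le> K * (N powr e * lg N powr b)" .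
  qed
qed

context llogl
begin

lemma lg_le_ln_add:
  assumes "0 \<le> t" "ln x \<le> k * ln (c + t)" "1 / ln c \<le> k"
  shows "lg x \<le> k * ln (c + t)"
proof -
  have l: "0 < ln (c + t)" "ln c \<le> ln (c + t)" using lnc(2,3)[OF assms(1)] by auto
  have "1 \<le> (1 / ln c) * ln (c + t)" using l lnc(1) by (simp add: field_simps)
  also have "\<dots> \<le> k * ln (c + t)" using assms l by (intro mult_right_mono) auto
  finally show ?thesis using assms by (simp add: lg_def)
qed

lemma ln_add_comparable_lg:
  obtains k where "1 \<le> k" "\<And>x. 1 \<le> x \<Longrightarrow> ln (c + x) \<le> k * lg x" "\<And>x. 1 \<le> x \<Longrightarrow> lg x \<le> k * ln (c + x)"
proof -
  define k where "k = max (ln (1 + c) + 1) (max 1 (1 / ln c))"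
  have k: "ln (1 + c) + 1 \<le> k" "1 \<le> k" "1 / ln c \<le> k" by (auto simp: k_def)
  show ?thesis
  proof (rule that[OF k(2)])
    fix x :: real assume x: "1 \<le> x"
    have "c + x \<le> (1 + c) * x" using x c1 by (simp add: algebra_simps mult_le_cancel_left1)
    then have "ln (c + x) \<le> ln ((1 + c) * x)" using x c1 by (subst ln_le_cancel_iff) auto
    also have "\<dots> = ln (1 + c) + ln x" using x c1 by (subst ln_mult) auto
    also have "\<dots> \<le> ln (1 + c) * lg x + 1 * lg x"
      using ln_le_lg[of x] c1 by (intro add_mono) (auto simp: mult_le_cancel_left1)
    also have "\<dots> = (ln (1 + c) + 1) * lg x" by (simp add: algebra_simps)
    also have "\<dots> \<le> k * lg x" using k by (intro mult_right_mono) (auto intro: less_imp_le)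
    finally show "ln (c + x) \<le> k * lg x" .
    have l: "0 < ln (c + x)" "ln c \<le> ln (c + x)" using lnc(2,3)[of x] x by auto
    have "ln x \<le> 1 * ln (c + x)" using x c1 by simp
    also have "\<dots> \<le> k * ln (c + x)" using k l by (intro mult_right_mono) auto
    finally show "lg x \<le> k * ln (c + x)" using k x by (intro lg_le_ln_add) auto
  qed
qed

text \<open>The order of \<open>w(n)\<close>. For p < 2, and for p = 2 with \<alpha> < 0, it is the
  order of the inverse of \<Phi> at n; in the other cases it is the square root of n, coming from
  L2.\<close>

definition growth :: "real \<Rightarrow> real" where
  "growth n = n powr (1 / min p 2) * lg n powr (if p < 2 then - \<alpha> else if p = 2 then neg_part \<alpha> else 0)"

lemma growth_pos: "1 \<le> n \<Longrightarrow> 0 < growth n"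
  by (auto simp: growth_def)

lemma le_Phi_ratio:
  assumes "0 < T" "T \<le> s"
  shows "s \<le> T / Phi T * Phi s"
proof -
  have "Phi (T / s * s) \<le> T / s * Phi s" using assms by (intro Phi_scale_le) auto
  then have "Phi T \<le> T / s * Phi s" using assms by simp
  then have "s * Phi T \<le> s * (T / s * Phi s)" using assms by (intro mult_left_mono) auto
  then show ?thesis using assms Phi_pos[of T] by (simp add: field_simps)
qed

text \<open>Splits at the level \<open>T\<close>. Above it monotonicity of \<Phi>(s) / s gives the
  linear alternative; below it a comparison of s^2 with \<Phi>(s) is assumed.\<close>

lemma dual_bound_threshold:
  assumes T: "0 < T" "T / Phi T \<le> a" and sq: "\<And>s. 0 < s \<Longrightarrow> s \<le> T \<Longrightarrow> s^2 \<le> k * Phi s"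
    and k: "0 \<le> k" "0 < th" "1 \<le> n"
  shows "dual_bound (8 * (real n * a + th * k + real n / th)) n"
proof (rule dual_bound_split)
  show "0 \<le> a" using T Phi_pos[of T] by (smt (verit) divide_nonneg_pos)
  fix s :: real assume s: "0 \<le> s"
  show "s \<le> a * Phi s \<or> s^2 \<le> k * (1 + Phi s)"
  proof (cases "T \<le> s")
    case True
    have "s \<le> T / Phi T * Phi s" using True T by (intro le_Phi_ratio) auto
    also have "\<dots> \<le> a * Phi s" using T by (intro mult_right_mono) auto
    finally show ?thesis ..
  next
    case False
    have "s^2 \<le> k * Phi s" using sq[of s] s False by (cases "s = 0") auto
    also have "\<dots> \<le> k * (1 + Phi s)" using k by (intro mult_left_mono) auto
    finally show ?thesis ..
  qed
qed (use k in auto)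

lemma s_times_phi: "0 < s \<Longrightarrow> s * phi s = s powr p * ln (c + s) powr (\<alpha> * p)"
  by (simp add: phi_def powr_diff)

lemma dual_bound_supquadratic:
  assumes "2 \<le> p" "p = 2 \<Longrightarrow> 0 \<le> \<alpha>"
  obtains K where "1 \<le> K" "\<And>n. 1 \<le> n \<Longrightarrow> dual_bound (K * growth n) n"
proof -
  obtain D where D: "1 \<le> D" "\<And>t. 0 \<le> t \<Longrightarrow> t * phi t \<le> D * Phi t"
    using Phi_lower by blast
  obtain A where A: "1 \<le> A" "\<And>m. 0 < m \<Longrightarrow> m \<le> 1 \<Longrightarrow> m powr (p - 2) * logfac c m powr (p * neg_part \<alpha>) \<le> A"
  proof (cases "p = 2")
    case True
    then have "neg_part \<alpha> = 0" using assms by (simp add: neg_part_def)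
    then show ?thesis using True that[of 1] logfac_ge1[OF c1] by (simp add: order.strict_iff_order)
  next
    case False
    then show ?thesis
      using that logfac_powr_bounded[OF c1, of "p - 2" "p * neg_part \<alpha>"] assms by auto
  qed
  define k where "k = max 1 (A * D / phi 1)"
  have k: "1 \<le> k" "A * D / phi 1 \<le> k" by (auto simp: k_def)
  have split: "s^2 \<le> k * (1 + Phi s)" if s: "0 \<le> s" for s
  proof (cases "s \<le> 1")
    case True
    then have "s^2 \<le> 1 * (1 + 0)" using s by (simp add: power_le_one)
    also have "\<dots> \<le> k * (1 + Phi s)" using k by (intro mult_mono) auto
    finally show ?thesis .
  next
    case False
    then have s1: "1 < s" by simp
    let ?m = "1 / s" and ?E = "logfac c (1 / s) powr (p * neg_part \<alpha>)"
    have "phi (?m * s) \<le> ?m powr (p - 1) * ?E * phi s" using s1 by (intro phi_scale_down) auto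
    then have "s^2 * phi 1 \<le> s^2 * (?m powr (p - 1) * ?E * phi s)"
      using s1 by (intro mult_left_mono) auto
    also have "\<dots> = (?m powr (p - 2) * ?E) * (s * phi s)"
    proof -
      have "s^2 * ?m powr (p - 1) = s * ?m powr (p - 2)"
        using s1 by (simp add: powr_divide powr_diff power2_eq_square)
      then have "s^2 * ?m powr (p - 1) * (?E * phi s) = s * ?m powr (p - 2) * (?E * phi s)" by simp
      then show ?thesis by (simp only: mult_ac)
    qed
    also have "\<dots> \<le> A * (D * Phi s)" using A(2)[of ?m] A(1) D(2)[of s] s1 by (intro mult_mono[of "?m powr (p - 2) * ?E"]) auto
    finally have "s^2 \<le> (A * D / phi 1) * Phi s" using phi_pos[of 1] by (simp add: field_simps)
    also have "\<dots> \<le> k * (1 + Phi s)" using k by (intro mult_mono) auto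
    finally show ?thesis .
  qed
  show ?thesis
  proof (rule that[of "8 * (k + 1)"])
    show "1 \<le> 8 * (k + 1)" using k by simp
    fix n :: nat assume n: "1 \<le> n"
    have "dual_bound (8 * (real n * 0 + sqrt (real n) * k + real n / sqrt (real n))) n"
      using split k n by (intro dual_bound_split) auto
    moreover have "growth n = sqrt (real n)"
      using assms n by (auto simp: growth_def powr_half_sqrt neg_part_def min_def)
    moreover have "real n / sqrt (real n) = sqrt (real n)" by (simp add: real_div_sqrt)
    ultimately show "dual_bound (8 * (k + 1) * growth n) n" by (simp add: algebra_simps)
  qed
qed

text \<open>The level is \<open>T = n\<close>. Below it the logarithm in \<Phi> is at most of order
  lg n, so \<Phi> is quadratic up to this factor; the part above contributes only a power of lg
  n.\<close>

lemma dual_bound_quadratic: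
  assumes "p = 2" "\<alpha> < 0"
  obtains K where "1 \<le> K" "\<And>n. 1 \<le> n \<Longrightarrow> dual_bound (K * growth n) n"
proof -
  obtain D where D: "1 \<le> D" "\<And>t. 0 \<le> t \<Longrightarrow> t * phi t \<le> D * Phi t"
    using Phi_lower by blast
  obtain k where k: "1 \<le> k" "\<And>x. 1 \<le> x \<Longrightarrow> ln (c + x) \<le> k * lg x"
    using ln_add_comparable_lg by metis
  define b where "b = - \<alpha>"
  have b: "0 < b" using assms by (simp add: b_def)
  obtain H where H: "1 \<le> H" "\<And>x. 1 \<le> x \<Longrightarrow> lg x powr b \<le> H * x powr (1/2)"
    using lg_powr_le[of "1/2" b] by auto
  define A where "A = D * k powr (2 * b)"
  have "1 \<le> k powr (2 * b)" using k b by (intro ge_one_powr_ge_zero) auto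
  then have A: "1 \<le> A" using mult_mono[of 1 D 1 "k powr (2 * b)"] D by (auto simp: A_def)
  show ?thesis
  proof (rule that[of "8 * (A * H + A + 1)"])
    show "1 \<le> 8 * (A * H + A + 1)" using A H by (simp add: add_nonneg_nonneg)
    fix n :: nat assume n: "1 \<le> n"
    let ?n = "real n" and ?l = "lg n"
    have n1: "1 \<le> ?n" using n by simp
    have ll: "ln (c + s) powr (2 * b) \<le> k powr (2 * b) * ?l powr (2 * b)" if "0 \<le> s" "s \<le> ?n" for s
    proof -
      have "ln (c + s) \<le> ln (c + ?n)" using that c1 by simp
      also have "\<dots> \<le> k * ?l" by (rule k(2)[OF n1])
      finally have "ln (c + s) powr (2 * b) \<le> (k * ?l) powr (2 * b)"
        using b lnc(3)[OF that(1)] by (intro powr_mono2) auto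
      then show ?thesis using k by (simp add: powr_mult)
    qed
    have sq: "s^2 \<le> A * ?l powr (2 * b) * Phi s" if s: "0 < s" "s \<le> ?n" for s
    proof -
      have lpos: "0 < ln (c + s)" using lnc(3)[of s] s by simp
      have "s^2 = ln (c + s) powr (2 * b) * (s * phi s)"
        using s lpos assms unfolding s_times_phi[OF s(1)] by (simp add: b_def flip: powr_add)
      also have "\<dots> \<le> (k powr (2 * b) * ?l powr (2 * b)) * (D * Phi s)"
        using ll[of s] D(2)[of s] s by (intro mult_mono[of "ln (c + s) powr (2 * b)"]) auto
      finally show ?thesis by (simp add: A_def mult_ac)
    qed
    have nPhi: "?n / Phi ?n \<le> A * ?l powr (2 * b) / ?n"
      using sq[of ?n] n Phi_pos[of ?n] by (simp add: field_simps power2_eq_square)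
    \<comment> \<open>Balances the last two terms: \<open>th\<close> times the squared logarithmic
      factor and \<open>n / th\<close> both become of the order of \<open>growth n\<close>.\<close>
    define th where "th = sqrt ?n * ?l powr (- b)"
    have th: "0 < th" using n by (simp add: th_def)
    have "dual_bound (8 * (?n * (A * ?l powr (2 * b) / ?n) + th * (A * ?l powr (2 * b)) + ?n / th)) n"
      using sq nPhi A th n by (intro dual_bound_threshold) auto
    moreover have "8 * (?n * (A * ?l powr (2 * b) / ?n) + th * (A * ?l powr (2 * b)) + ?n / th)
        \<le> 8 * (A * H + A + 1) * growth ?n"
    proof -
      have growth: "growth ?n = sqrt ?n * ?l powr b"
        unfolding growth_def using assms n by (simp add: powr_half_sqrt neg_part_def b_def)
      have l2: "?l powr (2 * b) = ?l powr b * ?l powr b" by (simp flip: powr_add)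
      have "?n * (A * ?l powr (2 * b) / ?n) = A * (?l powr b * ?l powr b)" using n by (simp add: l2)
      also have "\<dots> \<le> A * ((H * ?n powr (1/2)) * ?l powr b)"
        using H(2)[OF n1] A by (intro mult_left_mono mult_right_mono) auto
      also have "\<dots> = A * H * growth ?n" using n by (simp add: growth powr_half_sqrt)
      finally have 1: "?n * (A * ?l powr (2 * b) / ?n) \<le> A * H * growth ?n" .
      have 2: "th * (A * ?l powr (2 * b)) = A * growth ?n"
        by (simp add: th_def growth mult_ac flip: powr_add)
      have "?n / th = (?n / sqrt ?n) * ?l powr b" by (simp add: th_def powr_minus field_simps)
      then have 3: "?n / th = growth ?n" by (simp add: growth real_div_sqrt)
      have "?n * (A * ?l powr (2 * b) / ?n) + th * (A * ?l powr (2 * b)) + ?n / th \<le> (A * H + A + 1) * growth ?n"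
        using 1 unfolding 2 3 distrib_right by linarith
      then show ?thesis unfolding mult.assoc[of 8] by (rule mult_left_mono) simp
    qed
    ultimately show "dual_bound (8 * (A * H + A + 1) * growth ?n) n" by (rule dual_bound_mono)
  qed
qed

text \<open>Up to constants \<open>growth n\<close> lies between n^(1/(2p)) and n^2, so its
  logarithm is comparable to that of n.\<close>

lemma ln_add_threshold:
  assumes "p < 2"
  obtains k where "1 \<le> k" "\<And>n. 1 \<le> n \<Longrightarrow> ln (c + growth n) \<le> k * lg n" "\<And>n. 1 \<le> n \<Longrightarrow> lg n \<le> k * ln (c + growth n)"
proof -
  have growth: "growth n = n powr (1 / p) * lg n powr (- \<alpha>)" for n using assms by (simp add: growth_def)
  obtain H where H: "1 \<le> H" "\<And>x. 1 \<le> x \<Longrightarrow> lg x powr (- \<alpha>) \<le> H * x powr 1"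
    using lg_powr_le[of 1 "- \<alpha>"] by auto
  obtain J where J: "1 \<le> J" "\<And>x. 1 \<le> x \<Longrightarrow> lg x powr \<alpha> \<le> J * x powr (1 / (2 * p))"
    using lg_powr_le[of "1 / (2 * p)" \<alpha>] p1 by auto
  define k where "k = max (ln (c + H) + 2) (max (2 * p * (1 + ln J / ln c)) (max 1 (1 / ln c)))"
  have k: "ln (c + H) + 2 \<le> k" "2 * p * (1 + ln J / ln c) \<le> k" "1 \<le> k" "1 / ln c \<le> k" by (auto simp: k_def)
  show ?thesis
  proof (rule that[OF k(3)])
    fix n :: real assume n: "1 \<le> n"
    have w0: "0 < growth n" by (rule growth_pos[OF n])
    have l: "0 < ln (c + growth n)" "ln c \<le> ln (c + growth n)" using lnc(2,3)[of "growth n"] w0 by auto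
    have "growth n \<le> n powr 1 * (H * n powr 1)"
      unfolding growth using n p1 H(2)[OF n] by (intro mult_mono powr_mono) auto
    then have "growth n \<le> H * n^2" using n by (simp add: power2_eq_square mult_ac)
    moreover have "c * 1 \<le> c * n^2" using n c1 by (intro mult_left_mono) auto
    ultimately have "c + growth n \<le> (c + H) * n^2" by (simp add: algebra_simps)
    then have "ln (c + growth n) \<le> ln ((c + H) * n^2)" using w0 c1 H n by (subst ln_le_cancel_iff) auto
    also have "\<dots> = ln (c + H) + 2 * ln n" using n c1 H by (subst ln_mult) (auto simp: ln_realpow)
    also have "\<dots> \<le> ln (c + H) * lg n + 2 * lg n"
      using ln_le_lg[of n] c1 H by (intro add_mono) (auto simp: mult_le_cancel_left1)
    also have "\<dots> = (ln (c + H) + 2) * lg n" by (simp add: algebra_simps)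
    also have "\<dots> \<le> k * lg n" using k by (intro mult_right_mono) (auto intro: less_imp_le)
    finally show "ln (c + growth n) \<le> k * lg n" .
    have "n powr (1 / p) = growth n * lg n powr \<alpha>" unfolding growth by (simp add: mult.assoc flip: powr_add)
    also have "\<dots> \<le> growth n * (J * n powr (1 / (2 * p)))" using J(2)[OF n] w0 by (intro mult_left_mono) auto
    finally have "n powr (1 / p) \<le> growth n * J * n powr (1 / (2 * p))" by simp
    moreover have "n powr (1 / p) = n powr (1 / (2 * p)) * n powr (1 / (2 * p))"
      using p1 by (simp flip: powr_add)
    ultimately have "n powr (1 / (2 * p)) \<le> growth n * J" using n by simp
    then have "ln (n powr (1 / (2 * p))) \<le> ln (growth n * J)" using n w0 J by (subst ln_le_cancel_iff) auto
    then have "ln n / (2 * p) \<le> ln (growth n) + ln J" using n w0 J by (simp add: ln_powr ln_mult)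
    also have "ln (growth n) \<le> ln (c + growth n)" using w0 c1 by simp
    also have "ln J \<le> ln J / ln c * ln (c + growth n)"
    proof -
      have "ln J / ln c * ln c \<le> ln J / ln c * ln (c + growth n)"
        using l J lnc(1) by (intro mult_left_mono divide_nonneg_pos) auto
      moreover have "ln J / ln c * ln c = ln J" using lnc(1) by simp
      ultimately show ?thesis by linarith
    qed
    finally have "ln n / (2 * p) \<le> (1 + ln J / ln c) * ln (c + growth n)" by (simp add: algebra_simps)
    then have "ln n \<le> (2 * p * (1 + ln J / ln c)) * ln (c + growth n)" using p1 by (simp add: field_simps)
    also have "\<dots> \<le> k * ln (c + growth n)" using k l by (intro mult_right_mono) auto
    finally show "lg n \<le> k * ln (c + growth n)" using k w0 by (intro lg_le_ln_add) auto
  qed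
qed

text \<open>The level \<open>T = growth n\<close> makes \<Phi>(T) at least of order n. As p < 2, s^2
  / \<Phi>(s) is almost increasing, so below the level the worst case is s = T.\<close>

lemma dual_bound_subquadratic:
  assumes "p < 2"
  obtains K where "1 \<le> K" "\<And>n. 1 \<le> n \<Longrightarrow> dual_bound (K * growth n) n"
proof -
  obtain D where D: "1 \<le> D" "\<And>t. 0 \<le> t \<Longrightarrow> t * phi t \<le> D * Phi t"
    using Phi_lower by blast
  obtain k where k: "1 \<le> k" "\<And>n. 1 \<le> n \<Longrightarrow> ln (c + growth n) \<le> k * lg n" "\<And>n. 1 \<le> n \<Longrightarrow> lg n \<le> k * ln (c + growth n)"
    using ln_add_threshold[OF assms] by metis
  obtain A where A: "1 \<le> A" "\<And>m. 0 < m \<Longrightarrow> m \<le> 1 \<Longrightarrow> m powr (2 - p) * logfac c m powr neg_part (- (\<alpha> * p)) \<le> A"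
    using logfac_powr_bounded[OF c1, of "2 - p" "neg_part (- (\<alpha> * p))"] assms by (auto simp: neg_part_def)
  define B where "B = k powr \<bar>\<alpha> * p\<bar>"
  have B: "1 \<le> B" using k by (simp add: B_def ge_one_powr_ge_zero)
  define E where "E = A * D * B"
  have "1 \<le> A * D" using A D mult_mono[of 1 A 1 D] by auto
  then have E: "1 \<le> E" "D * B \<le> E"
    using A B D mult_mono[of 1 "A * D" 1 B] mult_right_mono[of 1 A "D * B"] by (auto simp: E_def mult.assoc)
  show ?thesis
  proof (rule that[of "8 * (2 * E + 1)"])
    show "1 \<le> 8 * (2 * E + 1)" using E by simp
    fix n :: nat assume n: "1 \<le> n"
    have n1: "1 \<le> real n" using n by simp
    define T where "T = growth n"
    have T: "0 < T" using growth_pos[OF n1] by (simp add: T_def)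
    have nT: "real n \<le> B * (T * phi T)"
    proof -
      have "lg n powr (\<alpha> * p) \<le> B * ln (c + T) powr (\<alpha> * p)"
        unfolding B_def T_def using k n1 lnc(3)[of "growth n"] growth_pos[OF n1]
        by (intro powr_comparable) auto
      then have "T powr p * lg n powr (\<alpha> * p) \<le> T powr p * (B * ln (c + T) powr (\<alpha> * p))"
        by (intro mult_left_mono) auto
      moreover have "T powr p * lg n powr (\<alpha> * p) = real n"
        using assms p1 n by (simp add: T_def growth_def powr_mult powr_powr mult.assoc flip: powr_add)
      ultimately show ?thesis unfolding s_times_phi[OF T] by (simp add: mult_ac)
    qed
    have nPhi: "real n \<le> D * B * Phi T"
    proof -
      have "B * (T * phi T) \<le> B * (D * Phi T)" using D(2)[of T] B T by (intro mult_left_mono) auto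
      then show ?thesis using nT by (simp add: mult_ac)
    qed
    have TPhi: "T / Phi T \<le> E * T / real n"
    proof -
      have "T * real n \<le> T * (E * Phi T)"
      proof (rule mult_left_mono)
        have "D * B * Phi T \<le> E * Phi T" using E by (intro mult_right_mono) auto
        then show "real n \<le> E * Phi T" using nPhi by linarith
      qed (use T in auto)
      then show ?thesis using n Phi_pos[OF T] by (simp add: field_simps)
    qed
    have sq: "s^2 \<le> E * T^2 / real n * Phi s" if s: "0 < s" "s \<le> T" for s
    proof -
      define m where "m = s / T"
      have m: "0 < m" "m \<le> 1" "m * T = s" using s T by (auto simp: m_def)
      let ?L = "logfac c m powr neg_part (- (\<alpha> * p))"
      have "m powr (p - 1) * phi T \<le> ?L * phi (m * T)" using m T by (intro phi_scale_up) auto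
      then have "m powr (2 - p) * m * T * (m powr (p - 1) * phi T) \<le> m powr (2 - p) * m * T * (?L * phi (m * T))"
        using m T by (intro mult_left_mono) auto
      moreover have "m powr (2 - p) * m powr (p - 1) = m"
        using m by (simp flip: powr_add)
      then have "m powr (2 - p) * m * T * (m powr (p - 1) * phi T) = m * m * (T * phi T)"
        by (metis (no_types, lifting) mult.assoc mult.commute)
      moreover have "m powr (2 - p) * m * T * (?L * phi (m * T)) = (m powr (2 - p) * ?L) * (s * phi s)"
        unfolding m(3) using m(3) by (simp add: mult_ac)
      ultimately have "m^2 * (T * phi T) \<le> (m powr (2 - p) * ?L) * (s * phi s)"
        by (simp add: power2_eq_square)
      also have "\<dots> \<le> A * (D * Phi s)" using A(2)[of m] A(1) m D(2)[of s] s by (intro mult_mono[of "m powr (2 - p) * ?L"]) auto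
      finally have 1: "m^2 * (T * phi T) \<le> A * (D * Phi s)" .
      have "m^2 * real n \<le> m^2 * (B * (T * phi T))" using nT by (intro mult_left_mono) auto
      also have "\<dots> = B * (m^2 * (T * phi T))" by simp
      also have "\<dots> \<le> B * (A * (D * Phi s))" using 1 B by (intro mult_left_mono) auto
      also have "\<dots> = E * Phi s" by (simp add: E_def)
      finally have "m^2 * real n * T^2 \<le> E * Phi s * T^2" by (intro mult_right_mono) auto
      moreover have "m^2 * T^2 = s^2" using m(3) by (simp flip: power_mult_distrib)
      ultimately have "s^2 * real n \<le> E * Phi s * T^2" by (simp add: mult_ac)
      then show ?thesis using n by (simp add: field_simps)
    qed
    \<comment> \<open>With the parameter \<open>th = n / T\<close> all three terms are of order
      T.\<close>
    have "dual_bound (8 * (real n * (E * T / real n) + (real n / T) * (E * T^2 / real n) + real n / (real n / T))) n"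
      using sq TPhi E T n by (intro dual_bound_threshold) auto
    moreover have "8 * (real n * (E * T / real n) + (real n / T) * (E * T^2 / real n) + real n / (real n / T))
        = 8 * (2 * E + 1) * growth n"
      using n T by (simp add: T_def[symmetric] field_simps power2_eq_square)
    ultimately show "dual_bound (8 * (2 * E + 1) * growth n) n" by simp
  qed
qed

lemma dual_bound_growth:
  obtains K where "1 \<le> K" "\<And>n. 1 \<le> n \<Longrightarrow> dual_bound (K * growth n) n"
proof -
  consider "p < 2" | "p = 2" "\<alpha> < 0" | "2 \<le> p" "p = 2 \<Longrightarrow> 0 \<le> \<alpha>" by linarith
  then show ?thesis
    using dual_bound_subquadratic dual_bound_quadratic dual_bound_supquadratic that by cases blast+
qed

section \<open>Step sizes, rates and the projection constant\<close>

definition omega_exp :: real where "omega_exp = (if p \<le> 2 then p * neg_part \<alpha> else 0)"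

definition growth_exp :: real where "growth_exp = (if p < 2 then - \<alpha> else if p = 2 then neg_part \<alpha> else 0)"

definition q0 :: real where "q0 = min p 2"

definition rate_exp :: real where "rate_exp = (growth_exp * q0 + omega_exp) / (q0 - 1)"

text \<open>The scale at which \<open>\<omega>(\<lambda>)\<close> is comparable with \<open>\<lambda> / growth n\<close>, up to a constant.\<close>

definition scale :: "real \<Rightarrow> real" where
  "scale n = (lg n powr (- omega_exp) / growth n) powr (1 / (q0 - 1))"

text \<open>Designed so that \<open>n * rate n = growth n / scale n\<close>. Up to constants this is
  the number of steps that contract the error by a fixed factor while \<open>n\<close> frequencies
  matter.\<close>

definition rate :: "real \<Rightarrow> real" where
  "rate n = n powr (1 / (q0 - 1) - 1) * lg n powr rate_exp"

lemma omega_exp_nonneg: "0 \<le> omega_exp"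
  by (simp add: omega_exp_def)

lemma q0: "1 < q0" "q0 \<le> 2"
  using p1 by (auto simp: q0_def)

lemma omega_eq: "omega x = x powr q0 * logfac c x powr omega_exp"
  by (simp add: omega_def q0_def omega_exp_def)

lemma growth_eq: "growth n = n powr (1 / q0) * lg n powr growth_exp"
  by (simp add: growth_def q0_def growth_exp_def)

text \<open>Lets a step size be shrunk by a small constant: the remainder then shrinks faster than
  the step.\<close>

lemma omega_mult_le:
  assumes "0 < x" "0 < y"
  shows "omega (x * y) \<le> omega x * omega y"
proof -
  have "logfac c (x * y) powr omega_exp \<le> (logfac c x * logfac c y) powr omega_exp"
    using logfac_mult[OF c1 assms] logfac_ge1[OF c1, of "x * y"] omega_exp_nonneg by (intro powr_mono2) auto
  also have "\<dots> = logfac c x powr omega_exp * logfac c y powr omega_exp"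
    using logfac_ge1[OF c1, of x] logfac_ge1[OF c1, of y] by (intro powr_mult)
  finally have "(x * y) powr q0 * logfac c (x * y) powr omega_exp \<le> (x * y) powr q0 * (logfac c x powr omega_exp * logfac c y powr omega_exp)"
    by (intro mult_left_mono) auto
  then show ?thesis using assms by (simp add: omega_eq powr_mult mult_ac)
qed

lemma scale_pos: "1 \<le> n \<Longrightarrow> 0 < scale n"
  using growth_pos[of n] by (simp add: scale_def)

lemma ln_scale_le:
  assumes "1 \<le> n"
  shows "\<bar>ln (scale n)\<bar> \<le> (omega_exp + 1 / q0 + \<bar>growth_exp\<bar>) / (q0 - 1) * lg n"
proof -
  have l: "0 \<le> ln (lg n)" "ln (lg n) \<le> lg n" "0 \<le> ln n" "ln n \<le> lg n"
    using assms ln_lg_le ln_le_lg by auto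
  have lw: "ln (growth n) = ln n / q0 + growth_exp * ln (lg n)"
    using assms by (simp add: growth_eq ln_mult ln_powr)
  have "\<bar>- omega_exp * ln (lg n) - ln (growth n)\<bar> \<le> omega_exp * ln (lg n) + (ln n / q0 + \<bar>growth_exp\<bar> * ln (lg n))"
  proof -
    have "\<bar>omega_exp * ln (lg n)\<bar> = omega_exp * ln (lg n)" "\<bar>ln n / q0\<bar> = ln n / q0" "\<bar>growth_exp * ln (lg n)\<bar> = \<bar>growth_exp\<bar> * ln (lg n)"
      using l omega_exp_nonneg q0 by (auto simp: abs_mult)
    then show ?thesis unfolding lw by linarith
  qed
  also have "\<dots> \<le> omega_exp * lg n + (lg n / q0 + \<bar>growth_exp\<bar> * lg n)"
    using l omega_exp_nonneg q0 by (intro add_mono mult_left_mono divide_right_mono) auto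
  also have "\<dots> = (omega_exp + 1 / q0 + \<bar>growth_exp\<bar>) * lg n" by (simp add: algebra_simps)
  finally have *: "\<bar>- omega_exp * ln (lg n) - ln (growth n)\<bar> \<le> (omega_exp + 1 / q0 + \<bar>growth_exp\<bar>) * lg n" .
  have "ln (scale n) = (- omega_exp * ln (lg n) - ln (growth n)) / (q0 - 1)"
    using growth_pos[OF assms] by (simp add: scale_def ln_powr ln_div)
  then have "\<bar>ln (scale n)\<bar> = \<bar>- omega_exp * ln (lg n) - ln (growth n)\<bar> / (q0 - 1)" using q0 by simp
  also have "\<dots> \<le> (omega_exp + 1 / q0 + \<bar>growth_exp\<bar>) * lg n / (q0 - 1)"
    using * q0 by (intro divide_right_mono) auto
  finally show ?thesis by simp
qed

text \<open>The formula for \<open>scale\<close> balances the two sides with lg n in place of the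
  logarithm of \<open>scale n\<close>. Since \<open>scale n\<close> is a power of n times a power of
  lg n, the replacement costs only a constant.\<close>

lemma omega_scale_le:
  obtains K where "1 \<le> K" "\<And>n. 1 \<le> n \<Longrightarrow> omega (scale n) \<le> K * (scale n / growth n)"
proof -
  define A where "A = 1 + (omega_exp + 1 / q0 + \<bar>growth_exp\<bar>) / (q0 - 1) / ln c"
  have A: "1 \<le> A" using q0 omega_exp_nonneg lnc(1) by (simp add: A_def)
  show ?thesis
  proof (rule that[of "A powr omega_exp"])
    show "1 \<le> A powr omega_exp" using A omega_exp_nonneg by (simp add: ge_one_powr_ge_zero)
    fix n :: real assume n: "1 \<le> n"
    have "logfac c (scale n) \<le> 1 * lg n + (omega_exp + 1 / q0 + \<bar>growth_exp\<bar>) / (q0 - 1) * lg n / ln c"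
      unfolding logfac_def using ln_scale_le[OF n] lnc(1) by (intro add_mono divide_right_mono) auto
    also have "\<dots> = A * lg n" by (simp add: A_def algebra_simps)
    finally have "logfac c (scale n) powr omega_exp \<le> (A * lg n) powr omega_exp"
      using logfac_ge1[OF c1, of "scale n"] omega_exp_nonneg by (intro powr_mono2) auto
    also have "\<dots> = A powr omega_exp * lg n powr omega_exp" using A by (simp add: powr_mult)
    finally have L: "logfac c (scale n) powr omega_exp \<le> A powr omega_exp * lg n powr omega_exp" .
    have "scale n powr (q0 - 1) = lg n powr (- omega_exp) / growth n"
      using q0 growth_pos[OF n] by (simp add: scale_def powr_powr)
    moreover have "scale n powr q0 = scale n * scale n powr (q0 - 1)" using scale_pos[OF n] by (simp add: powr_diff)
    ultimately have "omega (scale n) = scale n * (lg n powr (- omega_exp) / growth n) * logfac c (scale n) powr omega_exp"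
      by (simp add: omega_eq)
    also have "\<dots> \<le> scale n * (lg n powr (- omega_exp) / growth n) * (A powr omega_exp * lg n powr omega_exp)"
      using L scale_pos[OF n] growth_pos[OF n] by (intro mult_left_mono) auto
    also have "\<dots> = A powr omega_exp * (scale n / growth n)" by (simp add: powr_minus field_simps)
    finally show "omega (scale n) \<le> A powr omega_exp * (scale n / growth n)" .
  qed
qed

text \<open>Allows one constant multiple of \<open>scale n\<close> to satisfy the restriction to
  step sizes at most 1/4 for all n.\<close>

lemma scale_bounded:
  obtains K where "1 \<le> K" "\<And>n. 1 \<le> n \<Longrightarrow> scale n \<le> K"
proof -
  define e where "e = 1 / q0 / (q0 - 1)"
  have e: "0 < e" using q0 by (simp add: e_def)
  obtain K where K: "1 \<le> K" "\<And>x. 1 \<le> x \<Longrightarrow> lg x powr ((- omega_exp - growth_exp) / (q0 - 1)) \<le> K * x powr e"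
    using lg_powr_le[OF e] by blast
  show ?thesis
  proof (rule that[OF K(1)])
    fix n :: real assume n: "1 \<le> n"
    have "lg n powr (- omega_exp) / growth n = lg n powr (- omega_exp - growth_exp) * n powr (- (1 / q0))"
      by (simp add: growth_eq powr_diff powr_minus field_simps)
    then have "scale n = lg n powr ((- omega_exp - growth_exp) / (q0 - 1)) * n powr (- e)"
      by (simp add: scale_def powr_mult powr_powr e_def)
    also have "\<dots> \<le> (K * n powr e) * n powr (- e)" using K(2)[OF n] by (intro mult_right_mono) auto
    also have "\<dots> = K" using n by (simp add: mult.assoc flip: powr_add)
    finally show "scale n \<le> K" .
  qed
qed

lemma scale_over_growth:
  assumes "1 \<le> n"
  shows "scale n / growth n = 1 / (n * rate n)"
proof -
  have q: "1 / q0 * (1 / (q0 - 1)) + 1 / q0 = 1 / (q0 - 1)" "growth_exp * (1 / (q0 - 1)) + omega_exp * (1 / (q0 - 1)) + growth_exp = rate_exp"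
  proof -
    define t where "t = q0 - 1"
    then have t: "0 < t" "q0 = t + 1" using q0 by auto
    have "0 < t + t * t" using t(1) by (intro add_pos_pos mult_pos_pos)
    moreover have "0 < t + (t * (t * t) + t * (t * 2))" using t(1) by (intro add_pos_pos mult_pos_pos) auto
    ultimately have t2: "t + t * t \<noteq> 0" "t + (t * (t * t) + t * (t * 2)) \<noteq> 0" by simp_all
    show "1 / q0 * (1 / (q0 - 1)) + 1 / q0 = 1 / (q0 - 1)" "growth_exp * (1 / (q0 - 1)) + omega_exp * (1 / (q0 - 1)) + growth_exp = rate_exp"
      unfolding rate_exp_def t(2) using t(1) t2 by (auto simp: field_simps)
  qed
  have "1 / scale n = growth n powr (1 / (q0 - 1)) * lg n powr (omega_exp * (1 / (q0 - 1)))"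
    using growth_pos[OF assms] by (simp add: scale_def powr_divide powr_mult powr_powr powr_minus field_simps)
  also have "\<dots> = n powr (1 / q0 * (1 / (q0 - 1))) * (lg n powr (growth_exp * (1 / (q0 - 1))) * lg n powr (omega_exp * (1 / (q0 - 1))))"
    unfolding growth_eq by (simp add: powr_mult powr_powr)
  finally have "1 / scale n * growth n = (n powr (1 / q0 * (1 / (q0 - 1))) * n powr (1 / q0))
      * (lg n powr (growth_exp * (1 / (q0 - 1))) * lg n powr (omega_exp * (1 / (q0 - 1))) * lg n powr growth_exp)"
    unfolding growth_eq by (simp only: mult_ac)
  also have "\<dots> = n powr (1 / (q0 - 1)) * lg n powr rate_exp"
    unfolding powr_add[symmetric] q ..
  also have "\<dots> = n * rate n" using assms by (simp add: rate_def powr_diff)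
  finally show ?thesis using growth_pos[OF assms] scale_pos[OF assms] by (simp add: field_simps)
qed

lemma rate_pos: "1 \<le> n \<Longrightarrow> 0 < rate n"
  by (simp add: rate_def)

text \<open>Makes a single time unit serve all phases with n \<le> N. The exponent of n is positive
  exactly for p < 2, the only range in which the exponent of the logarithm can be negative.\<close>

lemma rate_almost_mono:
  obtains K where "1 \<le> K" "\<And>n N. 1 \<le> n \<Longrightarrow> n \<le> N \<Longrightarrow> rate n \<le> K * rate N"
proof -
  have "0 < 1 / (q0 - 1) - 1 \<or> 1 / (q0 - 1) - 1 = 0 \<and> 0 \<le> rate_exp"
  proof (cases "p < 2")
    case True
    then show ?thesis using q0 by (simp add: q0_def field_simps)
  next
    case False
    then have "0 \<le> growth_exp" by (simp add: growth_exp_def neg_part_def)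
    then show ?thesis using False omega_exp_nonneg by (simp add: q0_def rate_exp_def)
  qed
  then show ?thesis using that powr_lg_almost_mono[of "1 / (q0 - 1) - 1" rate_exp] unfolding rate_def by blast
qed

text \<open>The step size is a small constant multiple of \<open>scale n\<close>: there gain and
  remainder have the same order, and the superlinearity of \<open>omega\<close> makes the remainder
  at most half of the gain.\<close>

lemma gain_exists:
  assumes "0 < d" "0 < Ks"
  obtains k where "0 < k" "\<And>n. 1 \<le> n \<Longrightarrow> \<exists>l. 0 < l \<and> l \<le> 1/4 \<and> k / (n * rate n) \<le> l * (d / growth n) - Ks * omega l"
proof -
  obtain A where A: "1 \<le> A" "\<And>n. 1 \<le> n \<Longrightarrow> omega (scale n) \<le> A * (scale n / growth n)"
    using omega_scale_le by blast
  obtain B where B: "1 \<le> B" "\<And>n. 1 \<le> n \<Longrightarrow> scale n \<le> B"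
    using scale_bounded by blast
  obtain D e where D: "1 \<le> D" "0 < e" "\<And>l. 0 < l \<Longrightarrow> l \<le> 1 \<Longrightarrow> omega l \<le> D * l * l powr e"
    using omega_superlinear by blast
  define x where "x = d / (2 * Ks * A * D)"
  have x: "0 < x" using assms A D by (simp add: x_def)
  \<comment> \<open>The first bound keeps the step below 1/4. The second makes the remainder at most
    \<open>y * d / 2 * r\<close>, half of the linear term.\<close>
  define y where "y = min (1 / (4 * B)) (x powr (1 / e))"
  have y: "0 < y" "y \<le> 1 / (4 * B)" "y \<le> x powr (1 / e)" using x B by (auto simp: y_def)
  have "1 / (4 * B) \<le> 1" using B by simp
  then have y1: "y \<le> 1" using y by linarith
  have ye: "y powr e \<le> x"
  proof -
    have "y powr e \<le> (x powr (1 / e)) powr e" using y D by (intro powr_mono2) auto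
    then show ?thesis using x D by (simp add: powr_powr)
  qed
  show ?thesis
  proof (rule that[of "y * d / 2"])
    show "0 < y * d / 2" using y assms by simp
    fix n :: real assume n: "1 \<le> n"
    define r where "r = scale n / growth n"
    have r: "0 < r" using scale_pos[OF n] growth_pos[OF n] by (simp add: r_def)
    have "omega (y * scale n) \<le> omega y * omega (scale n)" using y scale_pos[OF n] by (intro omega_mult_le)
    also have "\<dots> \<le> (D * y * y powr e) * (A * r)"
      using A(2)[OF n] D(3)[OF y(1) y1] D y unfolding r_def by (intro mult_mono) auto
    also have "\<dots> \<le> (D * y * x) * (A * r)"
      using ye D y A r by (intro mult_right_mono mult_left_mono) auto
    finally have "Ks * omega (y * scale n) \<le> Ks * ((D * y * x) * (A * r))" using assms by (intro mult_left_mono) auto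
    also have "\<dots> = y * d / 2 * r" using assms A D by (simp add: x_def)
    finally have 1: "Ks * omega (y * scale n) \<le> y * d / 2 * r" .
    have "y * scale n * (d / growth n) = y * d / 2 * r + y * d / 2 * r" by (simp add: r_def)
    with 1 have low: "y * d / 2 * r \<le> y * scale n * (d / growth n) - Ks * omega (y * scale n)"
      by (simp only: le_diff_eq add_le_cancel_left)
    have eq: "y * d / 2 / (n * rate n) = y * d / 2 * r"
      unfolding r_def scale_over_growth[OF n] by simp
    have quarter: "y * scale n \<le> 1/4"
    proof -
      have "y * scale n \<le> 1 / (4 * B) * B" using y B(2)[OF n] scale_pos[OF n] by (intro mult_mono) auto
      then show ?thesis using B by simp
    qed
    have "0 < y * scale n" using y scale_pos[OF n] by simp
    then show "\<exists>l. 0 < l \<and> l \<le> 1/4 \<and> y * d / 2 / (n * rate n) \<le> l * (d / growth n) - Ks * omega l"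
      unfolding eq using low quarter by blast
  qed
qed

text \<open>The order of the logarithm of the norm of partial sum projections onto \<open>n\<close> frequencies.\<close>

definition proj_log :: "real \<Rightarrow> real" where
  "proj_log n = (if p = 2 then (if \<alpha> = 0 then 1 else lg (lg n)) else lg n)"

lemma proj_log_ge_1: "1 \<le> proj_log n"
  by (simp add: proj_log_def)

section \<open>Norms of projections onto sets of frequencies\<close>

definition projection_bound :: "real \<Rightarrow> nat \<Rightarrow> bool" where
  "projection_bound U N \<longleftrightarrow> (\<forall>S A b. finite S \<longrightarrow> A \<subseteq> S \<longrightarrow> card A \<le> N \<longrightarrow> nrm (tpoly A b) \<le> U * nrm (tpoly S b))"

text \<open>Summing the norms of the individual terms and bounding the coefficients by duality gives
  a constant of order N^2. This is wasteful, but only its logarithm counts.\<close>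

lemma projection_bound_crude:
  obtains K where "1 \<le> K" "\<And>N. 1 \<le> N \<Longrightarrow> \<exists>U\<ge>1. projection_bound U N \<and> ln (7 * U) \<le> K * lg N"
proof -
  obtain W where W: "1 \<le> W" "\<And>n. 1 \<le> n \<Longrightarrow> dual_bound (W * growth n) n"
    using dual_bound_growth by blast
  obtain H where H: "1 \<le> H" "\<And>x. 1 \<le> x \<Longrightarrow> lg x powr growth_exp \<le> H * x powr 1"
    using lg_powr_le[of 1 growth_exp] by auto
  define B where "B = trig_bound"
  have B: "1 \<le> B" "nrm (trig i) \<le> B" for i
    using nrm_trig[of i] by (auto simp: B_def trig_bound_def)
  have WH: "1 \<le> W * H" "1 \<le> B * (W * H)"
    using W H B mult_mono[of 1 W 1 H] mult_mono[of 1 B 1 "W * H"] by auto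
  define K where "K = ln (7 * (B * (W * H))) + 2"
  have K: "1 \<le> K" using WH by (simp add: K_def)
  show ?thesis
  proof (rule that[OF K])
    fix N :: nat assume N: "1 \<le> N"
    then have N1: "1 \<le> real N" by simp
    define U where "U = B * (W * H) * real N ^ 2"
    have "1 \<le> real N ^ 2" using N1 by simp
    then have U1: "1 \<le> U" using WH mult_mono[of 1 "B * (W * H)" 1 "real N ^ 2"] by (simp add: U_def)
    have "growth N \<le> real N powr 1 * (H * real N powr 1)"
      unfolding growth_eq using N1 q0 H(2)[OF N1] by (intro mult_mono powr_mono) auto
    then have growth: "growth N \<le> H * real N ^ 2" using N1 by (simp add: power2_eq_square mult_ac)
    have "projection_bound U N"
      unfolding projection_bound_def
    proof (intro allI impI)
      fix S A :: "int set" and b :: "int \<Rightarrow> complex" assume S: "finite S" "A \<subseteq> S" "card A \<le> N"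
      have fA: "finite A" using S finite_subset by blast
      have n0: "0 \<le> nrm (tpoly S b)" using S by (intro nrm_nonneg) simp
      have "nrm (tpoly A b) \<le> (\<Sum>i\<in>A. nrm (\<lambda>x. b i * trig i x))"
        unfolding tpoly_def[abs_def] using fA by (intro nrm_sum) auto
      also have "\<dots> = (\<Sum>i\<in>A. cmod (b i) * nrm (trig i))" by (simp add: nrm_cmult)
      also have "\<dots> \<le> (\<Sum>i\<in>A. cmod (b i) * B)" using B by (intro sum_mono mult_left_mono) auto
      also have "\<dots> = B * (\<Sum>i\<in>A. cmod (b i))" by (simp add: sum_distrib_left mult.commute)
      also have "\<dots> \<le> B * (W * growth N * nrm (tpoly S b))"
        using B coefficient_sum_le[OF W(2)[OF N] S] by (intro mult_left_mono) auto
      also have "\<dots> \<le> B * (W * (H * real N ^ 2) * nrm (tpoly S b))"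
        using growth B W n0 by (intro mult_left_mono mult_right_mono) auto
      also have "\<dots> = U * nrm (tpoly S b)" by (simp add: U_def)
      finally show "nrm (tpoly A b) \<le> U * nrm (tpoly S b)" .
    qed
    moreover have "ln (7 * U) \<le> K * lg N"
    proof -
      have "ln (7 * U) = ln (7 * (B * (W * H)) * real N ^ 2)" by (simp only: U_def mult.assoc)
      also have "\<dots> = ln (7 * (B * (W * H))) + 2 * ln (real N)"
        using WH N1 by (subst ln_mult) (auto simp: ln_realpow)
      also have "\<dots> \<le> ln (7 * (B * (W * H))) * lg N + 2 * lg N"
        using ln_le_lg[of "real N"] WH by (intro add_mono) (auto simp: mult_le_cancel_left1)
      also have "\<dots> = K * lg N" by (simp add: K_def algebra_simps)
      finally show ?thesis .
    qed
    ultimately show "\<exists>U\<ge>1. projection_bound U N \<and> ln (7 * U) \<le> K * lg N" using U1 by blast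
  qed
qed

text \<open>A polynomial with at most \<open>N\<close> terms is at most \<open>N\<close> times the
  tested radius everywhere, so \<Phi> is evaluated only at arguments up to \<open>N\<close>. There
  it is a square times a power of lg N, and Parseval finishes.\<close>

lemma nrm_tpoly_le_l2:
  assumes "p = 2"
  obtains R where "1 \<le> R" "\<And>N A b. 1 \<le> N \<Longrightarrow> finite A \<Longrightarrow> card A \<le> N \<Longrightarrow>
     nrm (tpoly A b) \<le> R * lg N powr neg_part (- \<alpha>) * sqrt (\<Sum>i\<in>A. (cmod (b i))^2)"
proof -
  obtain k where k: "1 \<le> k" "\<And>x. 1 \<le> x \<Longrightarrow> ln (c + x) \<le> k * lg x"
    using ln_add_comparable_lg by metis
  define g where "g = neg_part (- \<alpha>)"
  have g: "0 \<le> g" by (simp add: g_def neg_part_def)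
  define H where "H = max 1 (max (k powr (2 * \<alpha>)) (ln c powr (2 * \<alpha>)))"
  have H: "1 \<le> H" "k powr (2 * \<alpha>) \<le> H" "ln c powr (2 * \<alpha>) \<le> H" by (auto simp: H_def)
  show ?thesis
  proof (rule that[of "8 * H"])
    show "1 \<le> 8 * H" using H by simp
    fix N :: nat and A :: "int set" and b :: "int \<Rightarrow> complex"
    assume N: "1 \<le> N" and A: "finite A" "card A \<le> N"
    define s where "s = sqrt (\<Sum>i\<in>A. (cmod (b i))^2)"
    have s2: "s^2 = (\<Sum>i\<in>A. (cmod (b i))^2)" by (simp add: s_def sum_nonneg)
    have s0: "0 \<le> s" by (simp add: s_def sum_nonneg)
    let ?l = "lg N"
    show "nrm (tpoly A b) \<le> 8 * H * ?l powr neg_part (- \<alpha>) * sqrt (\<Sum>i\<in>A. (cmod (b i))^2)"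
    proof (cases "s = 0")
      case True
      then have "\<forall>i\<in>A. b i = 0" using s2 A by (simp add: sum_nonneg_eq_0_iff)
      then have "tpoly A b = (\<lambda>_. 0)" by (simp add: tpoly_def fun_eq_iff)
      then show ?thesis using H by (simp add: sum_nonneg)
    next
      case False
      then have s: "0 < s" using s0 by simp
      \<comment> \<open>The radius for which the modular is at most 2 pi / (64 H), hence at most
        1.\<close>
      define r where "r = 8 * H * ?l powr g * s"
      have lg1: "1 \<le> ?l powr g" using g by (simp add: ge_one_powr_ge_zero)
      have r: "0 < r" using H s by (simp add: r_def)
      have sup: "cmod (tpoly A b x) \<le> real N * r" for x
      proof -
        have "(\<Sum>i\<in>A. cmod (b i)) \<le> sqrt (real (card A)) * s" unfolding s_def by (rule sum_cmod_le_l2)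
        also have "\<dots> \<le> real N * r"
        proof (rule mult_mono)
          have "sqrt (real (card A)) \<le> sqrt (real N)" using A by simp
          also have "\<dots> \<le> sqrt (real N * real N)"
          proof -
            have "real N * 1 \<le> real N * real N" using N by (intro mult_left_mono) auto
            then show ?thesis by (simp only: real_sqrt_le_iff mult_1_right)
          qed
          finally show "sqrt (real (card A)) \<le> real N" by simp
          have "1 * 1 * s \<le> (8 * H) * ?l powr g * s"
            using H lg1 s by (intro mult_right_mono mult_mono) auto
          then show "s \<le> r" by (simp add: r_def)
        qed (use s in auto)
        finally show ?thesis using cmod_tpoly_le[of A b x] by linarith
      qed
      have PhiU: "Phi t \<le> H * (?l powr g)^2 * t^2" if t: "0 \<le> t" "t \<le> real N" for t
      proof -
        have lt: "0 < ln (c + t)" "ln c \<le> ln (c + t)" using lnc(2,3)[OF t(1)] by auto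
        have "ln (c + t) powr (2 * \<alpha>) \<le> H * (?l powr g)^2"
        proof (cases "0 \<le> \<alpha>")
          case True
          have "ln (c + t) \<le> ln (c + real N)" using t c1 by simp
          also have "\<dots> \<le> k * ?l" using k N by simp
          finally have "ln (c + t) powr (2 * \<alpha>) \<le> (k * ?l) powr (2 * \<alpha>)"
            using lt True by (intro powr_mono2) auto
          also have "\<dots> = k powr (2 * \<alpha>) * ?l powr (2 * \<alpha>)" using k by (simp add: powr_mult)
          also have "\<dots> \<le> H * ?l powr (2 * \<alpha>)" using H by (intro mult_right_mono) auto
          also have "?l powr (2 * \<alpha>) = (?l powr g)^2"
            using True by (simp add: g_def neg_part_def power2_eq_square flip: powr_add)
          finally show ?thesis .
        next
          case False
          then have "ln (c + t) powr (2 * \<alpha>) \<le> ln c powr (2 * \<alpha>)"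
            using lt lnc(1) by (intro powr_mono2') auto
          also have "\<dots> \<le> H * 1" using H by simp
          also have "\<dots> \<le> H * (?l powr g)^2" using H lg1 by (intro mult_left_mono) auto
          finally show ?thesis .
        qed
        then have "t^2 * ln (c + t) powr (2 * \<alpha>) \<le> t^2 * (H * (?l powr g)^2)" by (intro mult_left_mono) auto
        moreover have "Phi t \<le> t^2 * ln (c + t) powr (2 * \<alpha>)"
        proof (cases "t = 0")
          case False
          then have "t * phi t = t powr p * ln (c + t) powr (\<alpha> * p)" using t by (intro s_times_phi) auto
          then show ?thesis using Phi_upper[OF t(1)] assms t False by (simp add: mult.commute)
        qed simp
        ultimately show ?thesis by (simp add: mult_ac)
      qed
      have X: "tpoly A b \<in> X" using A by simp
      have sqint: "integrable TM (\<lambda>x. (cmod (tpoly A b x))^2)"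
        using sup r by (intro torus_integrable_bounded[of _ "(real N * r)^2"]) (auto intro!: power_mono)
      have "modular (\<lambda>x. cmod (tpoly A b x) / r) \<le> (\<integral>x. (H * (?l powr g)^2 / r^2) * (cmod (tpoly A b x))^2 \<partial>TM)"
        unfolding modular_def
      proof (intro integral_mono X_integrable_div X r integrable_mult_right sqint)
        fix x
        have "Phi (cmod (tpoly A b x) / r) \<le> H * (?l powr g)^2 * (cmod (tpoly A b x) / r)^2"
          using sup[of x] r by (intro PhiU) (auto simp: pos_divide_le_eq)
        then show "Phi (cmod (tpoly A b x) / r) \<le> (H * (?l powr g)^2 / r^2) * (cmod (tpoly A b x))^2"
          by (simp add: power_divide)
      qed
      also have "\<dots> = (H * (?l powr g)^2 / r^2) * (2 * pi * s^2)"
        using integral_tpoly_square[OF A(1)] by (simp add: s2)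
      also have "\<dots> = 2 * pi / (64 * H)"
        using H s by (simp add: r_def power2_eq_square field_simps)
      also have "\<dots> \<le> 1" using H pi_less_4 by simp
      finally have "nrm (tpoly A b) \<le> r" using X r by (intro nrm_le)
      then show ?thesis by (simp add: r_def s_def g_def)
    qed
  qed
qed

text \<open>Restriction of coefficients does not increase the l2 norm used on both sides: one
  comparison costs the power \<alpha>+ of lg N, the other \<alpha>-, together |\<alpha>|. Taking
  logarithms leaves log log N, and a constant if \<alpha> = 0.\<close>

lemma projection_bound_L2:
  assumes "p = 2"
  obtains K where "1 \<le> K" "\<And>N. 1 \<le> N \<Longrightarrow> \<exists>U\<ge>1. projection_bound U N \<and> ln (7 * U) \<le> K * proj_log N"
proof -
  obtain W where W: "1 \<le> W" "\<And>n. 1 \<le> n \<Longrightarrow> dual_bound (W * growth n) n"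
    using dual_bound_growth by blast
  obtain R where R: "1 \<le> R" "\<And>N A b. 1 \<le> N \<Longrightarrow> finite A \<Longrightarrow> card A \<le> N \<Longrightarrow>
     nrm (tpoly A b) \<le> R * lg N powr neg_part (- \<alpha>) * sqrt (\<Sum>i\<in>A. (cmod (b i))^2)"
    using nrm_tpoly_le_l2[OF assms] by blast
  have RW: "1 \<le> R * W" using R W mult_mono[of 1 R 1 W] by auto
  define K where "K = ln (7 * (R * W)) + \<bar>\<alpha>\<bar> + 1"
  have K: "1 \<le> K" using RW by (simp add: K_def)
  show ?thesis
  proof (rule that[OF K])
    fix N :: nat assume N: "1 \<le> N"
    let ?l = "lg N"
    define U where "U = R * W * ?l powr \<bar>\<alpha>\<bar>"
    have "1 \<le> ?l powr \<bar>\<alpha>\<bar>" by (simp add: ge_one_powr_ge_zero)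
    then have U1: "1 \<le> U" using RW mult_mono[of 1 "R * W" 1 "?l powr \<bar>\<alpha>\<bar>"] by (simp add: U_def)
    have growth: "growth N / sqrt (real N) = ?l powr neg_part \<alpha>"
      unfolding growth_def using assms N by (simp add: powr_half_sqrt)
    have "projection_bound U N"
      unfolding projection_bound_def
    proof (intro allI impI)
      fix S A :: "int set" and b :: "int \<Rightarrow> complex" assume S: "finite S" "A \<subseteq> S" "card A \<le> N"
      have fA: "finite A" using S finite_subset by blast
      have "nrm (tpoly A b) \<le> R * ?l powr neg_part (- \<alpha>) * sqrt (\<Sum>i\<in>A. (cmod (b i))^2)"
        by (rule R(2)[OF N fA S(3)])
      also have "\<dots> \<le> R * ?l powr neg_part (- \<alpha>) * (W * growth N / sqrt (real N) * nrm (tpoly S b))"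
        using R coefficient_l2_le[OF W(2)[OF N] S N] by (intro mult_left_mono) auto
      also have "\<dots> = R * W * (?l powr neg_part (- \<alpha>) * (growth N / sqrt (real N))) * nrm (tpoly S b)" by simp
      also have "?l powr neg_part (- \<alpha>) * (growth N / sqrt (real N)) = ?l powr \<bar>\<alpha>\<bar>"
        unfolding growth powr_add[symmetric] by (simp add: neg_part_def max_def abs_if)
      finally show "nrm (tpoly A b) \<le> U * nrm (tpoly S b)" by (simp add: U_def)
    qed
    moreover have "ln (7 * U) \<le> K * proj_log N"
    proof -
      have "ln (7 * U) = ln (7 * (R * W)) + \<bar>\<alpha>\<bar> * ln ?l"
      proof -
        have "ln (7 * U) = ln (7 * (R * W) * ?l powr \<bar>\<alpha>\<bar>)" by (simp only: U_def mult.assoc)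
        also have "\<dots> = ln (7 * (R * W)) + ln (?l powr \<bar>\<alpha>\<bar>)" using RW by (subst ln_mult) auto
        finally show ?thesis by (simp add: ln_powr)
      qed
      also have "\<bar>\<alpha>\<bar> * ln ?l \<le> \<bar>\<alpha>\<bar> * proj_log N"
      proof (cases "\<alpha> = 0")
        case False
        then have "ln ?l \<le> proj_log N" unfolding proj_log_def using ln_le_lg[of ?l] assms by simp
        then show ?thesis by (intro mult_left_mono) auto
      qed simp
      also have "ln (7 * (R * W)) \<le> (ln (7 * (R * W)) + 1) * proj_log N"
      proof -
        have "ln (7 * (R * W)) * 1 \<le> (ln (7 * (R * W)) + 1) * proj_log N"
          using RW proj_log_ge_1[of "real N"] by (intro mult_mono) auto
        then show ?thesis by simp
      qed
      finally show ?thesis by (simp add: K_def algebra_simps)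
    qed
    ultimately show "\<exists>U\<ge>1. projection_bound U N \<and> ln (7 * U) \<le> K * proj_log N" using U1 by blast
  qed
qed

lemma projection_bound_exists:
  obtains K where "1 \<le> K" "\<And>N. 1 \<le> N \<Longrightarrow> \<exists>U\<ge>1. projection_bound U N \<and> ln (7 * U) \<le> K * proj_log N"
proof (cases "p = 2")
  case True
  then show ?thesis using projection_bound_L2 that by blast
next
  case False
  then have "proj_log n = lg n" for n by (simp add: proj_log_def)
  then show ?thesis using projection_bound_crude that by metis
qed

text \<open>Identifies the exponents. For p < 2 the power is 1 / (p - 1) = p' - 1. For p = 2 and
  \<alpha> < 0 the exponent 4 \<alpha>- arises as 2 \<alpha>- from the dual bound and 2 \<alpha>-
  from the modulus of smoothness.\<close>

lemma phiN_eq: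
  assumes "1 \<le> N"
  shows "phiN p \<alpha> C N = nat \<lfloor>C * (real N * rate N * proj_log N)\<rfloor>"
proof -
  have N: "0 < real N" using assms by simp
  have sub: "real N * rate N = real N powr (p / (p - 1) - 1) * lg N powr (p / (p - 1) * neg_part \<alpha> - p / (p - 1) * \<alpha>)"
    if "p < 2"
  proof -
    have pq: "q0 = p" using that by (simp add: q0_def)
    have "p / (p - 1) - 1 = 1 / (q0 - 1)" unfolding pq using p1 by (simp add: field_simps)
    moreover have "rate_exp = p / (p - 1) * neg_part \<alpha> - p / (p - 1) * \<alpha>"
      unfolding rate_exp_def pq using that by (simp add: growth_exp_def omega_exp_def diff_divide_distrib add_divide_distrib mult.commute)
    ultimately show ?thesis using N by (simp add: rate_def powr_diff)
  qed
  show ?thesis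
  proof (cases "p < 2")
    case True
    then show ?thesis using sub by (simp add: phiN_def proj_log_def)
  next
    case False
    then have "q0 = 2" by (simp add: q0_def)
    then have "rate N = lg N powr (2 * growth_exp + omega_exp)" using N by (simp add: rate_def rate_exp_def mult.commute)
    moreover have "2 * growth_exp + omega_exp = (if p = 2 then 4 * neg_part \<alpha> else 0)"
      using False by (simp add: growth_exp_def omega_exp_def)
    ultimately show ?thesis
      using False by (auto simp: phiN_def proj_log_def neg_part_def)
  qed
qed

section \<open>Choice of the constant\<close>

lemma almost_optimal:
  assumes tau: "0 < \<tau>" "\<tau> \<le> 1"
  obtains C where "1 < C" "\<And>f idx F G N. f \<in> X \<Longrightarrow> wcga Phi \<tau> f idx F G \<Longrightarrow> 1 \<le> N \<Longrightarrow>
     nrm (\<lambda>x. f x - G (phiN p \<alpha> C N) x) \<le> 2 * sigmaN Phi N f"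
proof -
  obtain Ks where Ks: "1 \<le> Ks" "smoothness_const Ks" using greedy_decrement by blast
  obtain W where W: "1 \<le> W" "\<And>n. 1 \<le> n \<Longrightarrow> dual_bound (W * growth n) n"
    using dual_bound_growth by blast
  obtain J where J: "1 \<le> J" "\<And>N. 1 \<le> N \<Longrightarrow> \<exists>U\<ge>1. projection_bound U N \<and> ln (7 * U) \<le> J * proj_log N"
    using projection_bound_exists by blast
  obtain H where H: "1 \<le> H" "\<And>n N. 1 \<le> n \<Longrightarrow> n \<le> N \<Longrightarrow> rate n \<le> H * rate N"
    using rate_almost_mono by blast
  define d where "d = \<tau> / (6 * W * trig_bound)"
  have tb: "1 \<le> trig_bound" by (simp add: trig_bound_def)
  have d: "0 < d" using tau W tb by (simp add: d_def)
  obtain k where k: "0 < k" "\<And>n. 1 \<le> n \<Longrightarrow> \<exists>l. 0 < l \<and> l \<le> 1/4 \<and> k / (n * rate n) \<le> l * (d / growth n) - Ks * omega l"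
    using gain_exists[OF d, of Ks] Ks by auto
  \<comment> \<open>The 4 is that of \<open>4 * Q * N\<close>, the summand \<open>4 * H\<close> pays
    for rounding \<open>Q\<close> up, and the final 1 ensures C > 1.\<close>
  define C where "C = 4 * (H / k * J) + 4 * H + 1"
  have C: "1 < C" using H k J by (simp add: C_def add_pos_pos)
  show ?thesis
  proof (rule that[OF C])
    fix f idx F G and N :: nat
    assume f: "f \<in> X" and run: "wcga Phi \<tau> f idx F G" and N: "1 \<le> N"
    have N1: "1 \<le> real N" using N by simp
    obtain U where U: "1 \<le> U" "projection_bound U N" "ln (7 * U) \<le> J * proj_log N"
      using J(2)[OF N] by blast
    \<comment> \<open>The factor \<open>H\<close> compensates for \<open>rate\<close> being only
      almost increasing, so the same \<open>M\<close> works for every n \<le> N.\<close>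
    define M where "M = H / k * rate N"
    have rN: "0 < rate N" by (rule rate_pos[OF N1])
    have M: "0 < M" using H k rN by (simp add: M_def)
    define Q where "Q = nat \<lceil>M * ln (7 * U)\<rceil>"
    have Q: "M * ln (7 * U) \<le> real Q" unfolding Q_def by linarith
    have lnU: "0 \<le> ln (7 * U)" using U by simp
    have "real Q \<le> M * ln (7 * U) + 1"
      unfolding Q_def using M lnU mult_nonneg_nonneg[of M "ln (7 * U)"] by linarith
    also have "\<dots> \<le> M * (J * proj_log N) + H * rate N * proj_log N"
    proof (rule add_mono)
      show "M * ln (7 * U) \<le> M * (J * proj_log N)" using U M by (intro mult_left_mono) auto
      have "rate 1 \<le> H * rate N" using H(2)[of 1 "real N"] N1 by simp
      then have "1 \<le> H * rate N" by (simp add: rate_def lg_def)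
      then show "1 \<le> H * rate N * proj_log N"
        using proj_log_ge_1[of "real N"] mult_mono[of 1 "H * rate N" 1 "proj_log N"] by simp
    qed
    also have "\<dots> = (H / k * J + H) * (rate N * proj_log N)"
      by (simp add: M_def algebra_simps)
    finally have "4 * real Q * real N \<le> 4 * ((H / k * J + H) * (rate N * proj_log N)) * real N"
      by (intro mult_right_mono mult_left_mono) auto
    also have "\<dots> = (C - 1) * (real N * rate N * proj_log N)"
      by (simp add: C_def algebra_simps)
    also have "\<dots> \<le> C * (real N * rate N * proj_log N)"
      using rN N1 proj_log_ge_1[of "real N"] by (intro mult_right_mono) auto
    finally have "real (4 * Q * N) \<le> C * (real N * rate N * proj_log N)" by simp
    then have steps: "4 * Q * N \<le> phiN p \<alpha> C N" unfolding phiN_eq[OF N] by (rule le_nat_floor)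
    interpret greedy_run p \<alpha> c \<tau> f idx F G
      using tau f run by unfold_locales
    have bound: "res (phiN p \<alpha> C N) \<le> 2 * nrm (\<lambda>x. f x - g x)" if g: "g \<in> SigmaN N" for g
    proof -
      obtain S a where S: "finite S" "card S \<le> N" "g = tpoly S a"
        using g by (auto simp: SigmaN_def tpoly_def[abs_def])
      interpret greedy_target p \<alpha> c \<tau> f idx F G Ks N "\<lambda>n. W * growth n" U M Q S a
      proof
        fix n :: nat assume n: "1 \<le> n" "n \<le> N"
        then have n1: "1 \<le> real n" "real n \<le> real N" by auto
        show "0 < W * growth n" using W growth_pos[OF n1(1)] by simp
        obtain l where l: "0 < l" "l \<le> 1/4" "k / (real n * rate n) \<le> l * (d / growth n) - Ks * omega l"
          using k(2)[OF n1(1)] by blast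
        have "1 / (real n * M) = k / (real n * (H * rate N))" using k by (simp add: M_def)
        also have "\<dots> \<le> k / (real n * rate n)"
          using H n1 k rate_pos[OF n1(1)] rN by (intro divide_left_mono mult_left_mono mult_pos_pos H(2)) auto
        also have "\<dots> \<le> l * (d / growth n) - Ks * omega l" by (rule l(3))
        also have "d / growth n = \<tau> / (6 * (W * growth n) * trig_bound)" by (simp add: d_def)
        finally show "\<exists>l. 0 < l \<and> l \<le> 1/4 \<and>
            1 / (real n * M) \<le> l * (\<tau> / (6 * (W * growth n) * trig_bound)) - Ks * omega l"
          using l by blast
      qed (use Ks N W U M Q S in \<open>auto simp: projection_bound_def\<close>)
      show ?thesis using res_final res_mono[OF steps] S(3) by (simp add: eps_def)
    qed
    \<comment> \<open>The zero polynomial shows that the infimum is over a nonempty set; the bound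
      for every competitor then passes to it.\<close>
    have "(\<lambda>x. 0) \<in> SigmaN N" by (auto simp: SigmaN_def intro!: exI[of _ "{}"])
    then have "res (phiN p \<alpha> C N) / 2 \<le> sigmaN Phi N f"
      unfolding sigmaN_def using bound by (intro cInf_greatest) (auto simp: field_simps)
    then show "nrm (\<lambda>x. f x - G (phiN p \<alpha> C N) x) \<le> 2 * sigmaN Phi N f" by (simp add: res_def)
  qed
qed

end

theorem theorem5:
  fixes p \<alpha> c \<tau> :: real
  assumes "1 < p" and "1 < c" and "young_function (PhiLL p \<alpha> c)"
    and "0 < \<tau>" and "\<tau> \<le> 1"
  shows "\<exists>C>1. \<forall>f \<in> orlicz (PhiLL p \<alpha> c). \<forall>idx F G.
           wcga (PhiLL p \<alpha> c) \<tau> f idx F G \<longrightarrow>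
           (\<forall>N\<ge>2. lux (PhiLL p \<alpha> c) (\<lambda>x. f x - G (phiN p \<alpha> C N) x)
                    \<le> 2 * sigmaN (PhiLL p \<alpha> c) N f)"
proof -
  interpret llogl p \<alpha> c using assms by unfold_locales
  obtain C where "1 < C" "\<And>f idx F G N. f \<in> X \<Longrightarrow> wcga Phi \<tau> f idx F G \<Longrightarrow> 1 \<le> N \<Longrightarrow>
     nrm (\<lambda>x. f x - G (phiN p \<alpha> C N) x) \<le> 2 * sigmaN Phi N f"
    using almost_optimal[OF assms(4,5)] by blast
  then show ?thesis by (intro exI[of _ C]) auto
qed

end
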